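(* Let $p=O(1)$ as $n\to\infty$, $0<\alpha<p$, and $f_0\in\mathcal H^\alpha_p$ with $\|f_0\|_\infty\le F$. Let $L\asymp\log n$ and use the adaptive prior described in the context (which does not depend on $\alpha$). Then there is $\delta>1$ such that with $\xi_n=n^{-\alpha/(2\alpha+p)}\log^\delta n$, $$\Pi\big(f\in\mathcal F(L):\|f-f_0\|_L>M_n\xi_n\mid\bm Y^{(n)}\big)\to0$$ in $\mathbb P_0^n$-probability as $n\to\infty$, for every sequence $M_n\to\infty$.
   Context: Data: fixed covariates $\bm x_1,\dots,\bm x_n\in[0,1]^p$ and responses $Y_i=f_0(\bm x_i)+\epsilon_i$, $\epsilon_i$ i.i.d. $N(0,1)$; $\mathbb P_0^n$ is the law of $\bm Y^{(n)}=(Y_1,\dots,Y_n)$ under this model. $\mathcal H^\alpha_p$ denotes the $\alpha$-Hölder smooth functions on $[0,1]^p$. $\|g\|_L^2=\frac1n\sum_{i=1}^n g(\bm x_i)^2$. ReLU networks: for $L\in\mathbb N$ and $\mathbf p=(p_0,\dots,p_{L+1})$ with $p_0=p$, $p_{L+1}=1$, a network is $f(\bm x)=W_{L+1}\sigma_{b_L}(W_L\sigma_{b_{L-1}}(\cdots\sigma_{b_1}(W_1\bm x)))+b_{L+1}$, with $W_l\in\mathbb R^{p_l\times p_{l-1}}$, $b_l\in\mathbb R^{p_l}$ for $l\le L$, $b_{L+1}\in\mathbb R$, and $\sigma_b(v)=\max(v+b,0)$ componentwise. All parameters are stacked (layers from bottom to top) into $\beta=(\beta_1,\dots,\beta_T)$,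 $T=\sum_{l=0}^{L}p_{l+1}(p_l+1)$, so the last $p_L+1$ coordinates are the top-layer parameters $(W_{L+1},b_{L+1})$. $\mathcal F(L,\mathbf p,s)$ is the set of such networks with at most $s$ nonzero parameters and $\|f\|_\infty\le F$, for a fixed constant $F>0$. Prior (spike-and-slab with fully connected top layer), given $(L,\mathbf p,s)$: a connectivity vector $\gamma\in\{0,1\}^T$ has $\gamma_j=1$ for all $j>T-p_L-1$ and is uniformly distributed over all such vectors with $|\gamma|=s$. Given $\gamma$, independently: $\beta_j=0$ if $\gamma_j=0$; $\beta_j\sim\mathrm{Uniform}[-1,1]$ if $\gamma_j=1$ and $j\le T-p_L-1$; $\beta_j\sim N(0,1)$ if $j>T-p_L-1$; restricted to $\mathcal F(L,\mathbf p,s)$. Adaptive prior: the width parameter $N\in\{1,2,\dots\}$ has prior $\pi(N)=\lambda^N/((e^\lambda-1)N!)$ for a constant $\lambda>0$; given $N$ the widths are $\mathbf p^L_N=(p,12pN,\dots,12pN,1)\in\mathbb N^{L+2}$; the sparsity level $s$ has prior $\pi(s)\propto e^{-\lambda_s s}$ for a constant $\lambda_s>0$; given $(N,s)$ the network has the spike-and-slab prior above on $\mathcal F(L,\mathbf p_N^L,s)$. The parameter space is $\mathcal F(L)=\bigcup_{N\ge1}\bigcup_{s}\mathcal F(L,\mathbf p_N^L,s)$; $\Pi(\cdot\mid\bm Y^{(n)})$ is the posterior. *)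

theory Defs
  imports "HOL-Probability.Probability"
begin

type_synonym param = "nat \<times> nat \<times> nat \<Rightarrow> real"

definition cube :: "nat \<Rightarrow> (nat \<Rightarrow> real) set" where
  "cube p = {x. \<forall>i. (i < p \<longrightarrow> 0 \<le> x i \<and> x i \<le> 1) \<and> (p \<le> i \<longrightarrow> x i = 0)}"

definition has_partial :: "nat \<Rightarrow> ((nat \<Rightarrow> real) \<Rightarrow> real) \<Rightarrow> (nat \<Rightarrow> real) \<Rightarrow> real \<Rightarrow> bool" where
  "has_partial i g x d \<longleftrightarrow> ((\<lambda>t. g (x(i := t))) has_real_derivative d) (at (x i) within {0..1})"

definition partial :: "nat \<Rightarrow> ((nat \<Rightarrow> real) \<Rightarrow> real) \<Rightarrow> (nat \<Rightarrow> real) \<Rightarrow> real" where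
  "partial i g x = (SOME d. has_partial i g x d)"

fun pdiff :: "nat list \<Rightarrow> ((nat \<Rightarrow> real) \<Rightarrow> real) \<Rightarrow> (nat \<Rightarrow> real) \<Rightarrow> real" where
  "pdiff [] g = g"
| "pdiff (i # is) g = partial i (pdiff is g)"

definition dist_inf :: "nat \<Rightarrow> (nat \<Rightarrow> real) \<Rightarrow> (nat \<Rightarrow> real) \<Rightarrow> real" where
  "dist_inf p x y = Max ((\<lambda>i. \<bar>x i - y i\<bar>) ` {..<p})"

definition hoelder :: "nat \<Rightarrow> real \<Rightarrow> ((nat \<Rightarrow> real) \<Rightarrow> real) \<Rightarrow> bool" where
  "hoelder p \<alpha> g \<longleftrightarrow>
     (let m = nat (\<lceil>\<alpha>\<rceil> - 1) in
       (\<forall>is. set is \<subseteq> {..<p} \<and> length is < m \<longrightarrow>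
           (\<forall>i<p. \<forall>x\<in>cube p. \<exists>d. has_partial i (pdiff is g) x d)) \<and>
       (\<exists>K. (\<forall>is. set is \<subseteq> {..<p} \<and> length is \<le> m \<longrightarrow>
                 (\<forall>x\<in>cube p. \<bar>pdiff is g x\<bar> \<le> K)) \<and>
            (\<forall>is. set is \<subseteq> {..<p} \<and> length is = m \<longrightarrow>
                 (\<forall>x\<in>cube p. \<forall>y\<in>cube p.
                    \<bar>pdiff is g x - pdiff is g y\<bar> \<le> K * dist_inf p x y powr (\<alpha> - real m)))))"

text \<open>Parameter (l, j, k), 1 <= l <= L+1, j < p_l: for k < p_(l-1) it is the weight
  W_l[j,k]; for k = p_(l-1) it is the bias b_l[j].\<close>

definition width :: "nat \<Rightarrow> nat \<Rightarrow> nat \<Rightarrow> nat \<Rightarrow> nat" where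
  "width p L N l = (if l = 0 then p else if l = Suc L then 1 else 12 * p * N)"

fun hidden :: "(nat \<Rightarrow> nat) \<Rightarrow> param \<Rightarrow> nat \<Rightarrow> (nat \<Rightarrow> real) \<Rightarrow> nat \<Rightarrow> real" where
  "hidden w \<beta> 0 x = x"
| "hidden w \<beta> (Suc l) x =
     (\<lambda>j. max ((\<Sum>k<w l. \<beta> (Suc l, j, k) * hidden w \<beta> l x k) + \<beta> (Suc l, j, w l)) 0)"

definition relu_net :: "nat \<Rightarrow> (nat \<Rightarrow> nat) \<Rightarrow> param \<Rightarrow> (nat \<Rightarrow> real) \<Rightarrow> real" where
  "relu_net L w \<beta> x = (\<Sum>k<w L. \<beta> (Suc L, 0, k) * hidden w \<beta> L x k) + \<beta> (Suc L, 0, w L)"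

definition par_idx :: "nat \<Rightarrow> (nat \<Rightarrow> nat) \<Rightarrow> (nat \<times> nat \<times> nat) set" where
  "par_idx L w = {(l, j, k). 1 \<le> l \<and> l \<le> Suc L \<and> j < w l \<and> k \<le> w (l - 1)}"

definition top_idx :: "nat \<Rightarrow> (nat \<Rightarrow> nat) \<Rightarrow> (nat \<times> nat \<times> nat) set" where
  "top_idx L w = {(l, j, k) \<in> par_idx L w. l = Suc L}"

definition sup_bounded :: "nat \<Rightarrow> real \<Rightarrow> ((nat \<Rightarrow> real) \<Rightarrow> real) \<Rightarrow> bool" where
  "sup_bounded p F f \<longleftrightarrow> (\<forall>x\<in>cube p. \<bar>f x\<bar> \<le> F)"

text \<open>The parameter space F(L) = union over N >= 1 and s of F(L, p_N^L, s).\<close>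
definition relu_space :: "nat \<Rightarrow> nat \<Rightarrow> real \<Rightarrow> ((nat \<Rightarrow> real) \<Rightarrow> real) set" where
  "relu_space p L F = {f. \<exists>N \<beta>. N \<ge> 1 \<and> (\<forall>j. j \<notin> par_idx L (width p L N) \<longrightarrow> \<beta> j = 0) \<and>
       sup_bounded p F (relu_net L (width p L N) \<beta>) \<and> f = relu_net L (width p L N) \<beta>}"

definition conn_sets :: "nat \<Rightarrow> (nat \<Rightarrow> nat) \<Rightarrow> nat \<Rightarrow> (nat \<times> nat \<times> nat) set set" where
  "conn_sets L w s = {\<gamma>. \<gamma> \<subseteq> par_idx L w \<and> top_idx L w \<subseteq> \<gamma> \<and> card \<gamma> = s}"

definition slab_measure :: "nat \<Rightarrow> (nat \<Rightarrow> nat) \<Rightarrow> (nat \<times> nat \<times> nat) set \<Rightarrow> param measure" where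
  "slab_measure L w \<gamma> = PiM \<gamma> (\<lambda>j. if j \<in> top_idx L w then density lborel std_normal_density
                                     else uniform_measure lborel {-1..1::real})"

definition ext0 :: "(nat \<times> nat \<times> nat) set \<Rightarrow> param \<Rightarrow> param" where
  "ext0 \<gamma> \<beta> = (\<lambda>j. if j \<in> \<gamma> then \<beta> j else 0)"

text \<open>Integral of G against the (unrestricted) spike-and-slab prior given (L, widths, s):
  gamma uniform over the admissible connectivity sets; 0 if there is none.\<close>
definition ss_int :: "nat \<Rightarrow> (nat \<Rightarrow> nat) \<Rightarrow> nat \<Rightarrow> (param \<Rightarrow> ennreal) \<Rightarrow> ennreal" where
  "ss_int L w s G =
     (if conn_sets L w s = {} then 0
      else (\<Sum>\<gamma>\<in>conn_sets L w s. \<integral>\<^sup>+ \<beta>. G (ext0 \<gamma> \<beta>) \<partial>slab_measure L w \<gamma>)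
           / of_nat (card (conn_sets L w s)))"

definition cond_prior_int :: "nat \<Rightarrow> nat \<Rightarrow> real \<Rightarrow> (nat \<Rightarrow> nat) \<Rightarrow> nat \<Rightarrow> (param \<Rightarrow> ennreal) \<Rightarrow> ennreal" where
  "cond_prior_int p L F w s G =
     ss_int L w s (\<lambda>\<beta>. (if sup_bounded p F (relu_net L w \<beta>) then 1 else 0) * G \<beta>)
     / ss_int L w s (\<lambda>\<beta>. if sup_bounded p F (relu_net L w \<beta>) then 1 else 0)"

definition pi_N :: "real \<Rightarrow> nat \<Rightarrow> real" where
  "pi_N lam N = lam ^ N / ((exp lam - 1) * fact N)"

text \<open>Integral of G (depending on N and the parameter) against the adaptive prior, up to
  a global normalising constant (which cancels in the posterior): weight
  pi(N) * exp(-lambda_s s) on the admissible pairs (N, s), N >= 1.\<close>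
definition prior_int :: "nat \<Rightarrow> nat \<Rightarrow> real \<Rightarrow> real \<Rightarrow> real \<Rightarrow> (nat \<Rightarrow> param \<Rightarrow> ennreal) \<Rightarrow> ennreal" where
  "prior_int p L F lam lams G =
     (\<Sum>N. \<Sum>s. ennreal (pi_N lam (Suc N) * exp (- lams * real s)) *
               cond_prior_int p L F (width p L (Suc N)) s (G (Suc N)))"

definition lik :: "(nat \<Rightarrow> nat \<Rightarrow> nat \<Rightarrow> real) \<Rightarrow> nat \<Rightarrow> (nat \<Rightarrow> real) \<Rightarrow> ((nat \<Rightarrow> real) \<Rightarrow> real) \<Rightarrow> ennreal" where
  "lik X n Y f = ennreal (exp (- (\<Sum>i<n. (Y i - f (X n i))\<^sup>2) / 2))"

definition posterior :: "nat \<Rightarrow> nat \<Rightarrow> real \<Rightarrow> real \<Rightarrow> real \<Rightarrow> (nat \<Rightarrow> nat \<Rightarrow> nat \<Rightarrow> real) \<Rightarrow> nat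
    \<Rightarrow> (nat \<Rightarrow> real) \<Rightarrow> ((nat \<Rightarrow> real) \<Rightarrow> real) set \<Rightarrow> ennreal" where
  "posterior p L F lam lams X n Y E =
     prior_int p L F lam lams (\<lambda>N \<beta>. indicator E (relu_net L (width p L N) \<beta>) *
                                     lik X n Y (relu_net L (width p L N) \<beta>))
     / prior_int p L F lam lams (\<lambda>N \<beta>. lik X n Y (relu_net L (width p L N) \<beta>))"

definition emp_norm :: "(nat \<Rightarrow> nat \<Rightarrow> nat \<Rightarrow> real) \<Rightarrow> nat \<Rightarrow> ((nat \<Rightarrow> real) \<Rightarrow> real) \<Rightarrow> real" where
  "emp_norm X n g = sqrt ((\<Sum>i<n. (g (X n i))\<^sup>2) / real n)"

definition data_law :: "(nat \<Rightarrow> nat \<Rightarrow> nat \<Rightarrow> real) \<Rightarrow> ((nat \<Rightarrow> real) \<Rightarrow> real) \<Rightarrow> nat \<Rightarrow> (nat \<Rightarrow> real) measure" where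
  "data_law X f0 n = PiM {..<n} (\<lambda>i. density lborel (normal_density (f0 (X n i)) 1))"

definition outer_prob :: "'a measure \<Rightarrow> 'a set \<Rightarrow> real" where
  "outer_prob M A = Inf {measure M B | B. B \<in> sets M \<and> A \<inter> space M \<subseteq> B}"

end

theory Submission
  imports Defs "HOL-Computational_Algebra.Polynomial" "HOL-Real_Asymp.Real_Asymp"
begin

text \<open>Approximation: on a grid of about n^(p/(2\<alpha>+p)) cells, f0 is replaced by its Taylor polynomials.
  By polarization these are combinations of powers of finitely many linear forms that do not depend on
  the cell, and a linear interpolation of such a power with as many knots as there are cells is
  accurate enough because \<alpha> < p. The cell walls avoid the design points, so that one ReLU per cell
  selects the right polynomial exactly at the design; the gap between walls and design points is
  only polynomially small and is compensated by a single amplification after summation. This takes a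
  constant number of layers, and the remaining layers copy the result.

  Contraction: writing the likelihood ratio at f as exp (\<Sum> e g - \<Sum> g^2 / 2) with g = f - f0, a union bound
  over a polynomially fine parameter grid bounds the ratio pointwise on the sieve of networks with
  s \<le> n^(p/(2\<alpha>+p)) (log n)^4 and top weights at most n^2. Off the sieve the ratio has expectation 1 and the
  prior mass is tiny. The evidence is bounded below pointwise on a parameter box around the
  approximating network. Since \<delta> is free, all logarithmic factors are absorbed.\<close>

section \<open>Taylor expansion in ridge powers\<close>

text \<open>The powers of the logarithm come from one balance. With depth of order log n the output
  is Lipschitz in the parameters with constant n^O(log n), so each active parameter costs at most
  log^3 n, both in covering numbers and in prior mass. Put R = n^(p/(2\<alpha>+p)). The
  approximating network has O(R) parameters, so the evidence is at least exp(-O(R log^3 n)). The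
  sieve admits R log^4 n parameters, so that its complement has much smaller prior mass than that.
  Its entropy is then of order R log^7 n, and n \<xi>_n^2 = R log^8 n beats it. Hence \<delta> = 4.
  The uniform slabs confine all weights below the top layer to [-1,1]. This obstacle shapes the
  network: coefficients are scaled down, and the lost factor is regained by width and depth. All
  cells share the same interpolated powers; separate ones would need about R^2 parameters. Because
  the loss is the empirical norm, accuracy is needed only at the design points, but the bound F must
  hold on the whole cube, and clipping ensures it near the walls too.\<close>

definition words :: "nat \<Rightarrow> nat \<Rightarrow> nat list set" where
  "words p m = {w. set w \<subseteq> {..<p} \<and> length w \<le> m}"

text \<open>Words keep the order of differentiation, so several words give the same monomial. They
  are not merged: the expansion has one coefficient for each word.\<close>

definition mono_at :: "(nat \<Rightarrow> real) \<Rightarrow> (nat \<Rightarrow> real) \<Rightarrow> nat list \<Rightarrow> real" where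
  "mono_at a x w = prod_list (map (\<lambda>i. x i - a i) w)"

lemma mono_at_simps [simp]:
  "mono_at a x [] = 1" "mono_at a x (i # w) = (x i - a i) * mono_at a x w"
  by (simp_all add: mono_at_def)

lemma finite_words: "finite (words p m)"
  unfolding words_def by (rule finite_lists_length_le) simp

lemma words_0: "words p 0 = {[]}"
  by (auto simp: words_def)

lemma words_Suc: "words p (Suc m) = insert [] ((\<lambda>(i, w). i # w) ` ({..<p} \<times> words p m))"
proof -
  have "w \<in> words p (Suc m) \<longleftrightarrow> w \<in> insert [] ((\<lambda>(i, w). i # w) ` ({..<p} \<times> words p m))" for w
    by (cases w) (auto simp: words_def image_iff)
  then show ?thesis by blast
qed

lemma sum_words_Suc:
  fixes h :: "nat list \<Rightarrow> real"
  shows "(\<Sum>w\<in>words p (Suc m). h w) = h [] + (\<Sum>i<p. \<Sum>w\<in>words p m. h (i # w))"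
proof -
  have "(\<Sum>w\<in>words p (Suc m). h w) = h [] + (\<Sum>w\<in>(\<lambda>(i, w). i # w) ` ({..<p} \<times> words p m). h w)"
    unfolding words_Suc by (subst sum.insert) (auto simp: finite_words)
  also have "(\<Sum>w\<in>(\<lambda>(i, w). i # w) ` ({..<p} \<times> words p m). h w)
      = (\<Sum>(i, w)\<in>{..<p} \<times> words p m. h (i # w))"
    by (subst sum.reindex) (auto simp: inj_on_def case_prod_unfold)
  finally show ?thesis by (simp add: sum.cartesian_product)
qed

lemma mono_at_upd:
  "mono_at a (z(i := t)) w
     = (t - a i) ^ count_list w i * mono_at a z (filter (\<lambda>k. k \<noteq> i) w)"
  by (induction w) auto

text \<open>Prefixing the letter i raises the power of x_i - a_i by one. Read backwards, this gives
  an antiderivative in direction i of the monomial of w.\<close>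

lemma has_derivative_mono_at:
  "((\<lambda>t. mono_at a (z(i := t)) (i # w)) has_real_derivative
      real (Suc (count_list w i)) * mono_at a (z(i := t)) w) (at t within S)"
proof -
  have "((\<lambda>t. (t - a i) ^ Suc (count_list w i) * mono_at a z (filter (\<lambda>k. k \<noteq> i) w))
    has_real_derivative
      real (Suc (count_list w i)) * (t - a i) ^ count_list w i * mono_at a z (filter (\<lambda>k. k \<noteq> i) w))
      (at t within S)"
    by (rule derivative_eq_intros refl)+ simp
  then show ?thesis
    by (simp only: mono_at_upd) (simp add: mono_at_upd mult_ac)
qed

text \<open>A letter above i meets a coordinate that still equals that of a, so its factor is zero.
  At the intermediate points of the path only words with letters up to i survive.\<close>

lemma mono_at_trunc:
  "mono_at a (\<lambda>k. if k < Suc i then x k else a k) w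
     = (if set w \<subseteq> {..i} then mono_at a x w else 0)"
  by (induction w) (auto simp: less_Suc_eq_le)

lemma dist_inf_ge: "k < p \<Longrightarrow> \<bar>x k - y k\<bar> \<le> dist_inf p x y"
  unfolding dist_inf_def by (rule Max_ge) auto

lemma dist_inf_le:
  assumes "0 < p" and "\<And>k. k < p \<Longrightarrow> \<bar>x k - y k\<bar> \<le> d"
  shows "dist_inf p x y \<le> d"
  unfolding dist_inf_def using assms by (subst Max_le_iff) auto

lemma dist_inf_nonneg: "0 < p \<Longrightarrow> 0 \<le> dist_inf p x y"
  using dist_inf_ge[of 0 p x y] by linarith

lemma pdiff_snoc: "pdiff (is @ [i]) g = pdiff is (partial i g)"
  by (induction "is") auto

lemma cube_upd: "z \<in> cube p \<Longrightarrow> i < p \<Longrightarrow> 0 \<le> t \<Longrightarrow> t \<le> 1 \<Longrightarrow> z(i := t) \<in> cube p"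
  by (auto simp: cube_def)

text \<open>Integrating the expansions of the partial derivatives along the path that moves the
  coordinates from a to x one at a time, so that only one-dimensional mean value estimates
  are needed and no symmetry of mixed partials.\<close>
lemma taylor_words:
  assumes p: "0 < p" and \<theta>: "0 < \<theta>" and K: "0 \<le> K"
    and ex: "\<And>is i x. set is \<subseteq> {..<p} \<Longrightarrow> length is < m \<Longrightarrow> i < p \<Longrightarrow> x \<in> cube p
              \<Longrightarrow> \<exists>d. has_partial i (pdiff is g) x d"
    and bd: "\<And>is x. set is \<subseteq> {..<p} \<Longrightarrow> length is \<le> m \<Longrightarrow> x \<in> cube p \<Longrightarrow> \<bar>pdiff is g x\<bar> \<le> K"
    and ho: "\<And>is x y. set is \<subseteq> {..<p} \<Longrightarrow> length is = m \<Longrightarrow> x \<in> cube p \<Longrightarrow> y \<in> cube p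
              \<Longrightarrow> \<bar>pdiff is g x - pdiff is g y\<bar> \<le> K * dist_inf p x y powr \<theta>"
    and a: "a \<in> cube p"
  shows "\<exists>c. (\<forall>w. \<bar>c w\<bar> \<le> K) \<and>
     (\<forall>x\<in>cube p. \<bar>g x - (\<Sum>w\<in>words p m. c w * mono_at a x w)\<bar>
         \<le> real p ^ m * K * dist_inf p x a powr (real m + \<theta>))"
  using ex bd ho
proof (induction m arbitrary: g)
  case 0
  have "\<bar>g x - g a\<bar> \<le> K * dist_inf p x a powr \<theta>" if "x \<in> cube p" for x
    using "0.prems"(3)[of "[]" x a] that a by simp
  moreover have "\<bar>g a\<bar> \<le> K" using "0.prems"(2)[of "[]" a] a by simp
  ultimately show ?case
    by (intro exI[of _ "\<lambda>_. g a"]) (simp add: words_0)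
next
  case (Suc m)
  define E where "E = real p ^ m * K"
  have E0: "0 \<le> E" using K by (simp add: E_def)
  have "\<exists>c. (\<forall>w. \<bar>c w\<bar> \<le> K) \<and>
     (\<forall>x\<in>cube p. \<bar>partial i g x - (\<Sum>w\<in>words p m. c w * mono_at a x w)\<bar>
         \<le> E * dist_inf p x a powr (real m + \<theta>))" if i: "i < p" for i
    unfolding E_def
  proof (rule Suc.IH)
    fix "is" k x assume "set is \<subseteq> {..<p}" "length is < m" "k < p" "x \<in> cube p"
    then show "\<exists>d. has_partial k (pdiff is (partial i g)) x d"
      using Suc.prems(1)[of "is @ [i]" k x] i by (simp add: pdiff_snoc)
  next
    fix "is" x assume "set is \<subseteq> {..<p}" "length is \<le> m" "x \<in> cube p"
    then show "\<bar>pdiff is (partial i g) x\<bar> \<le> K"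
      using Suc.prems(2)[of "is @ [i]" x] i by (simp add: pdiff_snoc)
  next
    fix "is" x y assume "set is \<subseteq> {..<p}" "length is = m" "x \<in> cube p" "y \<in> cube p"
    then show "\<bar>pdiff is (partial i g) x - pdiff is (partial i g) y\<bar> \<le> K * dist_inf p x y powr \<theta>"
      using Suc.prems(3)[of "is @ [i]" x y] i by (simp add: pdiff_snoc)
  qed
  then obtain c where cK: "\<And>i w. i < p \<Longrightarrow> \<bar>c i w\<bar> \<le> K"
    and c: "\<And>i x. i < p \<Longrightarrow> x \<in> cube p \<Longrightarrow>
         \<bar>partial i g x - (\<Sum>w\<in>words p m. c i w * mono_at a x w)\<bar>
         \<le> E * dist_inf p x a powr (real m + \<theta>)"
    by metis
  \<comment> \<open>Integration in direction i divides by the exponent of the new factor. Words with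
    a letter above the first one get 0: they vanish at \<open>z (Suc i)\<close>, where the
    coordinates above i have not moved yet.\<close>
  define c' where "c' v = (case v of [] \<Rightarrow> g a | i # w \<Rightarrow>
      if i < p \<and> set w \<subseteq> {..i} then c i w / real (Suc (count_list w i)) else 0)" for v
  have c'K: "\<bar>c' v\<bar> \<le> K" for v
  proof (cases v)
    case Nil
    then show ?thesis using Suc.prems(2)[of "[]" a] a by (simp add: c'_def)
  next
    case (Cons i w)
    show ?thesis
    proof (cases "i < p \<and> set w \<subseteq> {..i}")
      case True
      have "\<bar>c i w / real (Suc (count_list w i))\<bar> \<le> \<bar>c i w\<bar> / 1"
        unfolding abs_divide by (intro divide_left_mono) auto
      then show ?thesis using True cK[of i w] by (simp add: c'_def Cons)
    qed (use K in \<open>auto simp: c'_def Cons\<close>)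
  qed
  have main: "\<bar>g x - (\<Sum>w\<in>words p (Suc m). c' w * mono_at a x w)\<bar>
      \<le> real p ^ Suc m * K * dist_inf p x a powr (real (Suc m) + \<theta>)" if x: "x \<in> cube p" for x
  proof -
    define d where "d = dist_inf p x a"
    have d0: "0 \<le> d" using p by (simp add: d_def dist_inf_nonneg)
    define z where "z i = (\<lambda>k. if k < i then x k else a k)" for i :: nat
    have zc: "z i \<in> cube p" for i
      using x a by (auto simp: z_def cube_def)
    define Q where "Q i y = (\<Sum>w\<in>words p m. c i w / real (Suc (count_list w i)) * mono_at a y (i # w))"
      for i y
    have step: "\<bar>g (z (Suc i)) - g (z i) - Q i (z (Suc i))\<bar> \<le> E * d powr (real (Suc m) + \<theta>)"
      if i: "i < p" for i
    proof -
      \<comment> \<open>The remainder along the i-th edge of the path. Its derivative is the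
        remainder in the expansion of \<open>partial i g\<close>, which the induction hypothesis
        bounds.\<close>
      define h where "h t = g ((z i)(i := t)) - Q i ((z i)(i := t))" for t
      define D where "D t = partial i g ((z i)(i := t))
           - (\<Sum>w\<in>words p m. c i w * mono_at a ((z i)(i := t)) w)" for t
      have x01: "0 \<le> x i" "x i \<le> 1" and a01: "0 \<le> a i" "a i \<le> 1"
        using x a i by (auto simp: cube_def)
      define S where "S = closed_segment (a i) (x i)"
      have S01: "S \<subseteq> {0..1}" using x01 a01 by (auto simp: S_def closed_segment_eq_real_ivl)
      have der: "(h has_real_derivative D t) (at t within S)" if t: "t \<in> S" for t
      proof -
        have t01: "t \<in> {0..1}" using t S01 by auto
        then have "(z i)(i := t) \<in> cube p" using zc i by (intro cube_upd) auto
        then obtain d' where "has_partial i g ((z i)(i := t)) d'"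
          using Suc.prems(1)[of "[]" i] i by auto
        then have "has_partial i g ((z i)(i := t)) (partial i g ((z i)(i := t)))"
          unfolding partial_def by (rule someI)
        then have g: "((\<lambda>s. g ((z i)(i := s))) has_real_derivative partial i g ((z i)(i := t)))
             (at t within S)"
          unfolding has_partial_def using DERIV_subset[OF _ S01] by simp
        have "((\<lambda>s. Q i ((z i)(i := s))) has_real_derivative
             (\<Sum>w\<in>words p m. c i w / real (Suc (count_list w i)) *
                (real (Suc (count_list w i)) * mono_at a ((z i)(i := t)) w))) (at t within S)"
          unfolding Q_def by (intro DERIV_sum DERIV_cmult has_derivative_mono_at)
        then have "((\<lambda>s. Q i ((z i)(i := s))) has_real_derivative
             (\<Sum>w\<in>words p m. c i w * mono_at a ((z i)(i := t)) w)) (at t within S)"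
          by simp
        with g show ?thesis unfolding h_def D_def by (rule DERIV_diff)
      qed
      have Db: "norm (D t) \<le> E * d powr (real m + \<theta>)" if t: "t \<in> S" for t
      proof -
        have t01: "t \<in> {0..1}" using t S01 by auto
        then have yc: "(z i)(i := t) \<in> cube p" using zc i by (intro cube_upd) auto
        have "\<bar>t - a i\<bar> \<le> \<bar>x i - a i\<bar>"
          using t by (auto simp: S_def closed_segment_eq_real_ivl split: if_splits)
        then have "dist_inf p ((z i)(i := t)) a \<le> d"
          using p dist_inf_ge[of _ p x a] i d0 unfolding d_def[symmetric]
          by (intro dist_inf_le) (auto simp: z_def intro: order_trans)
        then have "E * dist_inf p ((z i)(i := t)) a powr (real m + \<theta>) \<le> E * d powr (real m + \<theta>)"
          using E0 p \<theta> by (intro mult_left_mono powr_mono2) (auto simp: dist_inf_nonneg)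
        then show ?thesis using c[OF i yc] unfolding D_def by simp
      qed
      have "norm (h (x i) - h (a i)) \<le> E * d powr (real m + \<theta>) * norm (x i - a i)"
        by (rule field_differentiable_bound[of S]) (use der Db in \<open>auto simp: S_def\<close>)
      also have "\<dots> \<le> E * d powr (real m + \<theta>) * d"
        using dist_inf_ge[OF i, of x a] E0 by (intro mult_left_mono) (auto simp: d_def)
      also have "\<dots> = E * d powr (real (Suc m) + \<theta>)"
      proof (cases "d = 0")
        case False
        have "d powr (real (Suc m) + \<theta>) = d powr (real m + \<theta>) * d powr 1"
          by (subst powr_add[symmetric]) (simp add: add_ac)
        then show ?thesis using d0 by simp
      qed simp
      finally have "\<bar>h (x i) - h (a i)\<bar> \<le> E * d powr (real (Suc m) + \<theta>)" by simp
      moreover have "(z i)(i := x i) = z (Suc i)" "(z i)(i := a i) = z i"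
        by (auto simp: z_def fun_eq_iff less_Suc_eq)
      \<comment> \<open>Every word in Q starts with the letter i, whose factor vanishes at the start
        of the edge.\<close>
      moreover have "Q i (z i) = 0" by (simp add: Q_def z_def)
      ultimately show ?thesis by (simp add: h_def algebra_simps)
    qed
    have tel: "g x - g a = (\<Sum>i<p. g (z (Suc i)) - g (z i))"
    proof -
      have "z p = x" "z 0 = a" using x a by (auto simp: z_def fun_eq_iff cube_def)
      then show ?thesis using sum_lessThan_telescope[of "\<lambda>i. g (z i)" p] by simp
    qed
    have Qeq: "Q i (z (Suc i)) = (\<Sum>w\<in>words p m. c' (i # w) * mono_at a x (i # w))" if i: "i < p" for i
    proof -
      have "mono_at a (z (Suc i)) (i # w) = (if set w \<subseteq> {..i} then mono_at a x (i # w) else 0)" for w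
        unfolding z_def mono_at_trunc by simp
      then show ?thesis unfolding Q_def using i by (intro sum.cong) (simp_all add: c'_def)
    qed
    have "g x - (\<Sum>w\<in>words p (Suc m). c' w * mono_at a x w)
        = (\<Sum>i<p. g (z (Suc i)) - g (z i)) - (\<Sum>i<p. Q i (z (Suc i)))"
      using Qeq tel by (simp add: sum_words_Suc c'_def)
    also have "\<dots> = (\<Sum>i<p. g (z (Suc i)) - g (z i) - Q i (z (Suc i)))"
      by (simp add: sum_subtractf)
    also have "\<bar>\<dots>\<bar> \<le> (\<Sum>i<p. E * d powr (real (Suc m) + \<theta>))"
      by (rule order_trans[OF sum_abs sum_mono]) (use step in auto)
    finally show ?thesis by (simp add: E_def d_def mult_ac)
  qed
  show ?case using c'K main by blast
qed

section \<open>Polarization by iterated finite differences\<close>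

lemma sum_Pow_insert:
  fixes h :: "'b set \<Rightarrow> 'a::comm_monoid_add"
  assumes "finite T" "i \<notin> T"
  shows "(\<Sum>S\<in>Pow (insert i T). h S) = (\<Sum>S\<in>Pow T. h S) + (\<Sum>S\<in>Pow T. h (insert i S))"
proof -
  have "(\<Sum>S\<in>Pow (insert i T). h S) = (\<Sum>S\<in>Pow T. h S) + (\<Sum>S\<in>insert i ` Pow T. h S)"
    unfolding Pow_insert using assms by (intro sum.union_disjoint) auto
  also have "(\<Sum>S\<in>insert i ` Pow T. h S) = (\<Sum>S\<in>Pow T. h (insert i S))"
    using assms by (subst sum.reindex) (auto simp: inj_on_def)
  finally show ?thesis .
qed

text \<open>Adding an index i to T applies the difference q(X + z i) - q(X). It lowers the degree by
  one and multiplies the top coefficient by the degree and by z i, so after all steps only a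
  constant is left.\<close>

lemma sum_Pow_finite_difference:
  fixes z :: "'b \<Rightarrow> real"
  assumes "finite T" "degree q \<le> card T"
  shows "(\<Sum>S\<in>Pow T. (-1) ^ (card T - card S) * poly q (\<Sum>i\<in>S. z i))
      = fact (card T) * coeff q (card T) * (\<Prod>i\<in>T. z i)"
  using assms
proof (induction T arbitrary: q rule: finite_induct)
  case empty
  then show ?case by (simp add: poly_0_coeff_0)
next
  case (insert i T)
  define n where "n = card T"
  define r where "r = pcompose q [:z i, 1:] - q"
  have dq: "degree q \<le> Suc n" using insert by (simp add: n_def)
  have r: "degree r \<le> n \<and> coeff r n = real (Suc n) * coeff q (Suc n) * z i"
  proof -
    \<comment> \<open>Induction on the degree bound for all q at once, peeling off the constant
      term: for q = a + X q' the difference is z q'(X + z) + X (q'(X + z) - q'(X)).\<close>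
    have "\<forall>q. degree q \<le> Suc n \<longrightarrow> degree (pcompose q [:z i, 1:] - q) \<le> n \<and>
        coeff (pcompose q [:z i, 1:] - q) n = real (Suc n) * coeff q (Suc n) * z i"
    proof (induction n)
      case 0
      show ?case
      proof (intro allI impI)
        fix q :: "real poly" assume "degree q \<le> Suc 0"
        then obtain a b where q: "q = [:a, b:]"
          by (metis One_nat_def degree1_coeffs degree_0_id le_0_eq le_Suc_eq pCons_0_0)
        show "degree (pcompose q [:z i, 1:] - q) \<le> 0 \<and>
          coeff (pcompose q [:z i, 1:] - q) 0 = real (Suc 0) * coeff q (Suc 0) * z i"
          unfolding q by (simp add: pcompose_pCons)
      qed
    next
      case (Suc n)
      show ?case
      proof (intro allI impI)
        fix q :: "real poly" assume dq: "degree q \<le> Suc (Suc n)"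
        obtain a q' where q: "q = pCons a q'" by (cases q)
        have dq': "degree q' \<le> Suc n" using dq by (simp add: q split: if_splits)
        define r' where "r' = pcompose q' [:z i, 1:] - q'"
        have r': "degree r' \<le> n" "coeff r' n = real (Suc n) * coeff q' (Suc n) * z i"
          using Suc.IH dq' by (auto simp: r'_def)
        have pq: "pcompose q' [:z i, 1:] = r' + q'" by (simp add: r'_def)
        have eq: "pcompose q [:z i, 1:] - q = smult (z i) (r' + q') + pCons 0 r'"
          by (simp add: q pcompose_pCons pq algebra_simps)
        have "degree (smult (z i) (r' + q') + pCons 0 r') \<le> Suc n"
          using r'(1) dq' by (intro degree_add_le) (auto intro!: order_trans[OF degree_smult_le] degree_add_le
             order_trans[OF degree_pCons_le])
        moreover have "coeff r' (Suc n) = 0" using r'(1) by (intro coeff_eq_0) simp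
        ultimately show "degree (pcompose q [:z i, 1:] - q) \<le> Suc n \<and>
          coeff (pcompose q [:z i, 1:] - q) (Suc n) = real (Suc (Suc n)) * coeff q (Suc (Suc n)) * z i"
          unfolding eq by (simp add: r'(2) q algebra_simps)
      qed
    qed
    then show ?thesis using dq unfolding r_def by blast
  qed
  have "(\<Sum>S\<in>Pow (insert i T). (-1) ^ (card (insert i T) - card S) * poly q (\<Sum>i\<in>S. z i))
     = (\<Sum>S\<in>Pow T. (-1) ^ (Suc n - card S) * poly q (\<Sum>i\<in>S. z i))
     + (\<Sum>S\<in>Pow T. (-1) ^ (Suc n - card (insert i S)) * poly q (\<Sum>i\<in>insert i S. z i))"
    using insert(1,2) by (simp add: sum_Pow_insert n_def)
  also have "\<dots> = (\<Sum>S\<in>Pow T. (-1) ^ (n - card S) * poly r (\<Sum>i\<in>S. z i))"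
    unfolding sum.distrib[symmetric]
  proof (rule sum.cong[OF refl])
    fix S assume "S \<in> Pow T"
    then have S: "S \<subseteq> T" "finite S" "i \<notin> S" using insert(1,2) finite_subset by auto
    have "card S \<le> n" using S insert(1) by (simp add: n_def card_mono)
    then show "(-1) ^ (Suc n - card S) * poly q (\<Sum>i\<in>S. z i)
      + (-1) ^ (Suc n - card (insert i S)) * poly q (\<Sum>i\<in>insert i S. z i)
      = (-1) ^ (n - card S) * poly r (\<Sum>i\<in>S. z i)"
      using S by (simp add: r_def poly_pcompose Suc_diff_le algebra_simps)
  qed
  also have "\<dots> = fact n * coeff r n * (\<Prod>i\<in>T. z i)"
    using insert.IH[of r] r by (simp add: n_def)
  also have "\<dots> = fact (Suc n) * coeff q (Suc n) * (\<Prod>i\<in>insert i T. z i)"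
    using r insert(1,2) by simp
  finally show ?case using insert(1,2) by (simp add: n_def)
qed

lemma polarization:
  fixes z :: "'b \<Rightarrow> real"
  assumes "finite T"
  shows "(\<Prod>i\<in>T. z i) = (\<Sum>S\<in>Pow T. (-1) ^ (card T - card S) * (\<Sum>i\<in>S. z i) ^ card T) / fact (card T)"
  using sum_Pow_finite_difference[OF assms, of "monom 1 (card T)" z]
  by (simp add: degree_monom_eq poly_monom)

text \<open>Polarization turns the product into d-th powers of sums of x - a over sets S of
  positions. The binomial theorem then separates a from x: a enters the coefficients only, and the
  linear forms merely count letters. B is a free normalization of these forms.\<close>

lemma mono_at_ridge:
  fixes B :: real
  assumes w: "set w \<subseteq> {..<p}" and d: "d = length w" and B: "B \<noteq> 0"
  shows "mono_at a x w = (\<Sum>S\<in>Pow {..<d}. \<Sum>e\<le>d.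
      (-1) ^ (d - card S) / fact d * real (d choose e) * B ^ e * (- (\<Sum>k\<in>S. a (w ! k))) ^ (d - e)
        * (\<Sum>i<p. real (card {k \<in> S. w ! k = i}) / B * x i) ^ e)"
proof -
  have "mono_at a x w = (\<Prod>k<d. x (w ! k) - a (w ! k))"
    by (simp add: mono_at_def prod.list_conv_set_nth d atLeast0LessThan)
  also have "\<dots> = (\<Sum>S\<in>Pow {..<d}. (-1) ^ (d - card S) * (\<Sum>k\<in>S. x (w ! k) - a (w ! k)) ^ d) / fact d"
    by (subst polarization) auto
  also have "\<dots> = (\<Sum>S\<in>Pow {..<d}. (-1) ^ (d - card S) / fact d * (\<Sum>k\<in>S. x (w ! k) - a (w ! k)) ^ d)"
    by (simp add: sum_divide_distrib)
  also have "\<dots> = (\<Sum>S\<in>Pow {..<d}. \<Sum>e\<le>d.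
      (-1) ^ (d - card S) / fact d * real (d choose e) * B ^ e * (- (\<Sum>k\<in>S. a (w ! k))) ^ (d - e)
        * (\<Sum>i<p. real (card {k \<in> S. w ! k = i}) / B * x i) ^ e)"
  proof (rule sum.cong[OF refl])
    fix S assume S: "S \<in> Pow {..<d}"
    then have fS: "finite S" using finite_subset by auto
    have wp: "w ! k < p" if "k \<in> S" for k
      using that S d w nth_mem[of k w] by blast
    define Z where "Z = (\<Sum>i<p. real (card {k \<in> S. w ! k = i}) / B * x i)"
    have "(\<Sum>k\<in>S. x (w ! k)) = (\<Sum>i<p. \<Sum>k\<in>{k \<in> S. w ! k = i}. x (w ! k))"
      by (rule sum.group[symmetric]) (use fS wp in auto)
    also have "\<dots> = (\<Sum>i<p. real (card {k \<in> S. w ! k = i}) * x i)"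
      by (intro sum.cong) auto
    also have "\<dots> = B * Z"
      using B by (simp add: Z_def sum_distrib_left)
    finally have X: "(\<Sum>k\<in>S. x (w ! k) - a (w ! k)) = B * Z + (- (\<Sum>k\<in>S. a (w ! k)))"
      by (simp add: sum_subtractf)
    show "(-1) ^ (d - card S) / fact d * (\<Sum>k\<in>S. x (w ! k) - a (w ! k)) ^ d = (\<Sum>e\<le>d.
      (-1) ^ (d - card S) / fact d * real (d choose e) * B ^ e * (- (\<Sum>k\<in>S. a (w ! k))) ^ (d - e)
        * (\<Sum>i<p. real (card {k \<in> S. w ! k = i}) / B * x i) ^ e)"
      unfolding X Z_def[symmetric] binomial_ring sum_distrib_left
      by (rule sum.cong[OF refl]) (simp only: power_mult_distrib mult_ac)
  qed
  finally show ?thesis .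
qed

text \<open>The directions u are common to all base points a; only the coefficients c depend on a.\<close>
lemma hoelder_ridge_expansion:
  assumes p: "0 < p" and \<alpha>: "0 < \<alpha>" and g: "hoelder p \<alpha> g"
  shows "\<exists>(J :: (nat list \<times> nat set \<times> nat) set) u e C. finite J \<and> 0 \<le> C \<and>
     (\<forall>j\<in>J. (\<forall>i<p. 0 \<le> u j i) \<and> (\<Sum>i<p. u j i) \<le> 1) \<and>
     (\<forall>a\<in>cube p. \<exists>c. (\<forall>j\<in>J. \<bar>c j\<bar> \<le> C) \<and>
        (\<forall>x\<in>cube p. \<bar>g x - (\<Sum>j\<in>J. c j * (\<Sum>i<p. u j i * x i) ^ e j)\<bar> \<le> C * dist_inf p x a powr \<alpha>))"
proof -
  \<comment> \<open>The largest integer strictly below \<alpha>. For integral \<alpha> it is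
    \<alpha> - 1, so the remaining exponent \<alpha> - m lies in (0,1].\<close>
  define m where "m = nat (\<lceil>\<alpha>\<rceil> - 1)"
  have "of_int \<lceil>\<alpha>\<rceil> < \<alpha> + 1" "\<lceil>\<alpha>\<rceil> \<ge> 1" using \<alpha> by linarith+
  then have m: "real m < \<alpha>" unfolding m_def by simp
  from g obtain K where
    ex: "\<And>is i x. set is \<subseteq> {..<p} \<Longrightarrow> length is < m \<Longrightarrow> i < p \<Longrightarrow> x \<in> cube p
              \<Longrightarrow> \<exists>d. has_partial i (pdiff is g) x d"
    and bd: "\<And>is x. set is \<subseteq> {..<p} \<Longrightarrow> length is \<le> m \<Longrightarrow> x \<in> cube p \<Longrightarrow> \<bar>pdiff is g x\<bar> \<le> K"
    and ho: "\<And>is x y. set is \<subseteq> {..<p} \<Longrightarrow> length is = m \<Longrightarrow> x \<in> cube p \<Longrightarrow> y \<in> cube p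
              \<Longrightarrow> \<bar>pdiff is g x - pdiff is g y\<bar> \<le> K * dist_inf p x y powr (\<alpha> - real m)"
    unfolding hoelder_def Let_def m_def[symmetric] by blast
  have "(\<lambda>_. 0) \<in> cube p" by (simp add: cube_def)
  from bd[OF _ _ this, of "[]"] have K: "0 \<le> K" by simp
  \<comment> \<open>Exceeds every word length and is nonzero even for m = 0. Dividing by it makes
    the entries of a direction sum to at most 1: they become admissible weights, and the linear
    forms map the cube into [0,1].\<close>
  define B where "B = real m + 1"
  define J where "J = (SIGMA w:words p m. Pow {..<length w} \<times> {..length w})"
  define u where "u = (\<lambda>(w :: nat list, S :: nat set, e :: nat) i. real (card {k \<in> S. w ! k = i}) / B)"
  define e where "e = (\<lambda>(w :: nat list, S :: nat set, e :: nat). e)"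
  \<comment> \<open>The first summand serves the Taylor remainder. The second bounds the
    coefficients: 2^m for the binomials, and B^m because the exponents of B and of the sum over a
    add up to the word length.\<close>
  define C where "C = real p ^ m * K + K * (2 ^ m * B ^ m)"
  have fJ: "finite J" unfolding J_def by (intro finite_SigmaI finite_words) auto
  have B1: "1 \<le> B" by (simp add: B_def)
  have C0: "0 \<le> C" using K B1 by (simp add: C_def)
  have u1: "(\<forall>i<p. 0 \<le> u j i) \<and> (\<Sum>i<p. u j i) \<le> 1" if "j \<in> J" for j
  proof -
    obtain w S e' where j: "j = (w, S, e')" by (cases j)
    have w: "set w \<subseteq> {..<p}" "length w \<le> m" and S: "S \<subseteq> {..<length w}"
      using that by (auto simp: J_def j words_def)
    have fS: "finite S" using S finite_subset by blast
    have wp: "w ! k < p" if "k \<in> S" for k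
      using that S w(1) nth_mem[of k w] by blast
    have "card S \<le> m" using card_mono[OF _ S] w by simp
    moreover have "(\<Sum>i<p. card {k \<in> S. w ! k = i}) = card S"
    proof -
      have "(\<Sum>i<p. \<Sum>k\<in>{k \<in> S. w ! k = i}. 1) = (\<Sum>k\<in>S. (1::nat))"
        by (rule sum.group) (use fS wp in auto)
      then show ?thesis by simp
    qed
    then have "(\<Sum>i<p. real (card {k \<in> S. w ! k = i})) = real (card S)"
      by (metis of_nat_sum)
    ultimately have "(\<Sum>i<p. real (card {k \<in> S. w ! k = i})) / B \<le> 1"
      using B1 by (simp add: B_def)
    then show ?thesis using B1 by (simp add: u_def j sum_divide_distrib)
  qed
  have main: "\<exists>c. (\<forall>j\<in>J. \<bar>c j\<bar> \<le> C) \<and>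
        (\<forall>x\<in>cube p. \<bar>g x - (\<Sum>j\<in>J. c j * (\<Sum>i<p. u j i * x i) ^ e j)\<bar> \<le> C * dist_inf p x a powr \<alpha>)"
    if a: "a \<in> cube p" for a
  proof -
    have "0 < \<alpha> - real m" using m by simp
    then have "\<exists>c. (\<forall>w. \<bar>c w\<bar> \<le> K) \<and>
        (\<forall>x\<in>cube p. \<bar>g x - (\<Sum>w\<in>words p m. c w * mono_at a x w)\<bar>
           \<le> real p ^ m * K * dist_inf p x a powr (real m + (\<alpha> - real m)))"
      by (intro taylor_words p K a) (assumption | rule ex bd ho)+
    then obtain c where cK: "\<And>w. \<bar>c w\<bar> \<le> K" and
      c: "\<And>x. x \<in> cube p \<Longrightarrow> \<bar>g x - (\<Sum>w\<in>words p m. c w * mono_at a x w)\<bar>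
         \<le> real p ^ m * K * dist_inf p x a powr \<alpha>" by auto
    define c' where "c' = (\<lambda>(w, S, e). c w * ((-1) ^ (length w - card S) / fact (length w) *
        real (length w choose e) * B ^ e * (- (\<Sum>k\<in>S. a (w ! k))) ^ (length w - e)))"
    have e1: "(\<Sum>j\<in>J. c' j * (\<Sum>i<p. u j i * x i) ^ e j) = (\<Sum>w\<in>words p m. c w * mono_at a x w)" for x
    proof -
      have "(\<Sum>j\<in>J. c' j * (\<Sum>i<p. u j i * x i) ^ e j)
         = (\<Sum>w\<in>words p m. \<Sum>se\<in>Pow {..<length w} \<times> {..length w}.
              c' (w, se) * (\<Sum>i<p. u (w, se) i * x i) ^ e (w, se))"
        unfolding J_def by (subst sum.Sigma) (auto simp: finite_words case_prod_unfold)
      also have "\<dots> = (\<Sum>w\<in>words p m. c w * mono_at a x w)"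
      proof (rule sum.cong[OF refl])
        fix w assume "w \<in> words p m"
        then have w: "set w \<subseteq> {..<p}" by (simp add: words_def)
        have "B \<noteq> 0" using B1 by simp
        from mono_at_ridge[OF w refl this, of a x]
        show "(\<Sum>se\<in>Pow {..<length w} \<times> {..length w}.
              c' (w, se) * (\<Sum>i<p. u (w, se) i * x i) ^ e (w, se)) = c w * mono_at a x w"
          by (simp add: sum.cartesian_product' c'_def u_def e_def sum_distrib_left mult.assoc)
      qed
      finally show ?thesis .
    qed
    moreover have "\<bar>c' j\<bar> \<le> C" if "j \<in> J" for j
    proof -
      obtain w S e' where j: "j = (w, S, e')" by (cases j)
      have w: "set w \<subseteq> {..<p}" "length w \<le> m" and S: "S \<subseteq> {..<length w}" and e': "e' \<le> length w"
        using that by (auto simp: J_def j words_def)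
      have a01: "0 \<le> a (w ! k)" "a (w ! k) \<le> 1" if "k \<in> S" for k
      proof -
        have "w ! k < p" using that S w(1) nth_mem[of k w] by blast
        then show "0 \<le> a (w ! k)" "a (w ! k) \<le> 1" using a by (auto simp: cube_def)
      qed
      have "(\<Sum>k\<in>S. a (w ! k)) \<le> (\<Sum>k\<in>S. 1)" using a01 by (intro sum_mono)
      also have "\<dots> \<le> real m" using card_mono[OF _ S] w by simp
      finally have A: "\<bar>- (\<Sum>k\<in>S. a (w ! k))\<bar> \<le> B"
        using a01 by (simp add: B_def sum_nonneg)
      have "\<bar>c' j\<bar> = \<bar>c w\<bar> * (1 / fact (length w) * real (length w choose e') *
          (B ^ e' * \<bar>- (\<Sum>k\<in>S. a (w ! k))\<bar> ^ (length w - e')))"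
        using B1 by (simp add: c'_def j abs_mult power_abs mult_ac)
      also have "\<dots> \<le> K * (1 * 2 ^ m * (B ^ e' * B ^ (length w - e')))"
      proof (intro mult_mono power_mono)
        show "1 / fact (length w) \<le> (1 :: real)" by simp
        have "length w choose e' \<le> 2 ^ length w" by (rule binomial_le_pow2)
        also have "\<dots> \<le> 2 ^ m" using w by simp
        finally show "real (length w choose e') \<le> 2 ^ m" by (simp add: numeral_power_le_of_nat_cancel_iff[symmetric] of_nat_le_iff[symmetric] del: of_nat_le_iff)
      qed (use A cK K B1 in auto)
      also have "\<dots> = K * (2 ^ m * B ^ length w)"
        using e' by (simp add: power_add[symmetric])
      also have "\<dots> \<le> K * (2 ^ m * B ^ m)"
        using K B1 w by (intro mult_left_mono power_increasing) auto
      also have "\<dots> \<le> C" using K by (simp add: C_def)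
      finally show ?thesis .
    qed
    moreover have e3: "real p ^ m * K * dist_inf p x a powr \<alpha> \<le> C * dist_inf p x a powr \<alpha>" for x
      using K B1 by (intro mult_right_mono) (auto simp: C_def)
    ultimately show ?thesis
      by (intro exI[of _ c'] conjI ballI) (auto simp: e1 intro: order_trans[OF c e3])
  qed
  show ?thesis
    using fJ C0 u1 main by (intro exI[of _ J] exI[of _ u] exI[of _ e] exI[of _ C]) auto
qed

section \<open>Network constructions\<close>

lemma hidden_cong:
  "(\<And>l' j k. l' \<le> l \<Longrightarrow> \<beta> (l', j, k) = \<beta>' (l', j, k)) \<Longrightarrow> hidden w \<beta> l x = hidden w \<beta>' l x"
  by (induction l) auto

text \<open>The invariant of the layer-by-layer construction; \<iota> assigns to each index its neuron in layer l.\<close>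
definition computes :: "nat \<Rightarrow> (nat \<Rightarrow> nat) \<Rightarrow> nat \<Rightarrow> nat \<Rightarrow> 'i set \<Rightarrow> ('i \<Rightarrow> (nat \<Rightarrow> real) \<Rightarrow> real) \<Rightarrow> bool" where
  "computes p w l S I G \<longleftrightarrow> (\<exists>\<beta> \<iota>. (\<forall>j. \<bar>\<beta> j\<bar> \<le> 1) \<and> finite {j. \<beta> j \<noteq> 0} \<and> card {j. \<beta> j \<noteq> 0} \<le> S \<and>
     (\<forall>l' j k. \<beta> (l', j, k) \<noteq> 0 \<longrightarrow> 1 \<le> l' \<and> l' \<le> l \<and> j < w l' \<and> k \<le> w (l' - 1)) \<and>
     inj_on \<iota> I \<and> \<iota> ` I \<subseteq> {..<w l} \<and> (\<forall>x\<in>cube p. \<forall>i\<in>I. hidden w \<beta> l x (\<iota> i) = G i x))"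

lemma computes_input: "w 0 = p \<Longrightarrow> computes p w 0 0 {..<p} (\<lambda>i x. x i)"
  unfolding computes_def by (intro exI[of _ "\<lambda>_. 0"] exI[of _ id]) auto

text \<open>The new neurons sit at arbitrary distinct places of layer l + 1, and the other neurons
  there get zero weights. R is any finite set that contains the nonzero connections, so the layer
  costs card R weights and one bias per neuron.\<close>

lemma computes_layer:
  assumes G: "computes p w l S I G" and fin: "finite I" "finite I'"
    and width: "card I' \<le> w (Suc l)"
    and R: "finite R" "\<And>i j. j \<in> I' \<Longrightarrow> i \<in> I \<Longrightarrow> (j, i) \<notin> R \<Longrightarrow> A j i = 0"
    and A1: "\<And>j i. j \<in> I' \<Longrightarrow> i \<in> I \<Longrightarrow> \<bar>A j i\<bar> \<le> 1" and b1: "\<And>j. j \<in> I' \<Longrightarrow> \<bar>b j\<bar> \<le> 1"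
    and G': "\<And>j x. j \<in> I' \<Longrightarrow> x \<in> cube p \<Longrightarrow> G' j x = max ((\<Sum>i\<in>I. A j i * G i x) + b j) 0"
  shows "computes p w (Suc l) (S + card R + card I') I' G'"
proof -
  from G[unfolded computes_def] obtain \<beta> \<iota> where \<beta>1: "\<forall>j. \<bar>\<beta> j\<bar> \<le> 1"
    and fS: "finite {j. \<beta> j \<noteq> 0}" and S: "card {j. \<beta> j \<noteq> 0} \<le> S"
    and supp: "\<forall>l' j k. \<beta> (l', j, k) \<noteq> 0 \<longrightarrow> 1 \<le> l' \<and> l' \<le> l \<and> j < w l' \<and> k \<le> w (l' - 1)"
    and \<iota>: "inj_on \<iota> I" "\<iota> ` I \<subseteq> {..<w l}"
    and hid: "\<forall>x\<in>cube p. \<forall>i\<in>I. hidden w \<beta> l x (\<iota> i) = G i x"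
    by (elim exE conjE) (rule that)
  obtain \<iota>' where \<iota>': "inj_on \<iota>' I'" "\<iota>' ` I' \<subseteq> {..<w (Suc l)}"
    using card_le_inj[OF fin(2), of "{..<w (Suc l)}"] width by auto
  define \<beta>' where "\<beta>' = (\<lambda>(l', j, k). if l' = Suc l then
       (if j \<in> \<iota>' ` I' then
          (if k = w l then b (inv_into I' \<iota>' j)
           else if k \<in> \<iota> ` I then A (inv_into I' \<iota>' j) (inv_into I \<iota> k) else 0) else 0)
       else \<beta> (l', j, k))"
  have old: "hidden w \<beta>' l x = hidden w \<beta> l x" for x
    by (rule hidden_cong) (simp add: \<beta>'_def)
  have new: "hidden w \<beta>' (Suc l) x (\<iota>' j) = G' j x" if x: "x \<in> cube p" and j: "j \<in> I'" for x j
  proof -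
    have j': "\<iota>' j \<in> \<iota>' ` I'" "inv_into I' \<iota>' (\<iota>' j) = j" using j \<iota>'(1) by auto
    have b: "\<beta>' (Suc l, \<iota>' j, w l) = b j" by (simp add: \<beta>'_def j')
    have "(\<Sum>k<w l. \<beta>' (Suc l, \<iota>' j, k) * hidden w \<beta> l x k)
        = (\<Sum>k\<in>\<iota> ` I. \<beta>' (Suc l, \<iota>' j, k) * hidden w \<beta> l x k)"
      by (rule sum.mono_neutral_right) (use \<iota> in \<open>auto simp: \<beta>'_def\<close>)
    also have "\<dots> = (\<Sum>i\<in>I. \<beta>' (Suc l, \<iota>' j, \<iota> i) * hidden w \<beta> l x (\<iota> i))"
      by (subst sum.reindex) (use \<iota> in auto)
    also have "\<dots> = (\<Sum>i\<in>I. A j i * G i x)"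
    proof (rule sum.cong[OF refl])
      fix i assume i: "i \<in> I"
      have "\<iota> i < w l" using i \<iota> by auto
      moreover have "\<iota> i \<in> \<iota> ` I" "inv_into I \<iota> (\<iota> i) = i" using i \<iota>(1) by auto
      ultimately have "\<beta>' (Suc l, \<iota>' j, \<iota> i) = A j i" by (simp add: \<beta>'_def j')
      then show "\<beta>' (Suc l, \<iota>' j, \<iota> i) * hidden w \<beta> l x (\<iota> i) = A j i * G i x"
        by (simp add: hid[rule_format, OF x i])
    qed
    finally show ?thesis using b G'[OF j x] by (simp add: old)
  qed
  define N where "N = {j. \<beta> j \<noteq> 0} \<union> ((\<lambda>(j, i). (Suc l, \<iota>' j, \<iota> i)) ` R \<union> (\<lambda>j. (Suc l, \<iota>' j, w l)) ` I')"
  have fN: "finite N" unfolding N_def using fS R fin by auto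
  have "q \<in> N" if q: "\<beta>' q \<noteq> 0" for q
  proof -
    obtain l' j k where jk: "q = (l', j, k)" by (cases q)
    show ?thesis
    proof (cases "l' = Suc l")
      case False
      then show ?thesis using q by (simp add: N_def \<beta>'_def jk)
    next
      case True
      have "j \<in> \<iota>' ` I'" using q True unfolding \<beta>'_def jk by (simp split: if_splits)
      then obtain j' where j': "j = \<iota>' j'" "j' \<in> I'" by blast
      have inv: "inv_into I' \<iota>' j = j'" "j \<in> \<iota>' ` I'" using j' \<iota>'(1) by auto
      show ?thesis
      proof (cases "k = w l")
        case True
        then show ?thesis using j' \<open>l' = Suc l\<close> by (simp add: N_def jk)
      next
        case False
        then have "k \<in> \<iota> ` I" using q True unfolding \<beta>'_def jk by (simp split: if_splits)
        then obtain i where i: "k = \<iota> i" "i \<in> I" by blast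
        then have "inv_into I \<iota> k = i" "k \<in> \<iota> ` I" using \<iota>(1) by auto
        then have "A j' i \<noteq> 0" using q True False inv by (simp add: \<beta>'_def jk)
        then have "(j', i) \<in> R" using R(2)[of j' i] i j' by blast
        then show ?thesis using i j' True by (force simp: N_def jk)
      qed
    qed
  qed
  then have sub: "{q. \<beta>' q \<noteq> 0} \<subseteq> N" by blast
  have "card N \<le> card {j. \<beta> j \<noteq> 0} + (card ((\<lambda>(j, i). (Suc l, \<iota>' j, \<iota> i)) ` R)
      + card ((\<lambda>j. (Suc l, \<iota>' j, w l)) ` I'))"
    unfolding N_def by (intro order_trans[OF card_Un_le] add_mono order_refl card_Un_le)
  also have "\<dots> \<le> S + (card R + card I')"
    by (intro add_mono S card_image_le R fin)
  finally have cardN: "card N \<le> S + card R + card I'" by simp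
  show ?thesis
    unfolding computes_def
  proof (intro exI[of _ \<beta>'] exI[of _ \<iota>'] conjI allI impI ballI)
    fix q show "\<bar>\<beta>' q\<bar> \<le> 1"
    proof (cases q)
      case (fields l' j k)
      have "j \<in> \<iota>' ` I' \<Longrightarrow> inv_into I' \<iota>' j \<in> I'" "k \<in> \<iota> ` I \<Longrightarrow> inv_into I \<iota> k \<in> I"
        by (simp_all add: inv_into_into)
      then show ?thesis unfolding fields \<beta>'_def using \<beta>1 A1 b1 by simp
    qed
  next
    show "finite {q. \<beta>' q \<noteq> 0}" using sub fN by (rule finite_subset)
    show "card {q. \<beta>' q \<noteq> 0} \<le> S + card R + card I'"
      using card_mono[OF fN sub] cardN by simp
  next
    fix l' j k assume "\<beta>' (l', j, k) \<noteq> 0"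
    moreover have "k < w l" if "k \<in> \<iota> ` I" using subsetD[OF \<iota>(2) that] by simp
    moreover have "j < w (Suc l)" if "j \<in> \<iota>' ` I'" using subsetD[OF \<iota>'(2) that] by simp
    ultimately have "1 \<le> l' \<and> l' \<le> Suc l \<and> j < w l' \<and> k \<le> w (l' - 1)"
      using supp[rule_format, of l' j k] unfolding \<beta>'_def by (cases "l' = Suc l") (simp_all split: if_splits)
    then show "1 \<le> l'" "l' \<le> Suc l" "j < w l'" "k \<le> w (l' - 1)" by simp_all
  qed (use \<iota>' new in auto)
qed

text \<open>ReLU is the identity on nonnegative functions, so a single neuron copies g upwards;
  weight and bias account for the 2 per layer.\<close>

lemma computes_id:
  assumes "computes p w l S {()} (\<lambda>_. g)" "\<And>x. x \<in> cube p \<Longrightarrow> 0 \<le> g x"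
    and "\<And>k. k < m \<Longrightarrow> 1 \<le> w (Suc (l + k))"
  shows "computes p w (l + m) (S + 2 * m) {()} (\<lambda>_. g)"
  using assms(3)
proof (induction m)
  case 0
  then show ?case using assms(1) by simp
next
  case (Suc m)
  have "computes p w (Suc (l + m)) (S + 2 * m + card {((), ())} + card {()}) {()} (\<lambda>_. g)"
    by (rule computes_layer[where A = "\<lambda>_ _. 1" and b = "\<lambda>_. 0" and I = "{()}" and G = "\<lambda>_. g"])
       (use Suc assms(2) in auto)
  then show ?case by simp
qed

text \<open>All weights are at most 1 in absolute value, so a factor V is produced by V parallel copies
  which are summed in the next layer.\<close>
lemma computes_amplify:
  assumes "computes p w l S {()} (\<lambda>_. g)" "\<And>x. x \<in> cube p \<Longrightarrow> 0 \<le> g x"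
    and "\<And>k. k < 2 * m \<Longrightarrow> V \<le> w (Suc (l + k))" and "1 \<le> V"
  shows "computes p w (l + 2 * m) (S + m * (4 * V)) {()} (\<lambda>_ x. real V ^ m * g x)"
  using assms(3)
proof (induction m)
  case 0
  then show ?case using assms(1) by simp
next
  case (Suc m)
  define S' where "S' = S + m * (4 * V)"
  have 0: "computes p w (l + 2 * m) S' {()} (\<lambda>_ x. real V ^ m * g x)"
    unfolding S'_def using Suc by simp
  have w1: "V \<le> w (Suc (l + 2 * m))" "V \<le> w (Suc (l + Suc (2 * m)))"
    using Suc.prems[of "2 * m"] Suc.prems[of "Suc (2 * m)"] by auto
  have 1: "computes p w (Suc (l + 2 * m)) (S' + card ({..<V} \<times> {()}) + card {..<V}) {..<V}
      (\<lambda>_ x. real V ^ m * g x)"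
    by (rule computes_layer[where A = "\<lambda>_ _. 1" and b = "\<lambda>_. 0", OF 0]) (use assms(2) w1 in auto)
  have "computes p w (Suc (Suc (l + 2 * m))) (S' + card ({..<V} \<times> {()}) + card {..<V}
       + card ({()} \<times> {..<V}) + card {()}) {()} (\<lambda>_ x. real V ^ Suc m * g x)"
    by (rule computes_layer[where A = "\<lambda>_ _. 1" and b = "\<lambda>_. 0", OF 1]) (use assms(2,4) w1 in auto)
  then have 2: "computes p w (l + 2 * Suc m) (S' + 3 * V + 1) {()} (\<lambda>_ x. real V ^ Suc m * g x)"
    by (simp add: add_ac mult_2 numeral_3_eq_3)
  \<comment> \<open>V weights and V biases fan out, V weights and one bias collect; the last 1 is
    absorbed by V \<ge> 1.\<close>
  moreover have "S' + 3 * V + 1 \<le> S + Suc m * (4 * V)" using assms(4) by (simp add: S'_def)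
  ultimately show ?case unfolding computes_def by (meson order_trans)
qed

section \<open>Piecewise linear interpolation of powers\<close>

definition knot_slope :: "nat \<Rightarrow> nat \<Rightarrow> nat \<Rightarrow> real" where
  "knot_slope e V k = real V * ((real (Suc k) / real V) ^ e - (real k / real V) ^ e)"

definition knot_coef :: "nat \<Rightarrow> nat \<Rightarrow> nat \<Rightarrow> real" where
  "knot_coef e V k = (if k = 0 then knot_slope e V 0 else knot_slope e V k - knot_slope e V (k - 1))"

text \<open>The linear interpolant of t^e at the knots k / V, as a sum of ReLUs weighted by the
  changes of slope. The constant is its value at 0, which is 1 for e = 0.\<close>

definition interp :: "nat \<Rightarrow> nat \<Rightarrow> real \<Rightarrow> real" where
  "interp e V t = 0 ^ e + (\<Sum>k<V. knot_coef e V k * max (t - real k / real V) 0)"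

lemma power_diff_le:
  fixes a b :: real
  assumes "0 \<le> a" "a \<le> b" "b \<le> 1"
  shows "b ^ e - a ^ e \<le> real e * (b - a)"
proof (induction e)
  case (Suc e)
  have "b ^ Suc e - a ^ Suc e = b * (b ^ e - a ^ e) + (b - a) * a ^ e" by (simp add: algebra_simps)
  also have "\<dots> \<le> 1 * (b ^ e - a ^ e) + (b - a) * 1"
    using assms by (intro add_mono mult_right_mono mult_left_mono) (auto simp: power_mono power_le_one)
  also have "\<dots> \<le> real (Suc e) * (b - a)" using Suc by (simp add: algebra_simps)
  finally show ?case .
qed simp

lemma knot_slope_bounds:
  assumes "k < V"
  shows "0 \<le> knot_slope e V k" "knot_slope e V k \<le> real e"
proof -
  have V: "0 < real V" "real (Suc k) / real V \<le> 1" using assms by auto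
  have le: "real k / real V \<le> real (Suc k) / real V" using V(1) by (simp add: divide_right_mono)
  show "0 \<le> knot_slope e V k" unfolding knot_slope_def
    using power_mono[OF le, of e] V(1) by simp
  have "(real (Suc k) / real V) ^ e - (real k / real V) ^ e \<le> real e * (real (Suc k) / real V - real k / real V)"
    by (rule power_diff_le) (use V le in auto)
  also have "\<dots> = real e / real V" by (simp add: diff_divide_distrib[symmetric])
  finally have "knot_slope e V k \<le> real V * (real e / real V)"
    unfolding knot_slope_def using V(1) by (intro mult_left_mono) auto
  then show "knot_slope e V k \<le> real e" using V(1) by simp
qed

text \<open>The bound does not involve V, so one fixed rescaling makes the coefficients admissible
  weights however fine the knots are.\<close>

lemma knot_coef_bound:
  assumes "k < V"
  shows "\<bar>knot_coef e V k\<bar> \<le> 2 * real e"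
proof -
  have "k - 1 < V" using assms by simp
  from knot_slope_bounds[OF assms, of e] knot_slope_bounds[OF this, of e]
  show ?thesis unfolding knot_coef_def abs_le_iff by (cases "k = 0") simp_all
qed

text \<open>On the r-th piece the active ReLUs telescope to the chord. By monotonicity the chord and
  the power both lie between the same two knot values, which differ by at most e / V.\<close>

lemma interp_bounds:
  assumes V: "1 \<le> V" and t: "0 \<le> t" "t \<le> 1"
  shows "0 \<le> interp e V t" "interp e V t \<le> 1" "\<bar>interp e V t - t ^ e\<bar> \<le> real e / real V"
proof -
  have V0: "0 < real V" using V by simp
  \<comment> \<open>The endpoint t = 1 is assigned to the last piece, since r must stay below
    V.\<close>
  obtain r where r: "r < V" "real r / real V \<le> t" "t \<le> real (Suc r) / real V"
  proof (cases "t = 1")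
    case True
    show ?thesis by (rule that[of "V - 1"]) (use V True in \<open>auto simp: field_simps\<close>)
  next
    case False
    define r where "r = nat \<lfloor>t * real V\<rfloor>"
    have "real r \<le> t * real V" "t * real V < real r + 1"
      using t V0 by (auto simp: r_def)
    moreover have "t * real V < 1 * real V" using False t V0 by (intro mult_strict_right_mono) auto
    ultimately have "real r < real V" by linarith
    then show ?thesis
      by (intro that[of r]) (use \<open>real r \<le> t * real V\<close> \<open>t * real V < real r + 1\<close> V0 in \<open>auto simp: field_simps\<close>)
  qed
  have tel: "(\<Sum>k\<le>q. knot_coef e V k * (t - real k / real V))
      = (real q / real V) ^ e - 0 ^ e + knot_slope e V q * (t - real q / real V)" for q
  proof (induction q)
    case 0
    then show ?case by (simp add: knot_coef_def)
  next
    case (Suc q)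
    have "knot_slope e V q * (real (Suc q) / real V - real q / real V)
        = (real (Suc q) / real V) ^ e - (real q / real V) ^ e"
      unfolding knot_slope_def using V0 by (simp add: diff_divide_distrib[symmetric])
    then have "(real (Suc q) / real V) ^ e = (real q / real V) ^ e
        + knot_slope e V q * (real (Suc q) / real V) - knot_slope e V q * (real q / real V)"
      by (simp only: right_diff_distrib)
    moreover have "knot_coef e V (Suc q) = knot_slope e V (Suc q) - knot_slope e V q"
      by (simp add: knot_coef_def)
    ultimately show ?case
      unfolding sum.atMost_Suc Suc by (simp only: left_diff_distrib right_diff_distrib)
  qed
  have "(\<Sum>k<V. knot_coef e V k * max (t - real k / real V) 0)
      = (\<Sum>k\<le>r. knot_coef e V k * max (t - real k / real V) 0)"
  proof (rule sum.mono_neutral_right)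
    show "\<forall>k\<in>{..<V} - {..r}. knot_coef e V k * max (t - real k / real V) 0 = 0"
    proof
      fix k assume "k \<in> {..<V} - {..r}"
      then have "real (Suc r) / real V \<le> real k / real V" using V0 by (intro divide_right_mono) auto
      then show "knot_coef e V k * max (t - real k / real V) 0 = 0" using r by simp
    qed
  qed (use r in auto)
  also have "\<dots> = (\<Sum>k\<le>r. knot_coef e V k * (t - real k / real V))"
  proof (rule sum.cong[OF refl])
    fix k assume "k \<in> {..r}"
    then have "real k / real V \<le> real r / real V" using V0 by (intro divide_right_mono) auto
    then show "knot_coef e V k * max (t - real k / real V) 0 = knot_coef e V k * (t - real k / real V)"
      using r by simp
  qed
  finally have eq: "interp e V t = (real r / real V) ^ e + knot_slope e V r * (t - real r / real V)"
    by (simp add: interp_def tel)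
  have s: "0 \<le> knot_slope e V r" using knot_slope_bounds r by blast
  have "knot_slope e V r * (t - real r / real V) \<le> knot_slope e V r * (1 / real V)"
    using r s by (intro mult_left_mono) (auto simp: add_divide_distrib)
  also have "\<dots> = (real (Suc r) / real V) ^ e - (real r / real V) ^ e"
    unfolding knot_slope_def using V0 by simp
  finally have up: "interp e V t \<le> (real (Suc r) / real V) ^ e" by (simp add: eq)
  have lo: "(real r / real V) ^ e \<le> interp e V t" unfolding eq using s r by simp
  show "0 \<le> interp e V t" using lo V0 by (meson order_trans zero_le_power divide_nonneg_nonneg of_nat_0_le_iff)
  have "(real (Suc r) / real V) ^ e \<le> 1" using r by (intro power_le_one) auto
  then show "interp e V t \<le> 1" using up by simp
  have "(real r / real V) ^ e \<le> t ^ e" "t ^ e \<le> (real (Suc r) / real V) ^ e"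
    using r t by (auto intro!: power_mono)
  moreover have "(real (Suc r) / real V) ^ e - (real r / real V) ^ e \<le> real e / real V"
    using knot_slope_bounds(2)[of r V e] r V0 unfolding knot_slope_def by (simp add: field_simps)
  ultimately show "\<bar>interp e V t - t ^ e\<bar> \<le> real e / real V" using up lo by linarith
qed

text \<open>Pigeonhole: of n + 1 candidates at spacing 2 \<eta>, each of the n points comes closer
  than \<eta> to at most one.\<close>

lemma exists_separated_point:
  fixes y :: "nat \<Rightarrow> real"
  assumes "0 < \<eta>"
  shows "\<exists>t. lo \<le> t \<and> t \<le> lo + 2 * \<eta> * real n \<and> (\<forall>k<n. \<eta> \<le> \<bar>y k - t\<bar>)"
proof (rule ccontr)
  assume neg: "\<not> ?thesis"
  have "\<forall>q\<le>n. \<exists>k<n. \<bar>y k - (lo + 2 * \<eta> * real q)\<bar> < \<eta>"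
  proof (intro allI impI)
    fix q assume "q \<le> n"
    then have "2 * \<eta> * real q \<le> 2 * \<eta> * real n" using assms by simp
    then have "\<not> (\<forall>k<n. \<eta> \<le> \<bar>y k - (lo + 2 * \<eta> * real q)\<bar>)"
      using neg assms by (metis add_increasing2 add_left_mono mult_nonneg_nonneg of_nat_0_le_iff order.refl less_imp_le zero_le_numeral)
    then show "\<exists>k<n. \<bar>y k - (lo + 2 * \<eta> * real q)\<bar> < \<eta>" by (auto simp: not_le)
  qed
  then obtain h where h: "\<And>q. q \<le> n \<Longrightarrow> h q < n \<and> \<bar>y (h q) - (lo + 2 * \<eta> * real q)\<bar> < \<eta>"
    by metis
  have "inj_on h {..n}"
  proof (rule inj_onI)
    fix q q' assume q: "q \<in> {..n}" "q' \<in> {..n}" "h q = h q'"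
    have "\<bar>2 * \<eta> * real q - 2 * \<eta> * real q'\<bar> < 2 * \<eta>" using h[of q] h[of q'] q by auto
    then have "2 * \<eta> * \<bar>real q - real q'\<bar> < 2 * \<eta> * 1"
      using assms by (simp add: abs_mult right_diff_distrib[symmetric])
    then have "\<bar>real q - real q'\<bar> < 1" using assms by simp
    then show "q = q'" by linarith
  qed
  then have "card {..n} \<le> card {..<n}" using h by (intro card_inj_on_le[of h]) auto
  then show False by simp
qed

lemma exists_bracket:
  fixes t :: "nat \<Rightarrow> real"
  assumes "1 \<le> M" "t 0 \<le> x" "x \<le> t M"
  shows "\<exists>r<M. t r \<le> x \<and> x \<le> t (Suc r)"
  using assms
proof (induction M)
  case (Suc M)
  show ?case
  proof (cases "M = 0 \<or> t M \<le> x")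
    case True
    then show ?thesis using Suc.prems by (intro exI[of _ M]) auto
  next
    case False
    then have "\<exists>r<M. t r \<le> x \<and> x \<le> t (Suc r)" using Suc by auto
    then show ?thesis using less_Suc_eq by blast
  qed
qed simp

lemma computes_mono: "computes p w l S I G \<Longrightarrow> S \<le> S' \<Longrightarrow> computes p w l S' I G"
  unfolding computes_def by (meson order_trans)

section \<open>The gated network over the cells\<close>

locale cell_network =
  fixes p M A E :: nat and J :: "'j set" and u :: "'j \<Rightarrow> nat \<Rightarrow> real" and e :: "'j \<Rightarrow> nat"
    and t :: "nat \<Rightarrow> nat \<Rightarrow> real" and c :: "(nat \<Rightarrow> nat) \<Rightarrow> 'j \<Rightarrow> real" and C :: real
  assumes p: "1 \<le> p" and M: "1 \<le> M" and finJ: "finite J"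
    and u0: "\<And>j i. j \<in> J \<Longrightarrow> i < p \<Longrightarrow> 0 \<le> u j i"
    and usum: "\<And>j. j \<in> J \<Longrightarrow> (\<Sum>i<p. u j i) \<le> 1"
    and e: "\<And>j. j \<in> J \<Longrightarrow> e j \<le> E"
    and t01: "\<And>i r. i < p \<Longrightarrow> r \<le> M \<Longrightarrow> 0 \<le> t i r \<and> t i r \<le> 1"
    and C: "0 \<le> C"
    and c: "\<And>\<kappa> j. \<kappa> \<in> PiE {..<p} (\<lambda>_. {..<M}) \<Longrightarrow> j \<in> J \<Longrightarrow> \<bar>c \<kappa> j\<bar> \<le> C"
begin

definition V :: nat where "V = M ^ p"
definition \<omega> :: real where "\<omega> = 1 / real V ^ A"
definition cells :: "(nat \<Rightarrow> nat) set" where "cells = PiE {..<p} (\<lambda>_. {..<M})"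
definition ridge :: "'j \<Rightarrow> (nat \<Rightarrow> real) \<Rightarrow> real" where "ridge j x = (\<Sum>i<p. u j i * x i)"
text \<open>Once c holds the expansion coefficients divided by 2 F, the shift by 1/2 makes P
  approximate (1 + f/F) / 2, which lies in [0,1]. Truncation at 0 then does no harm.\<close>

definition P :: "(nat \<Rightarrow> nat) \<Rightarrow> (nat \<Rightarrow> real) \<Rightarrow> real" where
  "P \<kappa> x = 1 / 2 + (\<Sum>j\<in>J. c \<kappa> j * interp (e j) V (ridge j x))"
definition wall :: "(nat \<Rightarrow> nat) \<Rightarrow> (nat \<Rightarrow> real) \<Rightarrow> real" where
  "wall \<kappa> x = (\<Sum>i<p. max (t i (\<kappa> i) - x i) 0 + max (x i - t i (Suc (\<kappa> i))) 0)"
text \<open>Subtracting the distance to the cell switches off the cells that do not contain x, without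
  any multiplication, as long as the polynomial part is scaled below the separation.\<close>
definition gate :: "(nat \<Rightarrow> nat) \<Rightarrow> (nat \<Rightarrow> real) \<Rightarrow> real" where
  "gate \<kappa> x = max (\<omega> * P \<kappa> x - wall \<kappa> x) 0"
text \<open>Reflection at 1 lets a single ReLU truncate from above, while the gates are nonnegative
  anyway. The output therefore lies in [0,1] on the whole cube, also close to the walls, where it
  approximates nothing.\<close>

definition net_out :: "(nat \<Rightarrow> real) \<Rightarrow> real" where
  "net_out x = max (1 - real V ^ A * (\<Sum>\<kappa>\<in>cells. gate \<kappa> x)) 0"

lemma V1: "1 \<le> V" using M by (simp add: V_def)

lemma finite_cells: "finite cells" unfolding cells_def by (intro finite_PiE) auto

lemma card_cells: "card cells = V" by (simp add: cells_def V_def card_PiE)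

lemma u_le1: "j \<in> J \<Longrightarrow> i < p \<Longrightarrow> u j i \<le> 1"
  using usum[of j] member_le_sum[of i "{..<p}" "u j"] u0 by fastforce

lemma ridge01: "j \<in> J \<Longrightarrow> x \<in> cube p \<Longrightarrow> 0 \<le> ridge j x \<and> ridge j x \<le> 1"
proof -
  assume j: "j \<in> J" and x: "x \<in> cube p"
  have x01: "0 \<le> x i" "x i \<le> 1" if "i < p" for i using x that by (auto simp: cube_def)
  have "(\<Sum>i<p. u j i * x i) \<le> (\<Sum>i<p. u j i * 1)"
    using u0[OF j] x01 by (intro sum_mono mult_left_mono) auto
  then show ?thesis
    using usum[OF j] u0[OF j] x01 by (auto simp: ridge_def intro!: sum_nonneg)
qed

lemma net_out_01: "0 \<le> net_out x" "net_out x \<le> 1"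
proof -
  have "0 \<le> real V ^ A * (\<Sum>\<kappa>\<in>cells. gate \<kappa> x)"
    by (intro mult_nonneg_nonneg sum_nonneg) (auto simp: gate_def)
  then show "0 \<le> net_out x" "net_out x \<le> 1" by (auto simp: net_out_def)
qed

text \<open>One-sided distances to the walls are computed once per coordinate and shared by all
  cells, at the price of 2 p (M + 1) neurons.\<close>

definition T :: "(bool \<times> nat \<times> nat) set" where "T = UNIV \<times> {..<p} \<times> {..M}"

lemma finT: "finite T" by (simp add: T_def)
lemma cardT: "card T = 2 * p * (M + 1)" by (simp add: T_def card_cartesian_product)

fun G1 :: "(bool \<times> nat \<times> nat) + ('j \<times> nat) \<Rightarrow> (nat \<Rightarrow> real) \<Rightarrow> real" where
  "G1 (Inl (b, i, r)) x = max (if b then t i r - x i else x i - t i r) 0"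
| "G1 (Inr (j, k)) x = max (ridge j x - real k / real V) 0"

fun A1 :: "(bool \<times> nat \<times> nat) + ('j \<times> nat) \<Rightarrow> nat \<Rightarrow> real" where
  "A1 (Inl (b, i, r)) i' = (if i' = i then (if b then -1 else 1) else 0)"
| "A1 (Inr (j, k)) i' = u j i'"

fun b1 :: "(bool \<times> nat \<times> nat) + ('j \<times> nat) \<Rightarrow> real" where
  "b1 (Inl (b, i, r)) = (if b then t i r else - t i r)"
| "b1 (Inr (j, k)) = - (real k / real V)"

text \<open>Division by 2 E + 1 brings the knot coefficients into [-1,1]. The factor is returned in
  \<open>A3\<close>, where the small scale \<open>\<omega>\<close> absorbs it.\<close>

fun G2 :: "(bool \<times> nat \<times> nat) + 'j \<Rightarrow> (nat \<Rightarrow> real) \<Rightarrow> real" where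
  "G2 (Inl q) x = G1 (Inl q) x"
| "G2 (Inr j) x = interp (e j) V (ridge j x) / (2 * real E + 1)"

fun A2 :: "(bool \<times> nat \<times> nat) + 'j \<Rightarrow> (bool \<times> nat \<times> nat) + ('j \<times> nat) \<Rightarrow> real" where
  "A2 (Inl q) (Inl q') = (if q' = q then 1 else 0)"
| "A2 (Inr j) (Inr (j', k)) = (if j' = j then knot_coef (e j) V k / (2 * real E + 1) else 0)"
| "A2 _ _ = 0"

fun b2 :: "(bool \<times> nat \<times> nat) + 'j \<Rightarrow> real" where
  "b2 (Inl q) = 0"
| "b2 (Inr j) = 0 ^ e j / (2 * real E + 1)"

fun A3 :: "(nat \<Rightarrow> nat) \<Rightarrow> (bool \<times> nat \<times> nat) + 'j \<Rightarrow> real" where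
  "A3 \<kappa> (Inl (b, i, r)) = (if r = (if b then \<kappa> i else Suc (\<kappa> i)) then -1 else 0)"
| "A3 \<kappa> (Inr j) = \<omega> * c \<kappa> j * (2 * real E + 1)"

definition I1 where "I1 = Inl ` T \<union> Inr ` (J \<times> {..<V})"
definition I2 where "I2 = Inl ` T \<union> Inr ` J"

lemma finI: "finite I1" "finite I2" using finT finJ by (auto simp: I1_def I2_def)

lemma sum_Plus_image:
  fixes h :: "'c + 'd \<Rightarrow> real"
  assumes "finite S" "finite S'"
  shows "(\<Sum>y\<in>Inl ` S \<union> Inr ` S'. h y) = (\<Sum>y\<in>S. h (Inl y)) + (\<Sum>y\<in>S'. h (Inr y))"
  using assms by (subst sum.union_disjoint) (auto simp: sum.reindex inj_on_def)

lemma card_Plus_image: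
  "finite S \<Longrightarrow> finite S' \<Longrightarrow> card (Inl ` S \<union> Inr ` S') = card S + card S'"
  by (subst card_Un_disjoint) (auto simp: card_image inj_on_def)

lemma cardI: "card I1 = 2 * p * (M + 1) + card J * V" "card I2 = 2 * p * (M + 1) + card J"
  unfolding I1_def I2_def using finT finJ by (simp_all add: card_Plus_image cardT card_cartesian_product)

lemma layer1:
  assumes w: "w 0 = p" "card I1 \<le> w 1"
  shows "computes p w 1 (p * card I1 + card I1) I1 G1"
proof -
  have "computes p w (Suc 0) (0 + card (I1 \<times> {..<p}) + card I1) I1 G1"
  proof (rule computes_layer[where A = A1 and b = b1 and I = "{..<p}" and G = "\<lambda>i x. x i"])
    show "computes p w 0 0 {..<p} (\<lambda>i x. x i)" using w by (intro computes_input)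
    show "\<bar>A1 y i\<bar> \<le> 1" if "y \<in> I1" "i \<in> {..<p}" for y i
      using that u0 u_le1 by (auto simp: I1_def T_def)
    show "\<bar>b1 y\<bar> \<le> 1" if "y \<in> I1" for y
      using that t01 V1 by (auto simp: I1_def T_def)
    fix y x assume y: "y \<in> I1" and x: "x \<in> cube p"
    show "G1 y x = max ((\<Sum>i<p. A1 y i * x i) + b1 y) 0"
    proof (cases y)
      case (Inl q)
      obtain b i r where q: "q = (b, i, r)" by (cases q)
      have "i < p" using y by (auto simp: I1_def T_def Inl q)
      then have "(\<Sum>i'<p. A1 y i' * x i') = (if b then -1 else 1) * x i"
        by (simp add: Inl q if_distrib[of "\<lambda>z. z * _"] sum.delta cong: if_cong)
      then show ?thesis by (simp add: Inl q)
    next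
      case (Inr q)
      then show ?thesis by (cases q) (simp add: ridge_def)
    qed
  qed (use w finI in auto)
  then show ?thesis by (simp add: card_cartesian_product mult.commute)
qed

lemma layer2:
  assumes G: "computes p w l S I1 G1" and w: "card I2 \<le> w (Suc l)"
  shows "computes p w (Suc l) (S + card I1 + card I2) I2 G2"
proof -
  \<comment> \<open>Wall neurons are passed on and each interpolant reads only its own knots, so
    there are no more weights than neurons in the first layer.\<close>
  define R where "R = (\<lambda>q. (Inl q :: (bool \<times> nat \<times> nat) + 'j, Inl q :: (bool \<times> nat \<times> nat) + ('j \<times> nat))) ` T
      \<union> (\<lambda>jk. (Inr (fst jk), Inr jk)) ` (J \<times> {..<V})"
  have fR: "finite R" using finT finJ by (simp add: R_def)
  have "card R \<le> card T + card (J \<times> {..<V})"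
    unfolding R_def by (intro order_trans[OF card_Un_le] add_mono card_image_le finT) (use finJ in auto)
  then have cR: "card R \<le> card I1" by (simp add: cardI cardT card_cartesian_product)
  have "computes p w (Suc l) (S + card R + card I2) I2 G2"
  proof (rule computes_layer[where A = A2 and b = b2, OF G])
    fix y y' assume "y \<in> I2" "y' \<in> I1" "(y, y') \<notin> R"
    then show "A2 y y' = 0"
      by (cases y; cases y') (auto simp: R_def I1_def I2_def image_iff)
  next
    fix y y' assume y: "y \<in> I2" "y' \<in> I1"
    have "\<bar>knot_coef (e j) V k / (2 * real E + 1)\<bar> \<le> 1" if "j \<in> J" "k < V" for j k
      using knot_coef_bound[OF that(2), of "e j"] e[OF that(1)] by (simp add: abs_divide)
    then show "\<bar>A2 y y'\<bar> \<le> 1" using y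
      by (cases y; cases y') (auto simp: I1_def I2_def)
  next
    fix y assume "y \<in> I2"
    have "\<bar>0 ^ k / (2 * real E + 1)\<bar> \<le> 1" for k
      by (cases k) (auto simp: abs_divide)
    then show "\<bar>b2 y\<bar> \<le> 1" by (cases y) auto
  next
    fix y x assume y: "y \<in> I2" and x: "x \<in> cube p"
    show "G2 y x = max ((\<Sum>y'\<in>I1. A2 y y' * G1 y' x) + b2 y) 0"
    proof (cases y)
      case (Inl q)
      have q: "q \<in> T" using y by (auto simp: I2_def Inl)
      have "(\<Sum>y'\<in>I1. A2 y y' * G1 y' x) = (\<Sum>q'\<in>T. if q' = q then G1 (Inl q') x else 0)"
        unfolding I1_def using finT finJ
        by (simp add: sum_Plus_image Inl if_distrib[of "\<lambda>z. z * _"] cong: if_cong)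
      also have "\<dots> = G1 (Inl q) x" using q finT by simp
      moreover have "0 \<le> G1 (Inl q) x" by (cases q) auto
      ultimately show ?thesis by (simp add: Inl)
    next
      case (Inr j)
      have j: "j \<in> J" using y by (auto simp: I2_def Inr)
      have "(\<Sum>y'\<in>I1. A2 y y' * G1 y' x) = (\<Sum>(j', k)\<in>J \<times> {..<V}. A2 y (Inr (j', k)) * G1 (Inr (j', k)) x)"
        unfolding I1_def using finT finJ by (simp add: sum_Plus_image Inr case_prod_unfold del: A2.simps(2) G1.simps)
      also have "\<dots> = (\<Sum>j'\<in>J. \<Sum>k<V. A2 y (Inr (j', k)) * G1 (Inr (j', k)) x)"
        by (simp add: sum.cartesian_product)
      also have "\<dots> = (\<Sum>j'\<in>J. if j' = j then (\<Sum>k<V. knot_coef (e j) V k * max (ridge j x - real k / real V) 0) / (2 * real E + 1) else 0)"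
        by (rule sum.cong[OF refl]) (simp add: Inr sum_divide_distrib)
      also have "\<dots> = (\<Sum>k<V. knot_coef (e j) V k * max (ridge j x - real k / real V) 0) / (2 * real E + 1)"
        using j finJ by simp
      finally have "(\<Sum>y'\<in>I1. A2 y y' * G1 y' x) + b2 y = G2 y x"
        by (simp add: Inr interp_def add_divide_distrib[symmetric])
      moreover have "0 \<le> G2 y x" using interp_bounds(1)[OF V1] ridge01[OF j x] by (simp add: Inr)
      ultimately show ?thesis by simp
    qed
  qed (use w finI fR in auto)
  then show ?thesis by (rule computes_mono) (use cR in simp)
qed

lemma layer3:
  assumes G: "computes p w l S I2 G2" and w: "V \<le> w (Suc l)"
    and \<omega>1: "\<omega> * C * (2 * real E + 1) \<le> 1"
  shows "computes p w (Suc l) (S + V * (card J + 2 * p) + V) cells gate"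
proof -
  \<comment> \<open>A gate reads all interpolants, but in each coordinate only the two walls of its
    own cell. This keeps the number of weights linear in V.\<close>
  define Rk where "Rk \<kappa> = Inr ` J \<union> ((\<lambda>i. Inl (True, i, \<kappa> i)) ` {..<p} \<union> (\<lambda>i. Inl (False, i, Suc (\<kappa> i))) ` {..<p})"
    for \<kappa> :: "nat \<Rightarrow> nat"
  have fRk: "finite (Rk \<kappa>)" for \<kappa> using finJ by (simp add: Rk_def)
  have cRk: "card (Rk \<kappa>) \<le> card J + 2 * p" for \<kappa>
  proof -
    have "card (Rk \<kappa>) \<le> card J + (card {..<p} + card {..<p})"
      unfolding Rk_def
      by (intro order_trans[OF card_Un_le] add_mono card_image_le finJ) auto
    then show ?thesis by simp
  qed
  define R where "R = (SIGMA \<kappa>:cells. Rk \<kappa>)"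
  have fR: "finite R" unfolding R_def using finite_cells fRk by blast
  have "card R = (\<Sum>\<kappa>\<in>cells. card (Rk \<kappa>))" unfolding R_def using finite_cells fRk by simp
  also have "\<dots> \<le> V * (card J + 2 * p)"
    using sum_bounded_above[of cells "\<lambda>\<kappa>. card (Rk \<kappa>)" "card J + 2 * p"] cRk by (simp add: card_cells)
  finally have cR: "card R \<le> V * (card J + 2 * p)" .
  have V0: "0 < \<omega>" "\<omega> \<le> 1" using V1 by (auto simp: \<omega>_def)
  have "computes p w (Suc l) (S + card R + card cells) cells gate"
  proof (rule computes_layer[where A = A3 and b = "\<lambda>_. \<omega> / 2", OF G])
    fix \<kappa> y assume "\<kappa> \<in> cells" "y \<in> I2" "(\<kappa>, y) \<notin> R"
    then show "A3 \<kappa> y = 0"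
      by (cases y) (auto simp: R_def Rk_def I2_def T_def image_iff split: if_splits)
  next
    fix \<kappa> y assume k: "\<kappa> \<in> cells" and y: "y \<in> I2"
    have "\<bar>\<omega> * c \<kappa> j * (2 * real E + 1)\<bar> \<le> 1" if "j \<in> J" for j
    proof -
      have "\<bar>\<omega> * c \<kappa> j * (2 * real E + 1)\<bar> = \<omega> * \<bar>c \<kappa> j\<bar> * (2 * real E + 1)"
        using V0 by (simp add: abs_mult)
      also have "\<dots> \<le> \<omega> * C * (2 * real E + 1)"
        using c[of \<kappa> j] k that V0 by (intro mult_right_mono mult_left_mono) (auto simp: cells_def)
      finally show ?thesis using \<omega>1 by simp
    qed
    then show "\<bar>A3 \<kappa> y\<bar> \<le> 1" using y by (cases y) (auto simp: I2_def)
  next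
    show "\<bar>\<omega> / 2\<bar> \<le> 1" using V0 by simp
  next
    fix \<kappa> x assume k: "\<kappa> \<in> cells" and x: "x \<in> cube p"
    have kM: "\<kappa> i < M" if "i < p" for i using k that by (auto simp: cells_def)
    have "(\<Sum>q\<in>T. A3 \<kappa> (Inl q) * G1 (Inl q) x)
       = (\<Sum>b\<in>UNIV. \<Sum>i<p. \<Sum>r\<le>M. A3 \<kappa> (Inl (b, i, r)) * G1 (Inl (b, i, r)) x)"
      by (simp only: T_def sum.cartesian_product')
    also have "\<dots> = (\<Sum>b\<in>UNIV. \<Sum>i<p. - G1 (Inl (b, i, if b then \<kappa> i else Suc (\<kappa> i))) x)"
    proof (intro sum.cong refl)
      fix b i assume "i \<in> {..<p}"
      then have "(if b then \<kappa> i else Suc (\<kappa> i)) \<in> {..M}" using kM[of i] by auto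
      then have "(\<Sum>r\<le>M. if r = (if b then \<kappa> i else Suc (\<kappa> i)) then - G1 (Inl (b, i, r)) x else 0)
         = - G1 (Inl (b, i, if b then \<kappa> i else Suc (\<kappa> i))) x"
        by (subst sum.delta) (auto simp del: G1.simps)
      moreover have "A3 \<kappa> (Inl (b, i, r)) * G1 (Inl (b, i, r)) x
        = (if r = (if b then \<kappa> i else Suc (\<kappa> i)) then - G1 (Inl (b, i, r)) x else 0)" for r
        by (simp del: G1.simps)
      ultimately show "(\<Sum>r\<le>M. A3 \<kappa> (Inl (b, i, r)) * G1 (Inl (b, i, r)) x)
         = - G1 (Inl (b, i, if b then \<kappa> i else Suc (\<kappa> i))) x" by presburger
    qed
    also have "\<dots> = - wall \<kappa> x"
      by (simp add: UNIV_bool wall_def sum.distrib sum_negf)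
    finally have 1: "(\<Sum>q\<in>T. A3 \<kappa> (Inl q) * G1 (Inl q) x) = - wall \<kappa> x" .
    have E0: "2 * real E + 1 \<noteq> 0" by linarith
    have 2: "(\<Sum>j\<in>J. A3 \<kappa> (Inr j) * G2 (Inr j) x) = \<omega> * (\<Sum>j\<in>J. c \<kappa> j * interp (e j) V (ridge j x))"
      using E0 by (simp add: sum_distrib_left mult.assoc)
    have "(\<Sum>y\<in>I2. A3 \<kappa> y * G2 y x) = - wall \<kappa> x + \<omega> * (\<Sum>j\<in>J. c \<kappa> j * interp (e j) V (ridge j x))"
      unfolding I2_def sum_Plus_image[OF finT finJ] 2 using 1 by simp
    then show "gate \<kappa> x = max ((\<Sum>y\<in>I2. A3 \<kappa> y * G2 y x) + \<omega> / 2) 0"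
      by (simp add: gate_def P_def algebra_simps)
  qed (use w finI fR finite_cells card_cells in auto)
  then show ?thesis by (rule computes_mono) (use cR card_cells in simp)
qed

text \<open>Depth 2 A + 5: three layers up to the gates, one for their sum, 2 A for the
  amplification and one for the reflection at 1. The layers beyond that copy, at 2 parameters
  each.\<close>

lemma computes_net_out:
  assumes w: "w 0 = p" "\<And>l. 1 \<le> l \<Longrightarrow> l \<le> L \<Longrightarrow> card I1 + V \<le> w l" and L: "2 * A + 5 \<le> L"
    and \<omega>1: "\<omega> * C * (2 * real E + 1) \<le> 1"
  shows "computes p w L ((p + 3) * card I1 + V * (card J + 2 * p + 2 + 4 * A) + 3 + 2 * L) {()} (\<lambda>_. net_out)"
proof -
  have cI: "card I2 \<le> card I1" using V1 by (simp add: cardI)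
  have w': "card I1 \<le> w l" "card I2 \<le> w l" "V \<le> w l" "1 \<le> w l" if "1 \<le> l" "l \<le> L" for l
    using w(2)[OF that] cI V1 by linarith+
  have 1: "computes p w 1 (p * card I1 + card I1) I1 G1"
    by (rule layer1) (use w w'[of 1] L in auto)
  have 2: "computes p w (Suc 1) (p * card I1 + card I1 + card I1 + card I2) I2 G2"
    by (rule layer2[OF 1]) (use w'[of "Suc 1"] L in simp)
  have 3: "computes p w (Suc (Suc 1)) (p * card I1 + card I1 + card I1 + card I2 + V * (card J + 2 * p) + V)
      cells gate"
    by (rule layer3[OF 2]) (use w'[of "Suc (Suc 1)"] L \<omega>1 in simp_all)
  have sg: "0 \<le> (\<Sum>\<kappa>\<in>cells. gate \<kappa> x)" for x by (intro sum_nonneg) (simp add: gate_def)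
  define S3 where "S3 = p * card I1 + card I1 + card I1 + card I2 + V * (card J + 2 * p) + V"
  have "computes p w (Suc (Suc (Suc 1))) (S3 + card ({()} \<times> cells) + card {()}) {()}
      (\<lambda>_ x. \<Sum>\<kappa>\<in>cells. gate \<kappa> x)"
    by (rule computes_layer[where A = "\<lambda>_ _. 1" and b = "\<lambda>_. 0", OF 3[folded S3_def]])
       (use w'[of "Suc (Suc (Suc 1))"] L finite_cells in \<open>simp_all add: sg max_absorb1\<close>)
  then have 4: "computes p w 4 (S3 + V + 1) {()} (\<lambda>_ x. \<Sum>\<kappa>\<in>cells. gate \<kappa> x)"
    by (simp add: card_cells numeral_eq_Suc card_cartesian_product)
  have 5: "computes p w (4 + 2 * A) (S3 + V + 1 + A * (4 * V)) {()}
      (\<lambda>_ x. real V ^ A * (\<Sum>\<kappa>\<in>cells. gate \<kappa> x))"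
    by (rule computes_amplify[OF 4]) (use w' L V1 sg in auto)
  have "computes p w (Suc (4 + 2 * A)) (S3 + V + 1 + A * (4 * V) + card {((), ())} + card {()}) {()} (\<lambda>_. net_out)"
    by (rule computes_layer[where A = "\<lambda>_ _. -1" and b = "\<lambda>_. 1", OF 5])
       (use w'[of "Suc (4 + 2 * A)"] L in \<open>auto simp: net_out_def\<close>)
  then have 6: "computes p w (5 + 2 * A) (S3 + V + 1 + A * (4 * V) + 2) {()} (\<lambda>_. net_out)" by simp
  have 7: "computes p w (5 + 2 * A + (L - (5 + 2 * A)))
      (S3 + V + 1 + A * (4 * V) + 2 + 2 * (L - (5 + 2 * A))) {()} (\<lambda>_. net_out)"
    by (rule computes_id[OF 6 net_out_01(1)]) (use w' L in auto)
  have L5: "5 + 2 * A + (L - (5 + 2 * A)) = L" using L by simp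
  have "S3 + V + 1 + A * (4 * V) + 2 + 2 * (L - (5 + 2 * A))
      \<le> (p + 3) * card I1 + V * (card J + 2 * p + 2 + 4 * A) + 3 + 2 * L"
    using cI by (simp add: S3_def algebra_simps)
  from computes_mono[OF 7[unfolded L5] this] show ?thesis .
qed

lemma P_bound: "x \<in> cube p \<Longrightarrow> \<kappa> \<in> cells \<Longrightarrow> P \<kappa> x \<le> 1 + real (card J) * C"
proof -
  assume x: "x \<in> cube p" and k: "\<kappa> \<in> cells"
  have "(\<Sum>j\<in>J. c \<kappa> j * interp (e j) V (ridge j x)) \<le> (\<Sum>j\<in>J. C)"
  proof (rule sum_mono)
    fix j assume j: "j \<in> J"
    have "c \<kappa> j * interp (e j) V (ridge j x) \<le> C * 1"
      using c[of \<kappa> j] k j C interp_bounds[OF V1, of "ridge j x" "e j"] ridge01[OF j x]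
      by (intro mult_mono) (auto simp: cells_def)
    then show "c \<kappa> j * interp (e j) V (ridge j x) \<le> C" by simp
  qed
  then show ?thesis by (simp add: P_def)
qed

text \<open>\<open>P_bound\<close> is uniform over the cells, so the separation closes every gate
  but that of the own cell. Then \<open>real V ^ A * \<omega> = 1\<close> undoes the scaling
  exactly.\<close>

lemma net_out_eq:
  assumes x: "x \<in> cube p" and k: "\<kappa> \<in> cells" and wall0: "wall \<kappa> x = 0"
    and far: "\<And>\<kappa>'. \<kappa>' \<in> cells \<Longrightarrow> \<kappa>' \<noteq> \<kappa> \<Longrightarrow> \<omega> * (1 + real (card J) * C) \<le> wall \<kappa>' x"
  shows "net_out x = max (1 - max (P \<kappa> x) 0) 0"
proof -
  have V0: "0 < real V" using V1 by simp
  then have w0: "0 < \<omega>" by (simp add: \<omega>_def)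
  have "gate \<kappa>' x = 0" if "\<kappa>' \<in> cells - {\<kappa>}" for \<kappa>'
  proof -
    have "\<omega> * P \<kappa>' x \<le> \<omega> * (1 + real (card J) * C)"
      using P_bound[OF x, of \<kappa>'] that w0 by (intro mult_left_mono) auto
    then show ?thesis using far[of \<kappa>'] that by (simp add: gate_def)
  qed
  then have "(\<Sum>\<kappa>\<in>cells. gate \<kappa> x) = gate \<kappa> x"
    using sum.remove[OF finite_cells k, of "\<lambda>\<kappa>. gate \<kappa> x"] by simp
  also have "\<dots> = \<omega> * max (P \<kappa> x) 0"
    using w0 by (cases "P \<kappa> x \<le> 0") (simp_all add: gate_def wall0 mult_le_0_iff)
  finally show ?thesis using V0 by (simp add: net_out_def \<omega>_def)
qed

lemma P_error:
  assumes x: "x \<in> cube p" and k: "\<kappa> \<in> cells"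
  shows "\<bar>P \<kappa> x - (1 / 2 + (\<Sum>j\<in>J. c \<kappa> j * ridge j x ^ e j))\<bar> \<le> real (card J) * (C * (real E / real V))"
proof -
  have "P \<kappa> x - (1 / 2 + (\<Sum>j\<in>J. c \<kappa> j * ridge j x ^ e j))
     = (\<Sum>j\<in>J. c \<kappa> j * (interp (e j) V (ridge j x) - ridge j x ^ e j))"
    by (simp add: P_def sum_subtractf right_diff_distrib)
  also have "\<bar>\<dots>\<bar> \<le> (\<Sum>j\<in>J. C * (real E / real V))"
  proof (rule order_trans[OF sum_abs sum_mono])
    fix j assume j: "j \<in> J"
    have "\<bar>interp (e j) V (ridge j x) - ridge j x ^ e j\<bar> \<le> real (e j) / real V"
      using interp_bounds(3)[OF V1] ridge01[OF j x] by blast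
    also have "\<dots> \<le> real E / real V" using e[OF j] by (intro divide_right_mono) auto
    finally show "\<bar>c \<kappa> j * (interp (e j) V (ridge j x) - ridge j x ^ e j)\<bar> \<le> C * (real E / real V)"
      unfolding abs_mult using c[of \<kappa> j] k j C by (intro mult_mono) (auto simp: cells_def)
  qed
  finally show ?thesis by simp
qed

end

text \<open>The two assumptions \<open>amp\<close> say that the scaled polynomial part stays below
  the gap between walls and design points, and that the scaled coefficients are admissible weights.
  The factor 1 - r leaves room below F, so that a whole box of nearby parameters can survive the
  restriction of the prior.\<close>

lemma approx_network:
  fixes p n M A L E Wd :: nat and J :: "'j set" and u :: "'j \<Rightarrow> nat \<Rightarrow> real" and C \<alpha> F r :: real
    and X :: "nat \<Rightarrow> nat \<Rightarrow> real" and f :: "(nat \<Rightarrow> real) \<Rightarrow> real"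
  assumes p: "1 \<le> p" and M: "1 \<le> M" and finJ: "finite J"
    and u0: "\<And>j i. j \<in> J \<Longrightarrow> i < p \<Longrightarrow> 0 \<le> u j i"
    and usum: "\<And>j. j \<in> J \<Longrightarrow> (\<Sum>i<p. u j i) \<le> 1"
    and e: "\<And>j. j \<in> J \<Longrightarrow> e j \<le> E"
    and C: "0 \<le> C" and \<alpha>: "0 < \<alpha>" and F: "0 < F" and r: "0 \<le> r" "r \<le> 1"
    and expand: "\<And>a. a \<in> cube p \<Longrightarrow> \<exists>c. (\<forall>j\<in>J. \<bar>c j\<bar> \<le> C) \<and>
        (\<forall>x\<in>cube p. \<bar>f x - (\<Sum>j\<in>J. c j * (\<Sum>i<p. u j i * x i) ^ e j)\<bar> \<le> C * dist_inf p x a powr \<alpha>)"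
    and f: "\<And>x. x \<in> cube p \<Longrightarrow> \<bar>f x\<bar> \<le> F"
    and X: "\<And>k. k < n \<Longrightarrow> X k \<in> cube p"
    and w: "w 0 = p" "\<And>l. 1 \<le> l \<Longrightarrow> l \<le> L \<Longrightarrow> w l = Wd" "w (Suc L) = 1"
    and L: "2 * A + 5 \<le> L"
    and Wd: "2 * p * (M + 1) + card J * M ^ p + M ^ p \<le> Wd"
    and amp: "1 / real (M ^ p) ^ A * (1 + real (card J) * (C / (2 * F))) \<le> 1 / (8 * real M * (real n + 1))"
      "1 / real (M ^ p) ^ A * (C / (2 * F)) * (2 * real E + 1) \<le> 1"
  shows "\<exists>\<beta>. (\<forall>q. \<beta> q \<noteq> 0 \<longrightarrow> q \<in> par_idx L w) \<and> (\<forall>l j k. l \<le> L \<longrightarrow> \<bar>\<beta> (l, j, k)\<bar> \<le> 1) \<and>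
     (\<forall>q. \<bar>\<beta> q\<bar> \<le> 1 + 2 * F) \<and>
     card {q. \<beta> q \<noteq> 0} \<le> (p + 3) * (2 * p * (M + 1) + card J * M ^ p)
        + M ^ p * (card J + 2 * p + 2 + 4 * A) + 5 + 2 * L \<and>
     (\<forall>x. x \<in> cube p \<longrightarrow> \<bar>relu_net L w \<beta> x\<bar> \<le> F * (1 - r)) \<and>
     (\<forall>k<n. \<bar>relu_net L w \<beta> (X k) - f (X k)\<bar>
        \<le> F * r + C * (2 / real M) powr \<alpha> + real (card J) * (C * (real E / real (M ^ p))))"
proof -
  \<comment> \<open>Half the spacing of the n + 1 candidate positions of a wall. They fit into an
    interval of length 1 / (4 M), too short to disturb the order of the walls.\<close>
  define \<eta> where "\<eta> = 1 / (8 * real M * (real n + 1))"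
  have M0: "0 < real M" using M by simp
  have \<eta>0: "0 < \<eta>" using M0 by (simp add: \<eta>_def)
  have "\<eta> * n \<le> \<eta> * (n + 1)" using \<eta>0 by simp
  also have "\<dots> = 1 / (8 * real M)"
  proof -
    have "real n + 1 \<noteq> 0" by linarith
    then show ?thesis unfolding \<eta>_def using M0 by (simp add: divide_simps)
  qed
  finally have \<eta>n: "2 * \<eta> * real n \<le> 1 / (4 * real M)" by simp
  \<comment> \<open>Interior walls move left by at most a quarter of the cell width to avoid the
    design points. The outermost walls stay at 0 and 1, so that the cells cover the cube.\<close>
  have "\<exists>t. \<forall>i q. \<bar>t i q - real q / real M\<bar> \<le> 1 / (4 * real M) \<and>
        (q = 0 \<or> M \<le> q \<longrightarrow> t i q = real q / real M) \<and> t i q \<le> real q / real M \<and>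
        (1 \<le> q \<and> q < M \<longrightarrow> (\<forall>k<n. \<eta> \<le> \<bar>X k i - t i q\<bar>))"
  proof (intro choice allI)
    fix i q
    show "\<exists>t. \<bar>t - real q / real M\<bar> \<le> 1 / (4 * real M) \<and>
        (q = 0 \<or> M \<le> q \<longrightarrow> t = real q / real M) \<and> t \<le> real q / real M \<and>
        (1 \<le> q \<and> q < M \<longrightarrow> (\<forall>k<n. \<eta> \<le> \<bar>X k i - t\<bar>))"
    proof (cases "q = 0 \<or> M \<le> q")
      case True
      then show ?thesis by (intro exI[of _ "real q / real M"]) auto
    next
      case False
      from exists_separated_point[OF \<eta>0, where y = "\<lambda>k. X k i" and n = n and lo = "real q / real M - 1 / (4 * real M)"]
      obtain t where t: "real q / real M - 1 / (4 * real M) \<le> t"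
        "t \<le> real q / real M - 1 / (4 * real M) + 2 * \<eta> * real n" "\<forall>k<n. \<eta> \<le> \<bar>X k i - t\<bar>" by blast
      show ?thesis by (rule exI[of _ t]) (use t \<eta>n False M0 in auto)
    qed
  qed
  then obtain t where t1: "\<And>i q. \<bar>t i q - real q / real M\<bar> \<le> 1 / (4 * real M)"
    and t2: "\<And>i q. q = 0 \<or> M \<le> q \<Longrightarrow> t i q = real q / real M"
    and t3: "\<And>i q. t i q \<le> real q / real M"
    and t4: "\<And>i q k. 1 \<le> q \<Longrightarrow> q < M \<Longrightarrow> k < n \<Longrightarrow> \<eta> \<le> \<bar>X k i - t i q\<bar>"
    by metis
  have tmono: "t i q \<le> t i q'" if "q \<le> q'" for i q q'
  proof (cases "q = q'")
    case False
    then have "real q + 1 \<le> real q'" using that by simp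
    then have "(real q + 1) / real M \<le> real q' / real M" using M0 by (intro divide_right_mono) auto
    moreover have "1 / (4 * real M) \<le> 1 / real M" using M0 by (intro divide_left_mono) auto
    ultimately show ?thesis using t3[of i q] t1[of i q'] by (simp add: add_divide_distrib)
  qed simp
  have t01: "0 \<le> t i q \<and> t i q \<le> 1" if "q \<le> M" for i q
    using tmono[of 0 q i] tmono[of q M i] t2[of 0 i] t2[of M i] that M0 by simp
  \<comment> \<open>The expansion point of a cell is its lower corner before the shift; it lies in
    the cube and within 2 / M of every point of the shifted cell.\<close>
  define base where "base \<kappa> = (\<lambda>i. if i < p then real (\<kappa> i) / real M else 0)" for \<kappa> :: "nat \<Rightarrow> nat"
  define K where "K = PiE {..<p} (\<lambda>_. {..<M})"
  have base: "base \<kappa> \<in> cube p" if "\<kappa> \<in> K" for \<kappa>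
    using that M0 by (auto simp: base_def cube_def K_def PiE_def Pi_def less_imp_le)
  have "\<forall>\<kappa>. \<exists>c. \<kappa> \<in> K \<longrightarrow> (\<forall>j\<in>J. \<bar>c j\<bar> \<le> C) \<and>
        (\<forall>x\<in>cube p. \<bar>f x - (\<Sum>j\<in>J. c j * (\<Sum>i<p. u j i * x i) ^ e j)\<bar> \<le> C * dist_inf p x (base \<kappa>) powr \<alpha>)"
  proof
    fix \<kappa>
    show "\<exists>c. \<kappa> \<in> K \<longrightarrow> (\<forall>j\<in>J. \<bar>c j\<bar> \<le> C) \<and>
        (\<forall>x\<in>cube p. \<bar>f x - (\<Sum>j\<in>J. c j * (\<Sum>i<p. u j i * x i) ^ e j)\<bar> \<le> C * dist_inf p x (base \<kappa>) powr \<alpha>)"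
    proof (cases "\<kappa> \<in> K")
      case True
      then show ?thesis using expand[OF base[OF True]] by simp
    qed simp
  qed
  from choice[OF this] obtain c0 where c00: "\<forall>\<kappa>. \<kappa> \<in> K \<longrightarrow> (\<forall>j\<in>J. \<bar>c0 \<kappa> j\<bar> \<le> C) \<and>
        (\<forall>x\<in>cube p. \<bar>f x - (\<Sum>j\<in>J. c0 \<kappa> j * (\<Sum>i<p. u j i * x i) ^ e j)\<bar> \<le> C * dist_inf p x (base \<kappa>) powr \<alpha>)" ..
  have c0: "\<bar>c0 \<kappa> j\<bar> \<le> C" if "\<kappa> \<in> K" "j \<in> J" for \<kappa> j
    using c00[rule_format, OF that(1)] that(2) by simp
  have c0_approx: "\<bar>f x - (\<Sum>j\<in>J. c0 \<kappa> j * (\<Sum>i<p. u j i * x i) ^ e j)\<bar> \<le> C * dist_inf p x (base \<kappa>) powr \<alpha>"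
    if "\<kappa> \<in> K" "x \<in> cube p" for \<kappa> x
    using c00[rule_format, OF that(1)] that(2) by simp
  define c where "c \<kappa> j = c0 \<kappa> j / (2 * F)" for \<kappa> j
  define C' where "C' = C / (2 * F)"
  have C'0: "0 \<le> C'" using C F by (simp add: C'_def)
  note Cpos = C
  interpret cell_network p M A E J u e t c C'
  proof
    show "\<bar>c \<kappa> j\<bar> \<le> C'" if "\<kappa> \<in> PiE {..<p} (\<lambda>_. {..<M})" "j \<in> J" for \<kappa> j
      using c0[of \<kappa> j] that F by (simp add: c_def C'_def K_def abs_divide divide_right_mono)
  qed (use p M finJ u0 usum e t01 C'0 in auto)
  have cK: "cells = K" by (simp add: cells_def K_def)
  have VM: "V = M ^ p" by (simp add: V_def)
  have comp: "computes p w L ((p + 3) * card I1 + V * (card J + 2 * p + 2 + 4 * A) + 3 + 2 * L) {()} (\<lambda>_. net_out)"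
    by (rule computes_net_out) (use w Wd L amp(2) in \<open>auto simp: cardI VM \<omega>_def C'_def\<close>)
  from comp[unfolded computes_def] obtain \<beta> \<iota> where \<beta>1: "\<forall>j. \<bar>\<beta> j\<bar> \<le> 1"
    and fS: "finite {j. \<beta> j \<noteq> 0}"
    and S: "card {j. \<beta> j \<noteq> 0} \<le> (p + 3) * card I1 + V * (card J + 2 * p + 2 + 4 * A) + 3 + 2 * L"
    and supp: "\<forall>l' j k. \<beta> (l', j, k) \<noteq> 0 \<longrightarrow> 1 \<le> l' \<and> l' \<le> L \<and> j < w l' \<and> k \<le> w (l' - 1)"
    and \<iota>: "inj_on \<iota> {()}" "\<iota> ` {()} \<subseteq> {..<w L}"
    and hid: "\<forall>x\<in>cube p. \<forall>i\<in>{()}. hidden w \<beta> L x (\<iota> i) = net_out x"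
    by (elim exE conjE) (rule that)
  define m where "m = \<iota> ()"
  have m: "m < w L" using \<iota> by (simp add: m_def)
  define F' where "F' = F * (1 - r)"
  have F': "0 \<le> F'" "F' \<le> F" using F r by (auto simp: F'_def mult_left_le)
  \<comment> \<open>\<open>net_out\<close> approximates (1 - f/F) / 2 at the design points, so the
    affine output F' (1 - 2 net_out) approximates f up to the shrinkage F r. The top layer has
    Gaussian slabs and may carry weights of size 2 F.\<close>
  define \<beta>' where "\<beta>' = \<beta>((Suc L, 0, m) := - 2 * F', (Suc L, 0, w L) := F')"
  have top0: "\<beta> (Suc L, 0, k) = 0" for k using supp[rule_format, of "Suc L" 0 k] by force
  have net: "relu_net L w \<beta>' x = F' * (1 - 2 * net_out x)" if x: "x \<in> cube p" for x
  proof -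
    have "hidden w \<beta>' L x = hidden w \<beta> L x" by (rule hidden_cong) (simp add: \<beta>'_def)
    moreover have "(\<Sum>k<w L. \<beta>' (Suc L, 0, k) * hidden w \<beta> L x k)
       = (\<Sum>k<w L. if k = m then - 2 * F' * net_out x else 0)"
      by (rule sum.cong[OF refl]) (use hid x m in \<open>auto simp: \<beta>'_def top0 m_def\<close>)
    moreover have "\<beta>' (Suc L, 0, w L) = F'" by (simp add: \<beta>'_def)
    ultimately show ?thesis using m by (simp add: relu_net_def algebra_simps)
  qed
  show ?thesis
  proof (intro exI[of _ \<beta>'] conjI allI impI)
    fix q assume "\<beta>' q \<noteq> 0"
    moreover obtain l j k where q: "q = (l, j, k)" by (cases q)
    ultimately show "q \<in> par_idx L w"
      using supp[rule_format, of l j k] m w(3) by (auto simp: par_idx_def \<beta>'_def split: if_splits)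
  next
    fix l j k assume "l \<le> L"
    then show "\<bar>\<beta>' (l, j, k)\<bar> \<le> 1" using \<beta>1 by (simp add: \<beta>'_def)
  next
    fix q show "\<bar>\<beta>' q\<bar> \<le> 1 + 2 * F"
      using \<beta>1[rule_format, of q] F' F by (simp add: \<beta>'_def)
  next
    have "{q. \<beta>' q \<noteq> 0} \<subseteq> insert (Suc L, 0, m) (insert (Suc L, 0, w L) {q. \<beta> q \<noteq> 0})"
      by (auto simp: \<beta>'_def)
    then have "card {q. \<beta>' q \<noteq> 0} \<le> card (insert (Suc L, 0, m) (insert (Suc L, 0, w L) {q. \<beta> q \<noteq> 0}))"
      using fS by (intro card_mono) auto
    also have "\<dots> \<le> card {q. \<beta> q \<noteq> 0} + 2" using fS by (simp add: card_insert_if)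
    finally show "card {q. \<beta>' q \<noteq> 0} \<le> (p + 3) * (2 * p * (M + 1) + card J * M ^ p)
        + M ^ p * (card J + 2 * p + 2 + 4 * A) + 5 + 2 * L"
      using S unfolding cardI VM by linarith
  next
    fix x assume x: "x \<in> cube p"
    have "\<bar>relu_net L w \<beta>' x\<bar> \<le> F' * 1"
      unfolding net[OF x] abs_mult using F' net_out_01[of x] by (intro mult_mono) (auto simp: abs_le_iff)
    then show "\<bar>relu_net L w \<beta>' x\<bar> \<le> F * (1 - r)" by (simp add: F'_def)
  next
    fix k assume k: "k < n"
    define x where "x = X k"
    have x: "x \<in> cube p" using X k by (simp add: x_def)
    have x01: "0 \<le> x i" "x i \<le> 1" if "i < p" for i using x that by (auto simp: cube_def)
    have "\<forall>i. \<exists>q. i < p \<longrightarrow> q < M \<and> t i q \<le> x i \<and> x i \<le> t i (Suc q)"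
      using exists_bracket[OF M] t2 x01 M0 by (metis div_0 div_self of_nat_0 order_refl less_numeral_extra(3))
    then obtain \<kappa>0 where \<kappa>0: "\<And>i. i < p \<Longrightarrow> \<kappa>0 i < M \<and> t i (\<kappa>0 i) \<le> x i \<and> x i \<le> t i (Suc (\<kappa>0 i))"
      by metis
    define \<kappa> where "\<kappa> = restrict \<kappa>0 {..<p}"
    have \<kappa>: "\<kappa> i < M" "t i (\<kappa> i) \<le> x i" "x i \<le> t i (Suc (\<kappa> i))" if "i < p" for i
      using \<kappa>0[OF that] that by (auto simp: \<kappa>_def)
    have \<kappa>c: "\<kappa> \<in> cells" using \<kappa>0 by (auto simp: cells_def \<kappa>_def)
    have "wall \<kappa> x = 0" unfolding wall_def using \<kappa> by (intro sum.neutral) auto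
    moreover have "\<omega> * (1 + real (card J) * C') \<le> wall \<kappa>' x" if k': "\<kappa>' \<in> cells" "\<kappa>' \<noteq> \<kappa>" for \<kappa>'
    proof -
      have "\<exists>i<p. \<kappa>' i \<noteq> \<kappa> i"
        using PiE_ext[OF k'(1)[unfolded cells_def] \<kappa>c[unfolded cells_def]] k'(2) by auto
      then obtain i where i: "i < p" "\<kappa>' i \<noteq> \<kappa> i" by blast
      have kM: "\<kappa>' i < M" using k' i by (auto simp: cells_def)
      have sep: "\<eta> \<le> \<bar>x i - t i q\<bar>" if "1 \<le> q" "q < M" for q using t4[OF that k] by (simp add: x_def)
      \<comment> \<open>The two cells differ in coordinate i, so the wall of the own cell that faces
        the other cell is interior, and the design point x keeps distance \<eta> from it.\<close>
      have "\<eta> \<le> max (t i (\<kappa>' i) - x i) 0 + max (x i - t i (Suc (\<kappa>' i))) 0"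
      proof (cases "\<kappa>' i < \<kappa> i")
        case True
        have "t i (Suc (\<kappa>' i)) \<le> t i (\<kappa> i)" using True by (intro tmono) simp
        then show ?thesis using sep[of "\<kappa> i"] True \<kappa>[OF i(1)] by linarith
      next
        case False
        then have lt: "\<kappa> i < \<kappa>' i" using i by simp
        have "t i (Suc (\<kappa> i)) \<le> t i (\<kappa>' i)" using lt by (intro tmono) simp
        then show ?thesis using sep[of "Suc (\<kappa> i)"] lt kM \<kappa>[OF i(1)] by linarith
      qed
      also have "\<dots> \<le> wall \<kappa>' x"
        unfolding wall_def using i by (intro member_le_sum) auto
      finally show ?thesis using amp(1) by (simp add: \<omega>_def VM \<eta>_def C'_def)
    qed
    ultimately have out: "net_out x = max (1 - max (P \<kappa> x) 0) 0"
      by (intro net_out_eq x \<kappa>c) auto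
    define G where "G = (\<Sum>j\<in>J. c0 \<kappa> j * (\<Sum>i<p. u j i * x i) ^ e j)"
    have "(\<Sum>j\<in>J. c \<kappa> j * ridge j x ^ e j) = G / (2 * F)"
      by (simp add: G_def c_def ridge_def sum_divide_distrib)
    then have e1: "\<bar>P \<kappa> x - (1 / 2 + G / (2 * F))\<bar> \<le> real (card J) * (C' * (real E / real V))"
      using P_error[OF x \<kappa>c] by simp
    have "dist_inf p x (base \<kappa>) \<le> 2 / real M"
    proof (rule dist_inf_le)
      fix i assume i: "i < p"
      have "1 / (4 * real M) + 1 / real M \<le> 2 / real M" "1 / (4 * real M) \<le> 2 / real M"
        using M0 by (auto simp: field_simps)
      then show "\<bar>x i - base \<kappa> i\<bar> \<le> 2 / real M"
        using \<kappa>[OF i] t1[of i "\<kappa> i"] t1[of i "Suc (\<kappa> i)"] i M0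
        by (simp add: base_def add_divide_distrib abs_le_iff)
    qed (use p in simp)
    then have "C * dist_inf p x (base \<kappa>) powr \<alpha> \<le> C * (2 / real M) powr \<alpha>"
      using p \<alpha> Cpos by (intro mult_left_mono powr_mono2) (auto simp: dist_inf_nonneg)
    then have e2: "\<bar>f x - G\<bar> \<le> C * (2 / real M) powr \<alpha>"
      using c0_approx[of \<kappa> x] \<kappa>c x cK by (simp add: G_def)
    define d where "d = real (card J) * (C' * (real E / real V))"
    have d0: "0 \<le> d" using C'0 by (simp add: d_def)
    have fx: "\<bar>f x\<bar> \<le> F" using f x by blast
    have e3: "\<bar>2 * F * P \<kappa> x - (F + f x)\<bar> \<le> 2 * F * d + C * (2 / real M) powr \<alpha>"
    proof -
      have "2 * F * P \<kappa> x - (F + G) = 2 * F * (P \<kappa> x - (1 / 2 + G / (2 * F)))"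
        using F by (simp add: field_simps)
      then have "\<bar>2 * F * P \<kappa> x - (F + G)\<bar> \<le> 2 * F * d"
        using mult_left_mono[OF e1[folded d_def], of "2 * F"] F by (simp add: abs_mult)
      then show ?thesis using e2 by linarith
    qed
    have "2 * F * max (P \<kappa> x) 0 = max (2 * F * P \<kappa> x) 0" using F by (simp add: max_mult_distrib_left)
    then have "2 * F * net_out x = max (2 * F - max (2 * F * P \<kappa> x) 0) 0"
      unfolding out using F by (simp add: max_mult_distrib_left right_diff_distrib)
    then have "\<bar>2 * F * net_out x - (F - f x)\<bar> \<le> 2 * F * d + C * (2 / real M) powr \<alpha>"
      using e3 fx by linarith
    moreover have "\<bar>relu_net L w \<beta>' x - F * (1 - 2 * net_out x)\<bar> \<le> F * r"
    proof -
      have "relu_net L w \<beta>' x - F * (1 - 2 * net_out x) = - (F * r) * (1 - 2 * net_out x)"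
        unfolding net[OF x] F'_def by (simp add: algebra_simps)
      moreover have "\<bar>1 - 2 * net_out x\<bar> \<le> 1" using net_out_01[of x] by auto
      ultimately show ?thesis using F r by (simp add: abs_mult mult_left_le)
    qed
    moreover have "2 * F * d = real (card J) * (C * (real E / real (M ^ p)))"
      using F by (simp add: d_def C'_def VM)
    ultimately show "\<bar>relu_net L w \<beta>' (X k) - f (X k)\<bar>
        \<le> F * r + C * (2 / real M) powr \<alpha> + real (card J) * (C * (real E / real (M ^ p)))"
      unfolding x_def[symmetric] by (simp add: algebra_simps)
  qed
qed

section \<open>Perturbation bounds and the law of the data\<close>

lemma cube_abs_le_1: "x \<in> cube p \<Longrightarrow> \<bar>x k\<bar> \<le> 1"
  by (cases "k < p") (auto simp: cube_def)

lemma hidden_bound: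
  assumes B: "1 \<le> B" "\<And>q. \<bar>\<beta> q\<bar> \<le> B" and w: "\<And>k. k < l \<Longrightarrow> w k \<le> W" and x: "x \<in> cube p"
  shows "\<bar>hidden w \<beta> l x j\<bar> \<le> (B * (real W + 1)) ^ l"
  using w
proof (induction l arbitrary: j)
  case 0
  then show ?case using cube_abs_le_1[OF x] by simp
next
  case (Suc l)
  define H where "H = (B * (real W + 1)) ^ l"
  have "1 * 1 \<le> B * (real W + 1)" using B by (intro mult_mono) auto
  then have H1: "1 \<le> H" unfolding H_def by (intro one_le_power) simp
  have "\<bar>(\<Sum>k<w l. \<beta> (Suc l, j, k) * hidden w \<beta> l x k) + \<beta> (Suc l, j, w l)\<bar>
     \<le> \<bar>\<Sum>k<w l. \<beta> (Suc l, j, k) * hidden w \<beta> l x k\<bar> + B"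
    using B(2)[of "(Suc l, j, w l)"] by linarith
  also have "\<dots> \<le> (\<Sum>k<w l. B * H) + B"
    by (intro add_right_mono order_trans[OF sum_abs sum_mono])
       (use Suc B in \<open>auto simp: abs_mult H_def intro!: mult_mono\<close>)
  also have "\<dots> \<le> real W * (B * H) + B * H"
    using Suc.prems[of l] B H1 by (intro add_mono) (auto intro!: mult_right_mono)
  also have "\<dots> = (B * (real W + 1)) ^ Suc l" by (simp add: H_def algebra_simps)
  finally show ?case by (simp only: hidden.simps)
qed

text \<open>The change of a layer splits into perturbed weights acting on the old values and old
  weights acting on the change of the layer below. The first part contributes once per layer, hence
  the factor l.\<close>

lemma hidden_diff:
  assumes B: "1 \<le> B" "\<And>q. \<bar>\<beta> q\<bar> \<le> B" "\<And>q. \<bar>\<beta>' q\<bar> \<le> B" and d: "\<And>q. \<bar>\<beta> q - \<beta>' q\<bar> \<le> d"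
    and w: "\<And>k. k < l \<Longrightarrow> w k \<le> W" and x: "x \<in> cube p"
  shows "\<bar>hidden w \<beta> l x j - hidden w \<beta>' l x j\<bar> \<le> d * real l * (B * (real W + 1)) ^ l"
  using w
proof (induction l arbitrary: j)
  case 0
  then show ?case by simp
next
  case (Suc l)
  have d0: "0 \<le> d" using d[of undefined] by (meson abs_ge_zero order_trans)
  define H where "H = (B * (real W + 1)) ^ l"
  have H1: "1 \<le> H" unfolding H_def using B(1) by (intro one_le_power) (auto intro!: order_trans[OF _ mult_mono[of 1 B 1 "real W + 1"]])
  have step: "\<bar>\<beta> (Suc l, j, k) * hidden w \<beta> l x k - \<beta>' (Suc l, j, k) * hidden w \<beta>' l x k\<bar>
      \<le> d * H + B * (d * real l * H)" for k
  proof -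
    have "\<beta> (Suc l, j, k) * hidden w \<beta> l x k - \<beta>' (Suc l, j, k) * hidden w \<beta>' l x k
      = (\<beta> (Suc l, j, k) - \<beta>' (Suc l, j, k)) * hidden w \<beta> l x k
        + \<beta>' (Suc l, j, k) * (hidden w \<beta> l x k - hidden w \<beta>' l x k)" by (simp add: algebra_simps)
    also have "\<bar>\<dots>\<bar> \<le> \<bar>\<beta> (Suc l, j, k) - \<beta>' (Suc l, j, k)\<bar> * \<bar>hidden w \<beta> l x k\<bar>
        + \<bar>\<beta>' (Suc l, j, k)\<bar> * \<bar>hidden w \<beta> l x k - hidden w \<beta>' l x k\<bar>"
      by (metis abs_mult abs_triangle_ineq)
    also have "\<dots> \<le> d * H + B * (d * real l * H)"
    proof (intro add_mono mult_mono)
      show "\<bar>hidden w \<beta> l x k\<bar> \<le> H" unfolding H_def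
        by (rule hidden_bound[where W = W and p = p]) (use B Suc.prems x in auto)
      show "\<bar>hidden w \<beta> l x k - hidden w \<beta>' l x k\<bar> \<le> d * real l * H"
        unfolding H_def by (rule Suc.IH) (use Suc.prems in auto)
    qed (use B d d0 H1 in auto)
    finally show ?thesis .
  qed
  have "hidden w \<beta> (Suc l) x j = max a 0 \<Longrightarrow> hidden w \<beta>' (Suc l) x j = max b 0 \<Longrightarrow>
      \<bar>hidden w \<beta> (Suc l) x j - hidden w \<beta>' (Suc l) x j\<bar> \<le> \<bar>a - b\<bar>" for a b by linarith
  from this[OF hidden.simps(2)[THEN fun_cong, of w \<beta> l x j] hidden.simps(2)[THEN fun_cong, of w \<beta>' l x j]]
  have "\<bar>hidden w \<beta> (Suc l) x j - hidden w \<beta>' (Suc l) x j\<bar>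
     \<le> \<bar>(\<Sum>k<w l. \<beta> (Suc l, j, k) * hidden w \<beta> l x k - \<beta>' (Suc l, j, k) * hidden w \<beta>' l x k)
         + (\<beta> (Suc l, j, w l) - \<beta>' (Suc l, j, w l))\<bar>"
    by (simp add: sum_subtractf algebra_simps)
  also have "\<dots> \<le> \<bar>\<Sum>k<w l. \<beta> (Suc l, j, k) * hidden w \<beta> l x k - \<beta>' (Suc l, j, k) * hidden w \<beta>' l x k\<bar> + d"
    using d[of "(Suc l, j, w l)"] by linarith
  also have "\<dots> \<le> (\<Sum>k<w l. d * H + B * (d * real l * H)) + d"
    by (intro add_right_mono order_trans[OF sum_abs sum_mono]) (use step in auto)
  also have "\<dots> \<le> real W * (d * H + B * (d * real l * H)) + (d * H + B * (d * real l * H))"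
  proof (intro add_mono)
    show "(\<Sum>k<w l. d * H + B * (d * real l * H)) \<le> real W * (d * H + B * (d * real l * H))"
      using Suc.prems[of l] B d0 H1 by (auto intro!: mult_right_mono add_nonneg_nonneg)
    have "d * 1 \<le> d * H" using d0 H1 by (intro mult_left_mono) auto
    then show "d \<le> d * H + B * (d * real l * H)" using B d0 H1 by (simp add: add_increasing2)
  qed
  also have "\<dots> = (real W + 1) * (d * H) + (B * (real W + 1)) * (d * real l * H)" by (simp add: algebra_simps)
  also have "\<dots> \<le> (B * (real W + 1)) * (d * H) + (B * (real W + 1)) * (d * real l * H)"
    using B d0 H1 by (intro add_right_mono mult_right_mono) auto
  also have "\<dots> = d * real (Suc l) * (B * (real W + 1)) ^ Suc l" by (simp add: H_def algebra_simps)
  finally show ?case .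
qed

lemma relu_net_eq_max: "max (relu_net L w \<beta> x) 0 = hidden w \<beta> (Suc L) x 0"
  by (simp add: relu_net_def)

text \<open>The positive part of the output is a neuron of an extra hidden layer, and the negative part is the
  positive part of the network with the signs of the top layer flipped.\<close>
lemma relu_net_diff:
  assumes B: "1 \<le> B" "\<And>q. \<bar>\<beta> q\<bar> \<le> B" "\<And>q. \<bar>\<beta>' q\<bar> \<le> B" and d: "\<And>q. \<bar>\<beta> q - \<beta>' q\<bar> \<le> d"
    and w: "\<And>k. k \<le> L \<Longrightarrow> w k \<le> W" and x: "x \<in> cube p"
  shows "\<bar>relu_net L w \<beta> x - relu_net L w \<beta>' x\<bar> \<le> d * (2 * (real L + 1) * (B * (real W + 1)) ^ Suc L)"
proof -
  have neg: "- relu_net L w b x = relu_net L w (\<lambda>(l, j, k). if l = Suc L then - b (l, j, k) else b (l, j, k)) x" for b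
  proof -
    have "hidden w (\<lambda>(l, j, k). if l = Suc L then - b (l, j, k) else b (l, j, k)) l x = hidden w b l x"
      if "l \<le> L" for l
      using that by (induction l) auto
    from this[of L] show ?thesis by (simp add: relu_net_def sum_negf)
  qed
  have pos: "\<bar>max (relu_net L w b x) 0 - max (relu_net L w b' x) 0\<bar> \<le> d * (real L + 1) * (B * (real W + 1)) ^ Suc L"
    if "\<And>q. \<bar>b q\<bar> \<le> B" "\<And>q. \<bar>b' q\<bar> \<le> B" "\<And>q. \<bar>b q - b' q\<bar> \<le> d" for b b'
  proof -
    have "\<bar>hidden w b (Suc L) x 0 - hidden w b' (Suc L) x 0\<bar> \<le> d * real (Suc L) * (B * (real W + 1)) ^ Suc L"
      by (rule hidden_diff[where p = p]) (use B(1) that w x in auto)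
    then show ?thesis unfolding relu_net_eq_max by (simp add: add.commute)
  qed
  let ?n = "\<lambda>b. (\<lambda>(l, j, k). if l = Suc L then - b (l, j, k) else b (l, j, k)) :: param"
  have "\<bar>max (relu_net L w (?n \<beta>) x) 0 - max (relu_net L w (?n \<beta>') x) 0\<bar> \<le> d * (real L + 1) * (B * (real W + 1)) ^ Suc L"
    by (rule pos) (use B d in \<open>auto simp: abs_minus_commute split: prod.splits\<close>)
  then have "\<bar>max (- relu_net L w \<beta> x) 0 - max (- relu_net L w \<beta>' x) 0\<bar> \<le> d * (real L + 1) * (B * (real W + 1)) ^ Suc L"
    by (simp only: neg)
  moreover note pos[of \<beta> \<beta>', OF B(2,3) d]
  ultimately have "\<bar>relu_net L w \<beta> x - relu_net L w \<beta>' x\<bar> \<le> 2 * (d * (real L + 1) * (B * (real W + 1)) ^ Suc L)"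
    by linarith
  then show ?thesis by (simp add: algebra_simps)
qed

lemma relu_net_zero: "relu_net L w (\<lambda>_. 0) x = 0"
  by (simp add: relu_net_def)

lemma par_idx_subset:
  assumes "\<And>l. l \<le> Suc L \<Longrightarrow> w l \<le> W"
  shows "par_idx L w \<subseteq> {1..Suc L} \<times> {..<W} \<times> {..W}"
proof
  fix q assume q: "q \<in> par_idx L w"
  obtain l j k where [simp]: "q = (l, j, k)" by (cases q)
  have *: "1 \<le> l" "l \<le> Suc L" "j < w l" "k \<le> w (l - 1)" using q by (auto simp: par_idx_def)
  then have "w l \<le> W" "w (l - 1) \<le> W" by (auto intro!: assms)
  then show "q \<in> {1..Suc L} \<times> {..<W} \<times> {..W}" using * by auto
qed

lemma finite_par_idx: "finite (par_idx L w)"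
proof -
  have "w l \<le> (\<Sum>l\<le>Suc L. w l)" if "l \<le> Suc L" for l
    using that by (intro member_le_sum) auto
  from par_idx_subset[OF this] show ?thesis by (rule finite_subset) auto
qed

lemma card_par_idx_le:
  assumes "\<And>l. l \<le> Suc L \<Longrightarrow> w l \<le> W"
  shows "card (par_idx L w) \<le> (L + 1) * (W * (W + 1))"
  using card_mono[OF _ par_idx_subset[OF assms]] by (simp add: card_cartesian_product)

lemma top_idx_subset: "top_idx L w \<subseteq> par_idx L w"
  by (auto simp: top_idx_def)

lemma card_top_idx: "w (Suc L) = 1 \<Longrightarrow> card (top_idx L w) = w L + 1"
proof -
  assume w: "w (Suc L) = 1"
  have "top_idx L w = {Suc L} \<times> {0} \<times> {..w L}"
    using w by (auto simp: top_idx_def par_idx_def)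
  then show ?thesis by (simp add: card_cartesian_product)
qed

lemma finite_conn_sets: "finite (conn_sets L w s)"
  by (rule finite_subset[of _ "Pow (par_idx L w)"]) (auto simp: conn_sets_def finite_par_idx)

lemma card_conn_sets_le: "card (conn_sets L w s) \<le> card (par_idx L w) ^ s"
proof -
  have "card (conn_sets L w s) \<le> card {\<gamma>. \<gamma> \<subseteq> par_idx L w \<and> card \<gamma> = s}"
    using finite_par_idx by (intro card_mono) (auto simp: conn_sets_def)
  also have "\<dots> = card (par_idx L w) choose s" by (rule n_subsets[OF finite_par_idx])
  also have "\<dots> \<le> card (par_idx L w) ^ s"
    by (cases "s \<le> card (par_idx L w)") (auto intro: binomial_le_pow simp: binomial_eq_0)
  finally show ?thesis .
qed

lemma conn_setsD:
  assumes "\<gamma> \<in> conn_sets L w s"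
  shows "finite \<gamma>" "\<gamma> \<subseteq> par_idx L w" "top_idx L w \<subseteq> \<gamma>" "card \<gamma> = s"
  using assms finite_subset[OF _ finite_par_idx] by (auto simp: conn_sets_def)

section \<open>Exponential moments and Chernoff bound for Gaussian noise\<close>

lemma nn_integral_normal_exp:
  "(\<integral>\<^sup>+y. ennreal (exp (g * (y - \<mu>))) \<partial>density lborel (normal_density \<mu> 1)) = ennreal (exp (g\<^sup>2 / 2))"
proof -
  \<comment> \<open>Completing the square: exponential tilting moves the mean of the normal density
    by g.\<close>
  have eq: "normal_density \<mu> 1 y * exp (g * (y - \<mu>)) = exp (g\<^sup>2 / 2) * normal_density (\<mu> + g) 1 y" for y
  proof -
    have "- ((y - \<mu>)\<^sup>2 / 2) + g * (y - \<mu>) = g\<^sup>2 / 2 - (y - (\<mu> + g))\<^sup>2 / 2"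
      by (simp add: power2_eq_square field_simps)
    then show ?thesis
      by (simp add: normal_density_def exp_add[symmetric] exp_diff[symmetric] mult.commute)
  qed
  have 1: "(\<integral>\<^sup>+y. ennreal (normal_density (\<mu> + g) 1 y) \<partial>lborel) = 1"
    using prob_space.emeasure_space_1[OF prob_space_normal_density[of 1 "\<mu> + g"]]
    by (simp add: emeasure_density)
  have "(\<integral>\<^sup>+y. ennreal (exp (g * (y - \<mu>))) \<partial>density lborel (normal_density \<mu> 1))
      = (\<integral>\<^sup>+y. ennreal (exp (g\<^sup>2 / 2)) * ennreal (normal_density (\<mu> + g) 1 y) \<partial>lborel)"
    by (subst nn_integral_density) (auto simp: ennreal_mult'[symmetric] eq)
  also have "\<dots> = ennreal (exp (g\<^sup>2 / 2))" by (subst nn_integral_cmult) (auto simp: 1)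
  finally show ?thesis .
qed

abbreviation gauss :: "(nat \<Rightarrow> real) \<Rightarrow> nat \<Rightarrow> (nat \<Rightarrow> real) measure" where
  "gauss \<mu> n \<equiv> PiM {..<n} (\<lambda>i. density lborel (normal_density (\<mu> i) 1))"

lemma data_law_eq: "data_law X f0 n = gauss (\<lambda>i. f0 (X n i)) n"
  by (simp add: data_law_def)

lemma prob_space_gauss: "prob_space (gauss \<mu> n)"
  by (intro prob_space_PiM prob_space_normal_density) simp

lemma gauss_mgf:
  "(\<integral>\<^sup>+Y. ennreal (exp (\<Sum>i<n. g i * (Y i - \<mu> i))) \<partial>gauss \<mu> n) = ennreal (exp ((\<Sum>i<n. (g i)\<^sup>2) / 2))"
proof -
  interpret product_sigma_finite "\<lambda>i. density lborel (normal_density (\<mu> i) 1)"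
    by (intro product_sigma_finite.intro prob_space_imp_sigma_finite prob_space_normal_density) simp
  have "(\<integral>\<^sup>+Y. ennreal (exp (\<Sum>i<n. g i * (Y i - \<mu> i))) \<partial>gauss \<mu> n)
     = (\<integral>\<^sup>+Y. (\<Prod>i<n. ennreal (exp (g i * (Y i - \<mu> i)))) \<partial>gauss \<mu> n)"
    by (simp add: exp_sum prod_ennreal)
  also have "\<dots> = (\<Prod>i<n. \<integral>\<^sup>+y. ennreal (exp (g i * (y - \<mu> i))) \<partial>density lborel (normal_density (\<mu> i) 1))"
    by (rule product_nn_integral_prod) auto
  also have "\<dots> = ennreal (exp ((\<Sum>i<n. (g i)\<^sup>2) / 2))"
    by (simp add: nn_integral_normal_exp prod_ennreal exp_sum sum_divide_distrib)
  finally show ?thesis .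
qed

lemma measurable_gauss_component:
  "i < n \<Longrightarrow> (\<lambda>Y. Y i) \<in> borel_measurable (gauss \<mu> n)"
proof -
  assume "i < n"
  then have "(\<lambda>Y. Y i) \<in> measurable (gauss \<mu> n) (density lborel (normal_density (\<mu> i) 1))"
    by (intro measurable_component_singleton) simp
  then show ?thesis by (simp cong: measurable_cong_sets)
qed

lemma sets_gauss_sum: "{Y \<in> space (gauss \<mu> n). b \<le> (\<Sum>i<n. g i * (Y i - \<mu> i))} \<in> sets (gauss \<mu> n)"
proof -
  have "(\<lambda>Y. \<Sum>i<n. g i * (Y i - \<mu> i)) \<in> borel_measurable (gauss \<mu> n)"
    by (intro borel_measurable_sum borel_measurable_times borel_measurable_diff measurable_gauss_component) auto
  then show ?thesis by measurable
qed

lemma gauss_chernoff: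
  "measure (gauss \<mu> n) {Y \<in> space (gauss \<mu> n). b \<le> (\<Sum>i<n. g i * (Y i - \<mu> i))} \<le> exp ((\<Sum>i<n. (g i)\<^sup>2) / 2 - b)"
proof -
  interpret prob_space "gauss \<mu> n" by (rule prob_space_gauss)
  let ?h = "\<lambda>Y. \<Sum>i<n. g i * (Y i - \<mu> i)"
  let ?S = "{Y \<in> space (gauss \<mu> n). b \<le> ?h Y}"
  have "ennreal (exp b) * emeasure (gauss \<mu> n) ?S = (\<integral>\<^sup>+Y. ennreal (exp b) * indicator ?S Y \<partial>gauss \<mu> n)"
    using sets_gauss_sum by (simp add: nn_integral_cmult_indicator)
  also have "\<dots> \<le> (\<integral>\<^sup>+Y. ennreal (exp (?h Y)) \<partial>gauss \<mu> n)"
    by (intro nn_integral_mono) (auto simp: indicator_def intro!: ennreal_leI)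
  also have "\<dots> = ennreal (exp ((\<Sum>i<n. (g i)\<^sup>2) / 2))" by (rule gauss_mgf)
  finally have "ennreal (exp b * measure (gauss \<mu> n) ?S) \<le> ennreal (exp ((\<Sum>i<n. (g i)\<^sup>2) / 2))"
    by (simp add: emeasure_eq_measure ennreal_mult')
  then have "exp b * measure (gauss \<mu> n) ?S \<le> exp ((\<Sum>i<n. (g i)\<^sup>2) / 2)"
    by (subst (asm) ennreal_le_iff) auto
  then show ?thesis by (simp add: exp_diff pos_le_divide_eq mult.commute)
qed

section \<open>The slab measures: mass of small boxes and tails\<close>

abbreviation slab1 :: "nat \<Rightarrow> (nat \<Rightarrow> nat) \<Rightarrow> nat \<times> nat \<times> nat \<Rightarrow> real measure" where
  "slab1 L w q \<equiv> (if q \<in> top_idx L w then density lborel std_normal_density else uniform_measure lborel {-1..1::real})"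

lemma prob_space_slab1: "prob_space (slab1 L w q)"
  by (auto intro!: prob_space_normal_density prob_space_uniform_measure)

lemma sets_slab1 [simp]: "sets (slab1 L w q) = sets borel" by simp
lemma space_slab1 [simp]: "space (slab1 L w q) = UNIV" by simp

lemma product_prob_slab: "product_prob_space (slab1 L w)"
  by (intro product_prob_space.intro product_sigma_finite.intro product_prob_space_axioms.intro
      prob_space_imp_sigma_finite prob_space_slab1)

lemma prob_space_slab: "prob_space (slab_measure L w \<gamma>)"
  unfolding slab_measure_def by (rule prob_space_PiM) (rule prob_space_slab1)

text \<open>For a top parameter the normal density on the interval is at least its value at K + 1.
  Below the top, the interval meets [-1,1] in length at least d, even for b = 1 or b = -1, and the
  uniform density is 1/2.\<close>

lemma slab1_interval:
  assumes "\<bar>b\<bar> \<le> K" "0 < d" "d \<le> 1" "q \<notin> top_idx L w \<Longrightarrow> \<bar>b\<bar> \<le> 1"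
  shows "ennreal (min (1 / 2) (std_normal_density (K + 1)) * d) \<le> emeasure (slab1 L w q)
           (if q \<in> top_idx L w then {b - d..b + d} else {b - d..b + d} \<inter> {-1..1})"
proof (cases "q \<in> top_idx L w")
  case True
  have "ennreal (min (1 / 2) (std_normal_density (K + 1)) * d)
      \<le> ennreal (std_normal_density (K + 1)) * emeasure lborel {b - d..b + d}"
  proof -
    have "min (1 / 2) (std_normal_density (K + 1)) * d \<le> std_normal_density (K + 1) * (2 * d)"
      using assms by (intro mult_mono) auto
    then show ?thesis using assms by (simp add: ennreal_mult'[symmetric] ennreal_leI)
  qed
  also have "\<dots> = (\<integral>\<^sup>+x. ennreal (std_normal_density (K + 1)) * indicator {b - d..b + d} x \<partial>lborel)"
    by (simp add: nn_integral_cmult_indicator)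
  also have "\<dots> \<le> (\<integral>\<^sup>+x. ennreal (std_normal_density x) * indicator {b - d..b + d} x \<partial>lborel)"
  proof (intro nn_integral_mono)
    fix x :: real
    have "std_normal_density (K + 1) \<le> std_normal_density x" if "x \<in> {b - d..b + d}"
    proof -
      have "\<bar>x\<bar> \<le> \<bar>K + 1\<bar>" using that assms by auto
      then have "x\<^sup>2 \<le> (K + 1)\<^sup>2" by (simp only: abs_le_square_iff)
      then show ?thesis by (simp add: std_normal_density_def divide_right_mono)
    qed
    then show "ennreal (std_normal_density (K + 1)) * indicator {b - d..b + d} x
      \<le> ennreal (std_normal_density x) * indicator {b - d..b + d} x"
      by (auto simp: indicator_def intro!: ennreal_leI)
  qed
  also have "\<dots> = emeasure (slab1 L w q) {b - d..b + d}" using True by (simp add: emeasure_density)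
  finally show ?thesis using True by simp
next
  case False
  have b: "- 1 \<le> b" "b \<le> 1" using assms(4)[OF False] by auto
  have "{b - d..b + d} \<inter> {-1..1} = {max (b - d) (-1)..min (b + d) 1}" by auto
  then have "emeasure lborel ({-1..1} \<inter> ({b - d..b + d} \<inter> {-1..1})) = ennreal (min (b + d) 1 - max (b - d) (-1))"
    using b assms by (simp add: Int_commute Int_left_commute Int_assoc[symmetric])
  moreover have "ennreal (min (1 / 2) (std_normal_density (K + 1)) * d) \<le> ennreal ((min (b + d) 1 - max (b - d) (-1)) / 2)"
  proof (rule ennreal_leI)
    have "min (1 / 2) (std_normal_density (K + 1)) * d \<le> 1 / 2 * d"
      using assms by (intro mult_right_mono) auto
    also have "1 / 2 * d \<le> (min (b + d) 1 - max (b - d) (-1)) / 2"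
      using b assms(2,3) by (auto simp: min_def max_def)
    finally show "min (1 / 2) (std_normal_density (K + 1)) * d \<le> (min (b + d) 1 - max (b - d) (-1)) / 2" .
  qed
  moreover have "ennreal ((min (b + d) 1 - max (b - d) (-1)) / 2) = ennreal (min (b + d) 1 - max (b - d) (-1)) / 2"
    using divide_ennreal[of "min (b + d) 1 - max (b - d) (-1)" 2] b assms(2) by (simp add: min_def max_def)
  ultimately show ?thesis using False
    by (simp add: emeasure_uniform_measure)
qed

definition slab_box :: "nat \<Rightarrow> (nat \<Rightarrow> nat) \<Rightarrow> (nat \<times> nat \<times> nat) set \<Rightarrow> param \<Rightarrow> real \<Rightarrow> param set" where
  "slab_box L w \<gamma> b d = PiE \<gamma> (\<lambda>q. if q \<in> top_idx L w then {b q - d..b q + d} else {b q - d..b q + d} \<inter> {-1..1})"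

lemma sets_slab_box: "finite \<gamma> \<Longrightarrow> slab_box L w \<gamma> b d \<in> sets (slab_measure L w \<gamma>)"
  unfolding slab_box_def slab_measure_def by (rule sets_PiM_I_finite) auto

lemma emeasure_slab_box:
  assumes "finite \<gamma>" "\<And>q. q \<in> \<gamma> \<Longrightarrow> \<bar>b q\<bar> \<le> K" "0 < d" "d \<le> 1"
    and "\<And>q. q \<in> \<gamma> \<Longrightarrow> q \<notin> top_idx L w \<Longrightarrow> \<bar>b q\<bar> \<le> 1"
  shows "ennreal ((min (1 / 2) (std_normal_density (K + 1)) * d) ^ card \<gamma>)
     \<le> emeasure (slab_measure L w \<gamma>) (slab_box L w \<gamma> b d)"
proof -
  interpret slab: product_prob_space "slab1 L w" \<gamma> by (rule product_prob_slab)
  have "ennreal ((min (1 / 2) (std_normal_density (K + 1)) * d) ^ card \<gamma>)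
     = (\<Prod>q\<in>\<gamma>. ennreal (min (1 / 2) (std_normal_density (K + 1)) * d))"
    using assms by (simp add: ennreal_power)
  also have "\<dots> \<le> (\<Prod>q\<in>\<gamma>. emeasure (slab1 L w q)
           (if q \<in> top_idx L w then {b q - d..b q + d} else {b q - d..b q + d} \<inter> {-1..1}))"
    by (intro prod_mono_ennreal slab1_interval) (use assms in auto)
  also have "\<dots> = emeasure (slab_measure L w \<gamma>) (slab_box L w \<gamma> b d)"
    unfolding slab_measure_def slab_box_def
    by (subst slab.emeasure_PiM) (use assms in auto)
  finally show ?thesis .
qed

lemma slab_box_ext0:
  assumes "\<beta> \<in> slab_box L w \<gamma> b d" "\<And>q. q \<notin> \<gamma> \<Longrightarrow> b q = 0" "0 \<le> d"
  shows "\<bar>ext0 \<gamma> \<beta> q - b q\<bar> \<le> d"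
proof (cases "q \<in> \<gamma>")
  case True
  then have "\<beta> q \<in> {b q - d..b q + d}"
    using PiE_mem[OF assms(1)[unfolded slab_box_def] True] by (simp split: if_splits)
  then show ?thesis using True by (auto simp: ext0_def)
qed (use assms in \<open>auto simp: ext0_def\<close>)

text \<open>Chernoff's bound with exponent 1, applied to x and to -x through g = 1 and g = -1. The
  rate exp(-B) is enough, because the cutoff used later is B = n^2.\<close>

lemma std_normal_tail:
  "emeasure (density lborel std_normal_density) {x. B < \<bar>x\<bar>} \<le> ennreal (2 * exp (1 / 2 - B))"
proof -
  let ?M = "density lborel std_normal_density"
  have 1: "emeasure ?M {x. B < g * x} \<le> ennreal (exp (1 / 2 - B))" if g: "g\<^sup>2 = 1" for g
  proof -
    have "emeasure ?M {x. B < g * x} = (\<integral>\<^sup>+x. indicator {x. B < g * x} x \<partial>?M)" by simp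
    also have "\<dots> \<le> (\<integral>\<^sup>+x. ennreal (exp (- B)) * ennreal (exp (g * (x - 0))) \<partial>?M)"
      by (intro nn_integral_mono) (auto simp: indicator_def ennreal_mult'[symmetric] exp_add[symmetric] ennreal_1[symmetric]
         simp del: ennreal_1 intro!: ennreal_leI)
    also have "\<dots> = ennreal (exp (- B)) * ennreal (exp (g\<^sup>2 / 2))"
      by (subst nn_integral_cmult) (auto simp only: nn_integral_normal_exp, simp)
    also have "\<dots> = ennreal (exp (1 / 2 - B))"
      by (simp add: g ennreal_mult'[symmetric] exp_add[symmetric])
    finally show ?thesis .
  qed
  have "{x. B < \<bar>x\<bar>} = {x. B < 1 * x} \<union> {x. B < - 1 * x}" by auto
  then have "emeasure ?M {x. B < \<bar>x\<bar>} \<le> emeasure ?M {x. B < 1 * x} + emeasure ?M {x. B < - 1 * x}"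
    by (simp only:) (rule emeasure_subadditive, auto)
  also have "\<dots> \<le> ennreal (exp (1 / 2 - B)) + ennreal (exp (1 / 2 - B))"
    by (intro add_mono 1) auto
  finally show ?thesis by (simp add: ennreal_plus[symmetric] del: ennreal_plus)
qed

lemma measurable_slab_component:
  assumes "q \<in> \<gamma>"
  shows "(\<lambda>\<beta>. \<beta> q) \<in> borel_measurable (slab_measure L w \<gamma>)"
proof -
  have "(\<lambda>\<beta>. \<beta> q) \<in> measurable (slab_measure L w \<gamma>) (slab1 L w q)"
    unfolding slab_measure_def using assms by (rule measurable_component_singleton)
  then show ?thesis by (simp cong: measurable_cong_sets)
qed

text \<open>A union bound over \<gamma>. Uniform slabs and inactive coordinates never exceed B \<ge>
  1, so only Gaussian coordinates can leave the range.\<close>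

lemma slab_tail:
  assumes fin: "finite \<gamma>" and B: "1 \<le> B"
  shows "emeasure (slab_measure L w \<gamma>) {\<beta> \<in> space (slab_measure L w \<gamma>). \<exists>q. B < \<bar>ext0 \<gamma> \<beta> q\<bar>}
     \<le> ennreal (real (card \<gamma>) * (2 * exp (1 / 2 - B)))"
proof -
  interpret slab: product_prob_space "slab1 L w" \<gamma> by (rule product_prob_slab)
  let ?S = "slab_measure L w \<gamma>"
  have tail1: "emeasure (slab1 L w q) {x. B < \<bar>x\<bar>} \<le> ennreal (2 * exp (1 / 2 - B))" for q
  proof (cases "q \<in> top_idx L w")
    case False
    have "{-1..1} \<inter> {x::real. B < \<bar>x\<bar>} = {}" using B by auto
    then show ?thesis using False by (simp add: emeasure_uniform_measure)
  qed (use std_normal_tail in simp)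
  have meas: "{\<beta> \<in> space ?S. B < \<bar>\<beta> q\<bar>} \<in> sets ?S" if "q \<in> \<gamma>" for q
    using measurable_slab_component[OF that] by measurable
  have comp: "emeasure ?S {\<beta> \<in> space ?S. B < \<bar>\<beta> q\<bar>} \<le> ennreal (2 * exp (1 / 2 - B))" if q: "q \<in> \<gamma>" for q
  proof -
    have "emeasure ?S {\<beta> \<in> space ?S. B < \<bar>\<beta> q\<bar>} = emeasure (distr ?S (slab1 L w q) (\<lambda>\<beta>. \<beta> q)) {x. B < \<bar>x\<bar>}"
      unfolding slab_measure_def using q
      by (subst emeasure_distr) (auto intro!: arg_cong2[where f = emeasure])
    also have "distr ?S (slab1 L w q) (\<lambda>\<beta>. \<beta> q) = slab1 L w q"
      unfolding slab_measure_def by (rule slab.PiM_component[OF q])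
    finally show ?thesis using tail1 by simp
  qed
  have "{\<beta> \<in> space ?S. \<exists>q. B < \<bar>ext0 \<gamma> \<beta> q\<bar>} = (\<Union>q\<in>\<gamma>. {\<beta> \<in> space ?S. B < \<bar>\<beta> q\<bar>})"
    using B by (auto simp: ext0_def split: if_splits)
  then have "emeasure ?S {\<beta> \<in> space ?S. \<exists>q. B < \<bar>ext0 \<gamma> \<beta> q\<bar>} \<le> (\<Sum>q\<in>\<gamma>. emeasure ?S {\<beta> \<in> space ?S. B < \<bar>\<beta> q\<bar>})"
    using fin meas by (auto intro!: emeasure_subadditive_finite)
  also have "\<dots> \<le> (\<Sum>q\<in>\<gamma>. ennreal (2 * exp (1 / 2 - B)))" by (intro sum_mono comp)
  also have "\<dots> = ennreal (real (card \<gamma>) * (2 * exp (1 / 2 - B)))"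
    by (simp add: ennreal_mult' ennreal_of_nat_eq_real_of_nat)
  finally show ?thesis .
qed

text \<open>Parameters have a countable index set, so the Borel sets of their product topology are
  those of the product measure space. Measurability can be checked by coordinates here, while
  continuous functions of the parameters count as Borel below.\<close>

lemma measurable_ext0: "ext0 \<gamma> \<in> measurable (slab_measure L w \<gamma>) borel"
proof -
  have "ext0 \<gamma> \<in> measurable (slab_measure L w \<gamma>) (PiM UNIV (\<lambda>_. borel))"
    unfolding ext0_def
  proof (rule measurable_PiM_single')
    fix q show "(\<lambda>\<beta>. if q \<in> \<gamma> then \<beta> q else 0) \<in> borel_measurable (slab_measure L w \<gamma>)"
      by (cases "q \<in> \<gamma>") (simp_all add: measurable_slab_component)
  qed simp
  then show ?thesis by (simp cong: measurable_cong_sets add: sets_PiM_equal_borel)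
qed

lemma continuous_hidden: "continuous_on UNIV (\<lambda>\<beta>. hidden w \<beta> l x j)"
proof (induction l arbitrary: j)
  case (Suc l)
  show ?case by (simp, intro continuous_intros Suc continuous_on_product_coordinates)
qed simp

lemma continuous_relu_net: "continuous_on UNIV (\<lambda>\<beta>. relu_net L w \<beta> x)"
  unfolding relu_net_def by (intro continuous_intros continuous_hidden continuous_on_product_coordinates)

lemma measurable_relu_net [measurable]: "(\<lambda>\<beta>. relu_net L w \<beta> x) \<in> borel_measurable borel"
  by (rule borel_measurable_continuous_onI[OF continuous_relu_net])

text \<open>The bound ranges over uncountably many x. It is still a Borel condition on the
  parameters, as an intersection of closed sets.\<close>

lemma sets_sup_bounded: "{\<beta>. sup_bounded p F (relu_net L w \<beta>)} \<in> sets borel"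
proof -
  have "closed {\<beta>. \<bar>relu_net L w \<beta> x\<bar> \<le> F}" for x
    by (intro closed_Collect_le continuous_intros continuous_relu_net)
  moreover have "{\<beta>. sup_bounded p F (relu_net L w \<beta>)} = (\<Inter>x\<in>cube p. {\<beta>. \<bar>relu_net L w \<beta> x\<bar> \<le> F})"
    by (auto simp: sup_bounded_def)
  ultimately have "closed {\<beta>. sup_bounded p F (relu_net L w \<beta>)}" by auto
  then show ?thesis by (rule borel_closed)
qed

section \<open>The prior as a functional\<close>

abbreviation bnd :: "nat \<Rightarrow> real \<Rightarrow> nat \<Rightarrow> (nat \<Rightarrow> nat) \<Rightarrow> param \<Rightarrow> ennreal" where
  "bnd p F L w \<beta> \<equiv> (if sup_bounded p F (relu_net L w \<beta>) then 1 else 0)"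

lemma measurable_bnd: "bnd p F L w \<in> borel_measurable borel"
proof -
  have "(\<lambda>\<beta>. indicator {\<beta>. sup_bounded p F (relu_net L w \<beta>)} \<beta> :: ennreal) \<in> borel_measurable borel"
    using sets_sup_bounded by (rule borel_measurable_indicator)
  also have "(\<lambda>\<beta>. indicator {\<beta>. sup_bounded p F (relu_net L w \<beta>)} \<beta> :: ennreal) = bnd p F L w"
    by (auto simp: indicator_def fun_eq_iff)
  finally show ?thesis .
qed

lemma measurable_slab_comp:
  "G \<in> borel_measurable borel \<Longrightarrow> (\<lambda>\<beta>. G (ext0 \<gamma> \<beta>)) \<in> borel_measurable (slab_measure L w \<gamma>)"
  by (rule measurable_compose[OF measurable_ext0])

lemma ss_int_mono:
  assumes "\<And>\<gamma> \<beta>. \<gamma> \<in> conn_sets L w s \<Longrightarrow> G (ext0 \<gamma> \<beta>) \<le> G' (ext0 \<gamma> \<beta>)"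
  shows "ss_int L w s G \<le> ss_int L w s G'"
  unfolding ss_int_def using assms
  by (auto intro!: divide_right_mono_ennreal sum_mono nn_integral_mono)

lemma ss_int_const: "conn_sets L w s \<noteq> {} \<Longrightarrow> ss_int L w s (\<lambda>_. K) = K"
proof -
  assume ne: "conn_sets L w s \<noteq> {}"
  then have c: "card (conn_sets L w s) \<noteq> 0" using finite_conn_sets by simp
  have "(\<integral>\<^sup>+\<beta>. K \<partial>slab_measure L w \<gamma>) = K" for \<gamma>
    using prob_space.emeasure_space_1[OF prob_space_slab] by simp
  then show ?thesis using ne c
    by (simp add: ss_int_def ennreal_mult_divide_eq mult.commute[of "of_nat _"])
qed

lemma ss_int_const_le: "ss_int L w s (\<lambda>_. K) \<le> K"
  using ss_int_const[of L w s K] by (cases "conn_sets L w s = {}") (auto simp: ss_int_def)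

lemma ss_int_add:
  assumes "G \<in> borel_measurable borel" "G' \<in> borel_measurable borel"
  shows "ss_int L w s (\<lambda>\<beta>. G \<beta> + G' \<beta>) = ss_int L w s G + ss_int L w s G'"
  unfolding ss_int_def
  by (simp add: nn_integral_add measurable_slab_comp assms sum.distrib add_divide_distrib_ennreal)

lemma ss_int_cmult:
  assumes "G \<in> borel_measurable borel"
  shows "ss_int L w s (\<lambda>\<beta>. K * G \<beta>) = K * ss_int L w s G"
  unfolding ss_int_def
  by (simp add: nn_integral_cmult measurable_slab_comp assms sum_distrib_left[symmetric] ennreal_times_divide)

lemma measurable_pair_ext0:
  fixes G :: "'a \<Rightarrow> param \<Rightarrow> ennreal"
  assumes "case_prod G \<in> borel_measurable (P \<Otimes>\<^sub>M borel)"
  shows "(\<lambda>(Y, \<beta>). G Y (ext0 \<gamma> \<beta>)) \<in> borel_measurable (P \<Otimes>\<^sub>M slab_measure L w \<gamma>)"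
proof -
  have "(\<lambda>z. (fst z, ext0 \<gamma> (snd z))) \<in> measurable (P \<Otimes>\<^sub>M slab_measure L w \<gamma>) (P \<Otimes>\<^sub>M borel)"
    by (intro measurable_Pair measurable_fst measurable_compose[OF measurable_snd measurable_ext0])
  from measurable_compose[OF this assms] show ?thesis by (simp add: case_prod_unfold)
qed

lemma measurable_ss_int:
  fixes G :: "'a \<Rightarrow> param \<Rightarrow> ennreal"
  assumes "case_prod G \<in> borel_measurable (P \<Otimes>\<^sub>M borel)"
  shows "(\<lambda>Y. ss_int L w s (G Y)) \<in> borel_measurable P"
proof -
  have "(\<lambda>Y. \<integral>\<^sup>+\<beta>. G Y (ext0 \<gamma> \<beta>) \<partial>slab_measure L w \<gamma>) \<in> borel_measurable P" for \<gamma>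
    using measurable_pair_ext0[OF assms]
    by (intro sigma_finite_measure.borel_measurable_nn_integral prob_space_imp_sigma_finite prob_space_slab)
  then show ?thesis unfolding ss_int_def by simp
qed

lemma nn_integral_ss_int:
  fixes G :: "'a \<Rightarrow> param \<Rightarrow> ennreal"
  assumes P: "sigma_finite_measure P" and G: "case_prod G \<in> borel_measurable (P \<Otimes>\<^sub>M borel)"
  shows "(\<integral>\<^sup>+Y. ss_int L w s (G Y) \<partial>P) = ss_int L w s (\<lambda>\<beta>. \<integral>\<^sup>+Y. G Y \<beta> \<partial>P)"
proof -
  have m: "(\<lambda>Y. \<integral>\<^sup>+\<beta>. G Y (ext0 \<gamma> \<beta>) \<partial>slab_measure L w \<gamma>) \<in> borel_measurable P" for \<gamma>
    using measurable_pair_ext0[OF G]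
    by (intro sigma_finite_measure.borel_measurable_nn_integral prob_space_imp_sigma_finite prob_space_slab)
  have F: "(\<integral>\<^sup>+Y. \<integral>\<^sup>+\<beta>. G Y (ext0 \<gamma> \<beta>) \<partial>slab_measure L w \<gamma> \<partial>P)
      = (\<integral>\<^sup>+\<beta>. \<integral>\<^sup>+Y. G Y (ext0 \<gamma> \<beta>) \<partial>P \<partial>slab_measure L w \<gamma>)" for \<gamma>
  proof -
    interpret pair_sigma_finite P "slab_measure L w \<gamma>"
      by (intro pair_sigma_finite.intro P prob_space_imp_sigma_finite prob_space_slab)
    show ?thesis by (rule Fubini'[symmetric]) (rule measurable_pair_ext0[OF G])
  qed
  show ?thesis
    unfolding ss_int_def using m by (simp add: nn_integral_divide nn_integral_sum F)
qed

lemma cond_prior_int_mono: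
  assumes "\<And>\<gamma> \<beta>. \<gamma> \<in> conn_sets L w s \<Longrightarrow> sup_bounded p F (relu_net L w (ext0 \<gamma> \<beta>)) \<Longrightarrow>
      G (ext0 \<gamma> \<beta>) \<le> G' (ext0 \<gamma> \<beta>)"
  shows "cond_prior_int p L F w s G \<le> cond_prior_int p L F w s G'"
  unfolding cond_prior_int_def using assms by (intro divide_right_mono_ennreal ss_int_mono) auto

lemma ss_int_bnd_le_1: "ss_int L w s (bnd p F L w) \<le> 1"
  by (rule order_trans[OF ss_int_mono ss_int_const_le]) auto

text \<open>The normalizer is at most 1, so dividing by it can only increase. If it is 0, the
  numerator vanishes too: G is bounded by \<top>, and the product of \<top> and 0 is 0.\<close>

lemma cond_prior_int_ge: "ss_int L w s (\<lambda>\<beta>. bnd p F L w \<beta> * G \<beta>) \<le> cond_prior_int p L F w s G"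
proof -
  let ?Z = "ss_int L w s (bnd p F L w)"
  show ?thesis
  proof (cases "?Z = 0")
    case True
    have "ss_int L w s (\<lambda>\<beta>. bnd p F L w \<beta> * G \<beta>) \<le> ss_int L w s (\<lambda>\<beta>. \<top> * bnd p F L w \<beta>)"
      by (intro ss_int_mono) auto
    also have "\<dots> = 0" using True by (simp add: ss_int_cmult measurable_bnd)
    finally show ?thesis by simp
  next
    case False
    let ?x = "ss_int L w s (\<lambda>\<beta>. bnd p F L w \<beta> * G \<beta>)"
    have Z1: "?Z \<le> 1" by (rule ss_int_bnd_le_1)
    then have "?Z \<noteq> \<top>" by (auto simp: top_unique)
    then have "?x = ?x * ?Z / ?Z" using False by (simp add: ennreal_mult_divide_eq)
    also have "\<dots> \<le> ?x * 1 / ?Z" using Z1 by (intro divide_right_mono_ennreal mult_left_mono) auto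
    finally show ?thesis by (simp add: cond_prior_int_def)
  qed
qed

lemma cond_prior_int_cmult:
  assumes "G \<in> borel_measurable borel"
  shows "cond_prior_int p L F w s (\<lambda>\<beta>. K * G \<beta>) = K * cond_prior_int p L F w s G"
proof -
  have "(\<lambda>\<beta>. bnd p F L w \<beta> * (K * G \<beta>)) = (\<lambda>\<beta>. K * (bnd p F L w \<beta> * G \<beta>))"
    by (simp add: mult_ac)
  then show ?thesis unfolding cond_prior_int_def
    by (simp only: ss_int_cmult borel_measurable_times_ennreal measurable_bnd assms ennreal_times_divide)
qed

text \<open>An inequality, because a vanishing normalizer gives 0 / 0 = 0 instead of K.\<close>

lemma cond_prior_int_const_le: "cond_prior_int p L F w s (\<lambda>_. K) \<le> K"
proof -
  let ?Z = "ss_int L w s (bnd p F L w)"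
  have "cond_prior_int p L F w s (\<lambda>_. K) = K * ?Z / ?Z"
    unfolding cond_prior_int_def by (simp only: mult.commute[of _ K] ss_int_cmult measurable_bnd)
  also have "\<dots> \<le> K"
  proof (cases "?Z = 0")
    case False
    moreover have "?Z \<noteq> \<top>" using ss_int_bnd_le_1[of L w s p F] by (auto simp: top_unique)
    ultimately show ?thesis by (simp add: ennreal_mult_divide_eq)
  qed simp
  finally show ?thesis .
qed

lemma cond_prior_int_add:
  assumes "G \<in> borel_measurable borel" "G' \<in> borel_measurable borel"
  shows "cond_prior_int p L F w s (\<lambda>\<beta>. G \<beta> + G' \<beta>)
     = cond_prior_int p L F w s G + cond_prior_int p L F w s G'"
  unfolding cond_prior_int_def
  by (simp only: distrib_left ss_int_add borel_measurable_times_ennreal measurable_bnd assms add_divide_distrib_ennreal)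

lemma measurable_bnd_times:
  fixes G :: "'a \<Rightarrow> param \<Rightarrow> ennreal"
  assumes "case_prod G \<in> borel_measurable (P \<Otimes>\<^sub>M borel)"
  shows "(\<lambda>(Y, \<beta>). bnd p F L w \<beta> * G Y \<beta>) \<in> borel_measurable (P \<Otimes>\<^sub>M borel)"
proof -
  have "(\<lambda>z. bnd p F L w (snd z) * case_prod G z) \<in> borel_measurable (P \<Otimes>\<^sub>M borel)"
    by (intro borel_measurable_times_ennreal assms measurable_compose[OF measurable_snd measurable_bnd])
  then show ?thesis by (simp add: case_prod_unfold)
qed

lemma measurable_cond_prior_int:
  fixes G :: "'a \<Rightarrow> param \<Rightarrow> ennreal"
  assumes "case_prod G \<in> borel_measurable (P \<Otimes>\<^sub>M borel)"
  shows "(\<lambda>Y. cond_prior_int p L F w s (G Y)) \<in> borel_measurable P"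
  unfolding cond_prior_int_def
  by (intro borel_measurable_divide_ennreal measurable_ss_int measurable_bnd_times assms borel_measurable_const)

lemma nn_integral_cond_prior_int:
  fixes G :: "'a \<Rightarrow> param \<Rightarrow> ennreal"
  assumes P: "sigma_finite_measure P" and G: "case_prod G \<in> borel_measurable (P \<Otimes>\<^sub>M borel)"
  shows "(\<integral>\<^sup>+Y. cond_prior_int p L F w s (G Y) \<partial>P) = cond_prior_int p L F w s (\<lambda>\<beta>. \<integral>\<^sup>+Y. G Y \<beta> \<partial>P)"
proof -
  have "(\<lambda>Y. G Y \<beta>) \<in> borel_measurable P" for \<beta>
    using measurable_compose[OF measurable_Pair2'[of \<beta> borel P] G] by simp
  then have "(\<lambda>\<beta>. \<integral>\<^sup>+Y. bnd p F L w \<beta> * G Y \<beta> \<partial>P) = (\<lambda>\<beta>. bnd p F L w \<beta> * (\<integral>\<^sup>+Y. G Y \<beta> \<partial>P))"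
    by (simp add: nn_integral_cmult)
  then show ?thesis
    unfolding cond_prior_int_def
    using measurable_ss_int[OF measurable_bnd_times[OF G]] nn_integral_ss_int[OF P measurable_bnd_times[OF G]]
    by (simp add: nn_integral_divide)
qed

text \<open>The sieve cuts off the sparsity level s, which the integrand of prior_int does not see.\<close>
definition prior_int_s :: "nat \<Rightarrow> nat \<Rightarrow> real \<Rightarrow> real \<Rightarrow> real \<Rightarrow> (nat \<Rightarrow> nat \<Rightarrow> param \<Rightarrow> ennreal) \<Rightarrow> ennreal" where
  "prior_int_s p L F lam lams G =
     (\<Sum>N. \<Sum>s. ennreal (pi_N lam (Suc N) * exp (- lams * real s)) *
               cond_prior_int p L F (width p L (Suc N)) s (G (Suc N) s))"

lemma prior_int_eq: "prior_int p L F lam lams G = prior_int_s p L F lam lams (\<lambda>N s. G N)"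
  by (simp add: prior_int_def prior_int_s_def)

lemma prior_int_s_mono:
  assumes "\<And>N s. 1 \<le> N \<Longrightarrow> cond_prior_int p L F (width p L N) s (G N s) \<le> cond_prior_int p L F (width p L N) s (G' N s)"
  shows "prior_int_s p L F lam lams G \<le> prior_int_s p L F lam lams G'"
  unfolding prior_int_s_def using assms by (intro suminf_le mult_left_mono summableI) auto

lemma prior_int_s_cmult:
  assumes "\<And>N s. G N s \<in> borel_measurable borel"
  shows "prior_int_s p L F lam lams (\<lambda>N s \<beta>. K * G N s \<beta>) = K * prior_int_s p L F lam lams G"
  unfolding prior_int_s_def
  by (simp add: cond_prior_int_cmult assms mult.left_commute[of _ K])

lemma prior_int_s_add:
  assumes "\<And>N s. G N s \<in> borel_measurable borel" "\<And>N s. G' N s \<in> borel_measurable borel"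
  shows "prior_int_s p L F lam lams (\<lambda>N s \<beta>. G N s \<beta> + G' N s \<beta>)
    = prior_int_s p L F lam lams G + prior_int_s p L F lam lams G'"
  unfolding prior_int_s_def
  by (simp add: cond_prior_int_add assms distrib_left suminf_add summableI)

lemma measurable_prior_int_s:
  fixes G :: "'a \<Rightarrow> nat \<Rightarrow> nat \<Rightarrow> param \<Rightarrow> ennreal"
  assumes "\<And>N s. case_prod (\<lambda>Y. G Y N s) \<in> borel_measurable (P \<Otimes>\<^sub>M borel)"
  shows "(\<lambda>Y. prior_int_s p L F lam lams (G Y)) \<in> borel_measurable P"
  unfolding prior_int_s_def
  by (intro borel_measurable_suminf_order borel_measurable_times_ennreal borel_measurable_const
      measurable_cond_prior_int assms)

lemma nn_integral_prior_int_s: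
  fixes G :: "'a \<Rightarrow> nat \<Rightarrow> nat \<Rightarrow> param \<Rightarrow> ennreal"
  assumes P: "sigma_finite_measure P" and G: "\<And>N s. case_prod (\<lambda>Y. G Y N s) \<in> borel_measurable (P \<Otimes>\<^sub>M borel)"
  shows "(\<integral>\<^sup>+Y. prior_int_s p L F lam lams (G Y) \<partial>P)
    = prior_int_s p L F lam lams (\<lambda>N s \<beta>. \<integral>\<^sup>+Y. G Y N s \<beta> \<partial>P)"
  unfolding prior_int_s_def
  by (simp add: nn_integral_suminf nn_integral_cmult measurable_cond_prior_int nn_integral_cond_prior_int[OF P] G
      borel_measurable_suminf_order borel_measurable_times_ennreal)

text \<open>The decay in s is shared out: half of the rate is kept to sum over s, the other half is
  conceded to the integrand in \<open>prior_int_s_le\<close> and becomes the smallness exp(-lams/2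
  sn) beyond the sieve.\<close>

definition prior_const :: "real \<Rightarrow> real \<Rightarrow> real" where
  "prior_const lam lams = (\<Sum>N. pi_N lam (Suc N)) * (\<Sum>s. exp (- (lams / 2) * real s))"

lemma pi_N_nonneg: "0 < lam \<Longrightarrow> 0 \<le> pi_N lam N"
  by (simp add: pi_N_def)

lemma summable_pi_N: "summable (\<lambda>N. pi_N lam (Suc N))"
proof -
  have "summable (\<lambda>N. lam ^ N / fact N)"
    using summable_exp[of lam] by (simp add: divide_inverse mult.commute)
  then have "summable (\<lambda>N. lam ^ Suc N / fact (Suc N) / (exp lam - 1))"
    by (intro summable_divide) (simp only: summable_Suc_iff[of "\<lambda>N. lam ^ N / fact N"])
  then show ?thesis by (simp add: pi_N_def mult.commute)
qed

lemma summable_exp_linear: "0 < c \<Longrightarrow> summable (\<lambda>s. exp (- c * real s))"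
proof -
  assume "0 < c"
  then have "summable (\<lambda>s. exp (- c) ^ s)" by (intro summable_geometric) simp
  then show ?thesis by (simp add: exp_of_nat_mult[symmetric] mult.commute)
qed

lemma prior_int_s_le:
  assumes lam: "0 < lam" "0 < lams" and k: "0 \<le> k"
    and G: "\<And>N s. 1 \<le> N \<Longrightarrow> cond_prior_int p L F (width p L N) s (G N s) \<le> ennreal (k * exp (lams / 2 * real s))"
  shows "prior_int_s p L F lam lams G \<le> ennreal (prior_const lam lams * k)"
proof -
  have sN: "summable (\<lambda>N. pi_N lam (Suc N))" by (rule summable_pi_N)
  have ss: "summable (\<lambda>s. exp (- (lams / 2) * real s))" using lam by (intro summable_exp_linear) simp
  have "prior_int_s p L F lam lams G
     \<le> (\<Sum>N. \<Sum>s. ennreal (pi_N lam (Suc N)) * (ennreal k * ennreal (exp (- (lams / 2) * real s))))"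
    unfolding prior_int_s_def
  proof (intro suminf_le summableI)
    fix N s
    have "ennreal (pi_N lam (Suc N) * exp (- lams * real s)) *
               cond_prior_int p L F (width p L (Suc N)) s (G (Suc N) s)
        \<le> ennreal (pi_N lam (Suc N) * exp (- lams * real s)) * ennreal (k * exp (lams / 2 * real s))"
      using G[of "Suc N" s] by (intro mult_left_mono) auto
    also have "\<dots> = ennreal (pi_N lam (Suc N) * (k * (exp (- lams * real s) * exp (lams / 2 * real s))))"
      using lam k by (simp add: ennreal_mult'[symmetric] pi_N_nonneg mult_ac)
    also have "exp (- lams * real s) * exp (lams / 2 * real s) = exp (- (lams / 2) * real s)"
      by (simp add: exp_add[symmetric])
    also have "ennreal (pi_N lam (Suc N) * (k * exp (- (lams / 2) * real s)))
       = ennreal (pi_N lam (Suc N)) * (ennreal k * ennreal (exp (- (lams / 2) * real s)))"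
      using lam k by (simp add: ennreal_mult' pi_N_nonneg)
    finally show "ennreal (pi_N lam (Suc N) * exp (- lams * real s)) *
               cond_prior_int p L F (width p L (Suc N)) s (G (Suc N) s)
        \<le> ennreal (pi_N lam (Suc N)) * (ennreal k * ennreal (exp (- (lams / 2) * real s)))" .
  qed
  also have "\<dots> = (\<Sum>N. ennreal (pi_N lam (Suc N))) * (ennreal k * (\<Sum>s. ennreal (exp (- (lams / 2) * real s))))"
    by (simp only: ennreal_suminf_cmult ennreal_suminf_multc)
  also have "(\<Sum>s. ennreal (exp (- (lams / 2) * real s))) = ennreal (\<Sum>s. exp (- (lams / 2) * real s))"
    by (rule suminf_ennreal2[OF _ ss]) simp
  also have "(\<Sum>N. ennreal (pi_N lam (Suc N))) = ennreal (\<Sum>N. pi_N lam (Suc N))"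
    by (rule suminf_ennreal2[OF _ sN]) (simp add: pi_N_nonneg lam)
  also have "ennreal (\<Sum>N. pi_N lam (Suc N)) * (ennreal k * ennreal (\<Sum>s. exp (- (lams / 2) * real s)))
     = ennreal (prior_const lam lams * k)"
    using k suminf_nonneg[OF sN pi_N_nonneg[OF lam(1)]] suminf_nonneg[OF ss]
    by (simp add: prior_const_def ennreal_mult'[symmetric] mult_ac)
  finally show ?thesis .
qed

lemma prior_int_s_ge:
  assumes "1 \<le> N"
  shows "ennreal (pi_N lam N * exp (- lams * real s)) * cond_prior_int p L F (width p L N) s (G N s)
     \<le> prior_int_s p L F lam lams G"
proof -
  define h where "h N s = ennreal (pi_N lam (Suc N) * exp (- lams * real s)) *
               cond_prior_int p L F (width p L (Suc N)) s (G (Suc N) s)" for N s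
  obtain N' where N': "N = Suc N'" using assms by (cases N) auto
  have "h N' s \<le> (\<Sum>s. h N' s)" using sum_le_suminf[of "h N'" "{s}"] by (simp add: summableI)
  also have "\<dots> \<le> (\<Sum>N. \<Sum>s. h N s)"
    using sum_le_suminf[of "\<lambda>N. \<Sum>s. h N s" "{N'}"] by (simp add: summableI)
  finally show ?thesis by (simp add: h_def N' prior_int_s_def)
qed

section \<open>A finite-sample posterior bound\<close>

lemma sum_power_le: "(\<Sum>i\<le>n. c ^ i) \<le> (c + 1 :: nat) ^ n"
proof (induction n)
  case (Suc n)
  have "c ^ n \<le> (c + 1) ^ n" by (rule power_mono) auto
  from mult_le_mono2[OF this, of c] have "c ^ Suc n \<le> c * (c + 1) ^ n" by simp
  with Suc have "(\<Sum>i\<le>Suc n. c ^ i) \<le> (c + 1) ^ n + c * (c + 1) ^ n"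
    unfolding sum.atMost_Suc by (rule add_mono)
  then show ?case by simp
qed simp

text \<open>One fixed sample size. \<open>sn\<close> is the sparsity cutoff of the sieve and stays
  free until the asymptotic choice.\<close>

locale regression =
  fixes p n L sn :: nat and F lam lams :: real and X :: "nat \<Rightarrow> nat \<Rightarrow> nat \<Rightarrow> real"
    and f0 :: "(nat \<Rightarrow> real) \<Rightarrow> real"
  assumes p: "1 \<le> p" and n: "1 \<le> n" and L: "1 \<le> L" and F: "0 < F" and lam: "0 < lam" "0 < lams"
    and X: "\<And>i. i < n \<Longrightarrow> X n i \<in> cube p"
begin

definition dif :: "nat \<Rightarrow> param \<Rightarrow> nat \<Rightarrow> real" where
  "dif N \<beta> i = relu_net L (width p L N) \<beta> (X n i) - f0 (X n i)"

definition eps :: "(nat \<Rightarrow> real) \<Rightarrow> nat \<Rightarrow> real" where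
  "eps Y i = Y i - f0 (X n i)"

definition LR :: "(nat \<Rightarrow> real) \<Rightarrow> nat \<Rightarrow> param \<Rightarrow> real" where
  "LR Y N \<beta> = exp ((\<Sum>i<n. dif N \<beta> i * eps Y i) - (\<Sum>i<n. (dif N \<beta> i)\<^sup>2) / 2)"

text \<open>The constant of \<open>relu_net_diff\<close> on the sieve, for parameters up to n^2 + 1
  and widths up to \<open>sn\<close>. The mesh is n^2 times finer, so that a shift by one mesh width
  moves the output by at most 1 / n^2.\<close>

definition Lip :: nat where
  "Lip = 2 * (L + 1) * ((n ^ 2 + 1) * (sn + 1)) ^ Suc L"

definition mesh :: nat where "mesh = n ^ 2 * Lip"

lemma Lip1: "1 \<le> Lip" and mesh1: "1 \<le> mesh"
proof -
  have "1 \<le> ((n ^ 2 + 1) * (sn + 1)) ^ Suc L" by (intro one_le_power) simp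
  then show "1 \<le> Lip" unfolding Lip_def by (simp only: mult.assoc) (simp add: le_add1 trans_le_add1)
  then show "1 \<le> mesh" using n by (simp add: mesh_def)
qed

text \<open>The factor at f0 does not depend on the network and cancels in the posterior, which
  leaves the likelihood ratio.\<close>

lemma lik_eq: "lik X n Y (relu_net L (width p L N) \<beta>) = lik X n Y f0 * ennreal (LR Y N \<beta>)"
proof -
  have "(Y i - relu_net L (width p L N) \<beta> (X n i))\<^sup>2 = (Y i - f0 (X n i))\<^sup>2 - 2 * (dif N \<beta> i * eps Y i) + (dif N \<beta> i)\<^sup>2" for i
    by (simp add: dif_def eps_def power2_eq_square algebra_simps)
  then have "(\<Sum>i<n. (Y i - relu_net L (width p L N) \<beta> (X n i))\<^sup>2)
      = (\<Sum>i<n. (Y i - f0 (X n i))\<^sup>2) - 2 * (\<Sum>i<n. dif N \<beta> i * eps Y i) + (\<Sum>i<n. (dif N \<beta> i)\<^sup>2)"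
    by (simp add: sum.distrib sum_subtractf sum_distrib_left)
  then have "- (\<Sum>i<n. (Y i - relu_net L (width p L N) \<beta> (X n i))\<^sup>2) / 2 =
     - (\<Sum>i<n. (Y i - f0 (X n i))\<^sup>2) / 2 + ((\<Sum>i<n. dif N \<beta> i * eps Y i) - (\<Sum>i<n. (dif N \<beta> i)\<^sup>2) / 2)"
    by (simp add: field_simps)
  then show ?thesis by (simp add: lik_def LR_def ennreal_mult'[symmetric] exp_add[symmetric])
qed

lemma width_le:
  assumes "1 \<le> N" "12 * p * N \<le> W"
  shows "width p L N l \<le> W"
proof -
  have "p * 1 \<le> p * N" using assms(1) by (intro mult_le_mono2)
  then have "p \<le> W" using assms by linarith
  then show ?thesis using assms p by (simp add: width_def)
qed

text \<open>Every admissible \<gamma> contains the fully connected top layer with 12 p N + 1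
  entries. A cutoff for s is therefore also a cutoff for N, and the sieve meets only finitely many
  widths.\<close>

lemma width_sparsity:
  assumes "\<gamma> \<in> conn_sets L (width p L N) s"
  shows "12 * p * N < s"
proof -
  have "card (top_idx L (width p L N)) \<le> card \<gamma>"
    using conn_setsD[OF assms] by (intro card_mono)
  then show ?thesis using conn_setsD[OF assms] L
    by (simp add: card_top_idx width_def)
qed

lemma net_diff:
  assumes N: "1 \<le> N" "12 * p * N \<le> sn" and \<beta>: "\<And>q. \<bar>\<beta> q\<bar> \<le> real n ^ 2 + 1" "\<And>q. \<bar>\<beta>' q\<bar> \<le> real n ^ 2 + 1"
    and d: "\<And>q. \<bar>\<beta> q - \<beta>' q\<bar> \<le> 1 / real mesh" and x: "x \<in> cube p"
  shows "\<bar>relu_net L (width p L N) \<beta> x - relu_net L (width p L N) \<beta>' x\<bar> \<le> 1 / real n ^ 2"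
proof -
  have "\<bar>relu_net L (width p L N) \<beta> x - relu_net L (width p L N) \<beta>' x\<bar>
     \<le> 1 / real mesh * (2 * (real L + 1) * ((real n ^ 2 + 1) * (real sn + 1)) ^ Suc L)"
    by (rule relu_net_diff[OF _ \<beta> d width_le[OF N] x]) simp
  also have "\<dots> = 1 / real mesh * real Lip"
    by (simp only: Lip_def of_nat_mult of_nat_power of_nat_add of_nat_1 of_nat_numeral)
  also have "\<dots> = 1 / real n ^ 2" using Lip1 n by (simp add: mesh_def)
  finally show ?thesis .
qed

definition grid :: "real set" where
  "grid = (\<lambda>k. of_int k / real mesh) ` {- int (n ^ 2 * mesh + 1)..int (n ^ 2 * mesh + 1)}"

text \<open>A center is an association list of at most \<open>sn\<close> pairs of position and grid
  value. Counting the lists accounts for the choice of the support and of the values at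
  once.\<close>

definition centers :: "nat \<Rightarrow> param set" where
  "centers N = (\<lambda>xs q. case map_of xs q of None \<Rightarrow> 0 | Some v \<Rightarrow> v) `
     {xs. set xs \<subseteq> par_idx L (width p L N) \<times> grid \<and> length xs \<le> sn}"

definition n_centers :: nat where
  "n_centers = ((L + 1) * (sn * (sn + 1)) * (2 * (n ^ 2 * mesh + 1) + 1) + 1) ^ sn"

lemma finite_grid: "finite grid" by (simp add: grid_def)

lemma card_grid: "card grid \<le> 2 * (n ^ 2 * mesh + 1) + 1"
proof -
  have "card {- int m..int m} = 2 * m + 1" for m by simp
  from this[of "n ^ 2 * mesh + 1"] show ?thesis
    unfolding grid_def using card_image_le[OF finite_atLeastAtMost_int] by metis
qed

lemma centers_finite: "finite (centers N)"
  unfolding centers_def by (intro finite_imageI finite_lists_length_le finite_cartesian_product finite_par_idx finite_grid)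

lemma card_centers:
  assumes N: "1 \<le> N" "12 * p * N \<le> sn"
  shows "card (centers N) \<le> n_centers"
proof -
  let ?A = "par_idx L (width p L N) \<times> grid"
  have fin: "finite ?A" by (intro finite_cartesian_product finite_par_idx finite_grid)
  have "card ?A \<le> (L + 1) * (sn * (sn + 1)) * (2 * (n ^ 2 * mesh + 1) + 1)"
    unfolding card_cartesian_product
    by (intro mult_le_mono card_grid card_par_idx_le width_le N)
  then have A: "card ?A + 1 \<le> (L + 1) * (sn * (sn + 1)) * (2 * (n ^ 2 * mesh + 1) + 1) + 1" by simp
  have "card (centers N) \<le> card {xs. set xs \<subseteq> ?A \<and> length xs \<le> sn}"
    unfolding centers_def by (rule card_image_le) (rule finite_lists_length_le[OF fin])
  also have "\<dots> \<le> (card ?A + 1) ^ sn"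
    using sum_power_le[where c = "card ?A" and n = sn] by (simp add: card_lists_length_le[OF fin])
  also have "\<dots> \<le> n_centers" unfolding n_centers_def using A by (rule power_mono) simp
  finally show ?thesis .
qed

lemma centers_cover:
  assumes \<gamma>: "\<gamma> \<in> conn_sets L (width p L N) s" "s \<le> sn" and \<beta>: "\<And>q. \<bar>\<beta> q\<bar> \<le> real n ^ 2" "\<And>q. q \<notin> \<gamma> \<Longrightarrow> \<beta> q = 0"
  shows "\<exists>\<beta>'\<in>centers N. \<forall>q. \<bar>\<beta> q - \<beta>' q\<bar> \<le> 1 / real mesh \<and> \<bar>\<beta>' q\<bar> \<le> real n ^ 2 + 1"
proof -
  have m0: "0 < real mesh" using mesh1 by simp
  obtain ys where ys: "set ys = \<gamma>" "distinct ys" using finite_distinct_list conn_setsD(1)[OF \<gamma>(1)] by blast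
  define h where "h q = of_int \<lfloor>\<beta> q * real mesh\<rfloor> / real mesh" for q
  define \<beta>' where "\<beta>' = (\<lambda>q. case map_of (map (\<lambda>q. (q, h q)) ys) q of None \<Rightarrow> 0 | Some v \<Rightarrow> v)"
  have \<beta>': "\<beta>' q = (if q \<in> \<gamma> then h q else 0)" for q
    by (simp add: \<beta>'_def map_of_map_restrict ys restrict_map_def)
  have h: "\<bar>\<beta> q - h q\<bar> \<le> 1 / real mesh" for q
  proof -
    have "\<beta> q - h q = (\<beta> q * real mesh - of_int \<lfloor>\<beta> q * real mesh\<rfloor>) / real mesh"
      using m0 by (simp add: h_def diff_divide_distrib)
    also have "\<bar>\<dots>\<bar> \<le> 1 / real mesh"
      unfolding abs_divide using m0 by (intro frac_le) linarith+
    finally show ?thesis .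
  qed
  have hg: "h q \<in> grid" for q
  proof -
    have "\<bar>\<beta> q * real mesh\<bar> \<le> real n ^ 2 * real mesh"
      unfolding abs_mult using \<beta>(1)[of q] by (intro mult_mono) auto
    then have "\<lfloor>\<beta> q * real mesh\<rfloor> \<in> {- int (n ^ 2 * mesh + 1)..int (n ^ 2 * mesh + 1)}"
      by (simp add: abs_le_iff le_floor_iff floor_le_iff)
    then show ?thesis unfolding h_def grid_def by blast
  qed
  have "\<beta>' \<in> centers N" unfolding centers_def \<beta>'_def
  proof (rule imageI, safe)
    fix q v assume "(q, v) \<in> set (map (\<lambda>q. (q, h q)) ys)"
    then show "q \<in> par_idx L (width p L N)" "v \<in> grid" using ys conn_setsD(2)[OF \<gamma>(1)] hg by auto
  next
    show "length (map (\<lambda>q. (q, h q)) ys) \<le> sn"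
      using distinct_card[OF ys(2)] conn_setsD(4)[OF \<gamma>(1)] \<gamma>(2) ys by simp
  qed
  moreover have "\<bar>\<beta> q - \<beta>' q\<bar> \<le> 1 / real mesh \<and> \<bar>\<beta>' q\<bar> \<le> real n ^ 2 + 1" for q
  proof -
    have m: "1 / real mesh \<le> 1" using mesh1 by simp
    have "\<bar>h q\<bar> \<le> real n ^ 2 + 1" using h[of q] \<beta>(1)[of q] m by linarith
    then show ?thesis using h[of q] \<beta>(2)[of q] by (cases "q \<in> \<gamma>") (simp_all add: \<beta>')
  qed
  ultimately show ?thesis by blast
qed

text \<open>Errors 1 / n^2 against n terms of noise at most n add up to a constant. The squares use
  (a + b)^2 \<le> (1 + c) a^2 + (1 + 1/c) b^2, with c left open because the upper and the lower
  bound need different values.\<close>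

lemma sum_dif_perturb:
  assumes "\<And>i. i < n \<Longrightarrow> \<bar>g i - g' i\<bar> \<le> 1 / real n ^ 2" "\<And>i. i < n \<Longrightarrow> \<bar>e i\<bar> \<le> real n"
  shows "(\<Sum>i<n. g i * e i) \<le> (\<Sum>i<n. g' i * e i) + (1 :: real)"
    and "c > 0 \<Longrightarrow> (\<Sum>i<n. (g i)\<^sup>2) \<le> (1 + c) * (\<Sum>i<n. (g' i)\<^sup>2) + (1 + 1 / c)"
proof -
  have n0: "0 < real n" using n by simp
  have "(\<Sum>i<n. (g i - g' i) * e i) \<le> (\<Sum>i<n. 1 / real n)"
  proof (rule sum_mono)
    fix i assume i: "i \<in> {..<n}"
    have "(g i - g' i) * e i \<le> \<bar>g i - g' i\<bar> * \<bar>e i\<bar>" by (metis abs_ge_self abs_mult)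
    also have "\<dots> \<le> 1 / real n ^ 2 * real n" using assms i by (intro mult_mono) auto
    also have "\<dots> = 1 / real n" using n0 by (simp add: power2_eq_square)
    finally show "(g i - g' i) * e i \<le> 1 / real n" .
  qed
  then show "(\<Sum>i<n. g i * e i) \<le> (\<Sum>i<n. g' i * e i) + 1"
    using n0 by (simp add: left_diff_distrib sum_subtractf)
  assume c: "c > 0"
  have "(\<Sum>i<n. (g i)\<^sup>2) \<le> (\<Sum>i<n. (1 + c) * (g' i)\<^sup>2 + (1 + 1 / c) * (1 / real n))"
  proof (rule sum_mono)
    fix i assume i: "i \<in> {..<n}"
    define a b where "a = g' i" and "b = g i - g' i"
    have "(1 + c) * a\<^sup>2 + (1 + 1 / c) * b\<^sup>2 - (a + b)\<^sup>2 = (c * a - b)\<^sup>2 / c"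
      using c by (simp add: field_simps power2_eq_square)
    moreover have "0 \<le> (c * a - b)\<^sup>2 / c" using c by simp
    ultimately have "(g i)\<^sup>2 \<le> (1 + c) * a\<^sup>2 + (1 + 1 / c) * b\<^sup>2" by (simp add: a_def b_def)
    moreover have "b\<^sup>2 \<le> 1 / real n"
    proof -
      have "\<bar>b\<bar> \<le> 1 / real n ^ 2" using assms(1)[of i] i by (simp add: b_def)
      then have "b\<^sup>2 \<le> (1 / real n ^ 2)\<^sup>2" using power_mono[of "\<bar>b\<bar>" _ 2] by simp
      also have "\<dots> = 1 / real n ^ 4" by (simp add: power_divide power_mult[symmetric])
      also have "\<dots> \<le> 1 / real n ^ 1" using n by (intro divide_left_mono power_increasing) auto
      finally show ?thesis by simp
    qed
    then have "(1 + 1 / c) * b\<^sup>2 \<le> (1 + 1 / c) * (1 / real n)" using c by (intro mult_left_mono) auto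
    ultimately show "(g i)\<^sup>2 \<le> (1 + c) * (g' i)\<^sup>2 + (1 + 1 / c) * (1 / real n)" by (simp add: a_def)
  qed
  also have "\<dots> = (1 + c) * (\<Sum>i<n. (g' i)\<^sup>2) + (1 + 1 / c)"
    using n0 by (simp add: sum.distrib sum_distrib_left)
  finally show "(\<Sum>i<n. (g i)\<^sup>2) \<le> (1 + c) * (\<Sum>i<n. (g' i)\<^sup>2) + (1 + 1 / c)" .
qed

text \<open>Transfer from the nearest center with c = 1/2. If Q is the sum of squares at \<beta>,
  the cross term is at most (3/2 Q + 3) / 4 + En + 1; subtracting Q / 2 leaves -Q / 8 + En plus a
  constant below 2.\<close>

lemma LR_sieve:
  assumes \<gamma>: "\<gamma> \<in> conn_sets L (width p L N) s" "s \<le> sn" and N: "1 \<le> N"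
    and \<beta>: "\<And>q. \<bar>\<beta> q\<bar> \<le> real n ^ 2" "\<And>q. q \<notin> \<gamma> \<Longrightarrow> \<beta> q = 0"
    and cen: "\<And>\<beta>'. \<beta>' \<in> centers N \<Longrightarrow>
        (\<Sum>i<n. dif N \<beta>' i * eps Y i) \<le> (\<Sum>i<n. (dif N \<beta>' i)\<^sup>2) / 4 + En"
    and eps: "\<And>i. i < n \<Longrightarrow> \<bar>eps Y i\<bar> \<le> real n" and t: "t \<le> (\<Sum>i<n. (dif N \<beta> i)\<^sup>2)"
  shows "LR Y N \<beta> \<le> exp (- t / 8 + En + 2)"
proof -
  have N2: "12 * p * N \<le> sn" using width_sparsity[OF \<gamma>(1)] \<gamma>(2) by simp
  have "\<exists>\<beta>'\<in>centers N. \<forall>q. \<bar>\<beta> q - \<beta>' q\<bar> \<le> 1 / real mesh \<and> \<bar>\<beta>' q\<bar> \<le> real n ^ 2 + 1"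
    by (rule centers_cover[OF \<gamma> \<beta>(1)]) (rule \<beta>(2))
  then obtain \<beta>' where \<beta>': "\<beta>' \<in> centers N"
    and near: "\<And>q. \<bar>\<beta> q - \<beta>' q\<bar> \<le> 1 / real mesh" "\<And>q. \<bar>\<beta>' q\<bar> \<le> real n ^ 2 + 1" by blast
  have close: "\<bar>dif N \<beta> i - dif N \<beta>' i\<bar> \<le> 1 / real n ^ 2" if "i < n" for i
  proof -
    have "\<bar>\<beta> q\<bar> \<le> real n ^ 2 + 1" for q using \<beta>(1)[of q] by linarith
    from net_diff[OF N N2 this near(2) near(1) X[OF that]] show ?thesis by (simp add: dif_def)
  qed
  then have close': "\<bar>dif N \<beta>' i - dif N \<beta> i\<bar> \<le> 1 / real n ^ 2" if "i < n" for i
    using that by (simp add: abs_minus_commute)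
  have "(\<Sum>i<n. dif N \<beta> i * eps Y i) \<le> (\<Sum>i<n. dif N \<beta>' i * eps Y i) + 1"
    by (rule sum_dif_perturb(1)[OF close eps])
  moreover have "(\<Sum>i<n. (dif N \<beta>' i)\<^sup>2) \<le> (1 + 1 / 2) * (\<Sum>i<n. (dif N \<beta> i)\<^sup>2) + (1 + 1 / (1 / 2))"
    by (rule sum_dif_perturb(2)[OF close' eps]) auto
  ultimately have "(\<Sum>i<n. dif N \<beta> i * eps Y i) - (\<Sum>i<n. (dif N \<beta> i)\<^sup>2) / 2 \<le> - t / 8 + En + 2"
    using cen[OF \<beta>'] t by argo
  then show ?thesis by (simp add: LR_def)
qed

text \<open>A lower bound for the prior average of the likelihood ratio. Its factors are the weights
  of N and s, the least ratio on the box around the approximating network, the mass of that box, and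
  the reciprocal of a bound for the number of connectivity sets.\<close>

definition evidence :: "nat \<Rightarrow> nat \<Rightarrow> real \<Rightarrow> real \<Rightarrow> real" where
  "evidence N s K \<tau> = pi_N lam N * exp (- lams * real s) * exp (- 2 * \<tau> - 2) *
     (min (1 / 2) (std_normal_density (K + 1)) / real mesh) ^ s / real ((L + 1) * (sn * (sn + 1))) ^ s"

lemma std_normal_min_pos: "0 < min (1 / 2) (std_normal_density K)"
  by (simp add: std_normal_density_def)

lemma evidence_pos:
  assumes "1 \<le> sn"
  shows "0 < evidence N s K \<tau>"
proof -
  have "0 < real ((L + 1) * (sn * (sn + 1)))" using assms by (simp only: of_nat_0_less_iff) simp
  then show ?thesis
    unfolding evidence_def using lam mesh1 std_normal_min_pos[of "K + 1"]
    by (intro divide_pos_pos mult_pos_pos zero_less_power) (auto simp: pi_N_def)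
qed

text \<open>Only one width, one s and one \<gamma> are kept, namely the support of \<beta> together
  with the top layer, and there only the box of radius 1 / mesh around \<beta>. On it the output
  moves by at most 1 / n^2, so it respects F and the likelihood ratio stays controlled.\<close>

lemma evidence_lower_bound:
  assumes N: "1 \<le> N" and supp: "\<And>q. \<beta> q \<noteq> 0 \<Longrightarrow> q \<in> par_idx L (width p L N)"
    and \<beta>1: "\<And>l j k. l \<le> L \<Longrightarrow> \<bar>\<beta> (l, j, k)\<bar> \<le> 1" and K: "\<And>q. \<bar>\<beta> q\<bar> \<le> K" "K \<le> real n ^ 2"
    and s: "s = card ({q. \<beta> q \<noteq> 0} \<union> top_idx L (width p L N))" "s \<le> sn"
    and sup: "\<And>x. x \<in> cube p \<Longrightarrow> \<bar>relu_net L (width p L N) \<beta> x\<bar> \<le> F - 1 / real n ^ 2"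
    and \<tau>: "(\<Sum>i<n. (dif N \<beta> i)\<^sup>2) \<le> \<tau>"
    and Y: "- \<tau> \<le> (\<Sum>i<n. dif N \<beta> i * eps Y i)" and eps: "\<And>i. i < n \<Longrightarrow> \<bar>eps Y i\<bar> \<le> real n"
  shows "lik X n Y f0 * ennreal (evidence N s K \<tau>)
     \<le> prior_int p L F lam lams (\<lambda>N \<beta>. lik X n Y (relu_net L (width p L N) \<beta>))"
proof -
  define w where "w = width p L N"
  define \<gamma> where "\<gamma> = {q. \<beta> q \<noteq> 0} \<union> top_idx L w"
  have \<gamma>: "\<gamma> \<in> conn_sets L w s" using supp top_idx_subset s by (auto simp: \<gamma>_def conn_sets_def w_def)
  have N2: "12 * p * N \<le> sn" using width_sparsity[OF \<gamma>[unfolded w_def]] s by simp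
  have \<beta>0: "\<beta> q = 0" if "q \<notin> \<gamma>" for q using that by (auto simp: \<gamma>_def)
  define d where "d = 1 / real mesh"
  have d: "0 < d" "d \<le> 1" using mesh1 by (auto simp: d_def)
  have nontop: "\<bar>\<beta> q\<bar> \<le> 1" if "q \<in> \<gamma>" "q \<notin> top_idx L w" for q
  proof -
    obtain l j k where q: "q = (l, j, k)" by (cases q)
    have "q \<in> par_idx L w" using \<gamma> that by (auto simp: conn_sets_def)
    then have "l \<noteq> Suc L" "l \<le> Suc L" using that(2) by (auto simp: top_idx_def par_idx_def q)
    then show ?thesis using \<beta>1[of l j k] by (simp add: q)
  qed
  define c where "c = min (1 / 2) (std_normal_density (K + 1))"
  have box: "ennreal ((c * d) ^ s) \<le> emeasure (slab_measure L w \<gamma>) (slab_box L w \<gamma> \<beta> d)"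
    using emeasure_slab_box[of \<gamma> \<beta> K d L w] conn_setsD[OF \<gamma>] K d nontop by (simp add: c_def)
  have good: "bnd p F L w (ext0 \<gamma> b) = 1 \<and> exp (- 2 * \<tau> - 2) \<le> LR Y N (ext0 \<gamma> b)"
    if b: "b \<in> slab_box L w \<gamma> \<beta> d" for b
  proof -
    have near: "\<bar>ext0 \<gamma> b q - \<beta> q\<bar> \<le> 1 / real mesh" for q
      using slab_box_ext0[OF b \<beta>0] d by (simp add: d_def)
    have b1: "\<bar>ext0 \<gamma> b q\<bar> \<le> real n ^ 2 + 1" for q
      using near[of q] K(1)[of q] K(2) d unfolding d_def by linarith
    have b2: "\<bar>\<beta> q\<bar> \<le> real n ^ 2 + 1" for q using K(1)[of q] K(2) by linarith
    have nd: "\<bar>relu_net L w (ext0 \<gamma> b) x - relu_net L w \<beta> x\<bar> \<le> 1 / real n ^ 2" if "x \<in> cube p" for x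
      unfolding w_def by (rule net_diff[OF N N2 b1 b2 near that])
    have "\<bar>relu_net L w (ext0 \<gamma> b) x\<bar> \<le> F" if "x \<in> cube p" for x
      using nd[OF that] sup[OF that] by (simp add: w_def)
    then have sb: "sup_bounded p F (relu_net L w (ext0 \<gamma> b))" by (simp add: sup_bounded_def)
    have close: "\<bar>dif N (ext0 \<gamma> b) i - dif N \<beta> i\<bar> \<le> 1 / real n ^ 2" if "i < n" for i
      using nd[OF X[OF that]] by (simp add: dif_def w_def)
    have close': "\<bar>dif N \<beta> i - dif N (ext0 \<gamma> b) i\<bar> \<le> 1 / real n ^ 2" if "i < n" for i
      using close[OF that] by (simp add: abs_minus_commute)
    have 1: "(\<Sum>i<n. dif N \<beta> i * eps Y i) \<le> (\<Sum>i<n. dif N (ext0 \<gamma> b) i * eps Y i) + 1"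
      by (rule sum_dif_perturb(1)[OF close' eps])
    \<comment> \<open>With c = 1 half the squares cost at most \<tau> + 1, and the cross term costs
      another \<tau> + 1.\<close>
    have "(\<Sum>i<n. (dif N (ext0 \<gamma> b) i)\<^sup>2) \<le> (1 + 1) * (\<Sum>i<n. (dif N \<beta> i)\<^sup>2) + (1 + 1 / 1)"
      by (rule sum_dif_perturb(2)[OF close eps]) auto
    then have "- 2 * \<tau> - 2 \<le> (\<Sum>i<n. dif N (ext0 \<gamma> b) i * eps Y i) - (\<Sum>i<n. (dif N (ext0 \<gamma> b) i)\<^sup>2) / 2"
      using 1 \<tau> Y by simp
    then show ?thesis using sb by (simp add: LR_def)
  qed
  define G where "G = (\<lambda>\<beta>. lik X n Y (relu_net L (width p L N) \<beta>))"
  define l0 where "l0 = lik X n Y f0"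
  have int: "l0 * ennreal (exp (- 2 * \<tau> - 2)) * ennreal ((c * d) ^ s)
     \<le> (\<integral>\<^sup>+b. bnd p F L w (ext0 \<gamma> b) * G (ext0 \<gamma> b) \<partial>slab_measure L w \<gamma>)"
  proof -
    have "l0 * ennreal (exp (- 2 * \<tau> - 2)) * ennreal ((c * d) ^ s)
       \<le> l0 * ennreal (exp (- 2 * \<tau> - 2)) * emeasure (slab_measure L w \<gamma>) (slab_box L w \<gamma> \<beta> d)"
      by (intro mult_left_mono box) simp
    also have "\<dots> = (\<integral>\<^sup>+b. l0 * ennreal (exp (- 2 * \<tau> - 2)) * indicator (slab_box L w \<gamma> \<beta> d) b \<partial>slab_measure L w \<gamma>)"
      using sets_slab_box conn_setsD(1)[OF \<gamma>] by (simp add: nn_integral_cmult_indicator)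
    also have "\<dots> \<le> (\<integral>\<^sup>+b. bnd p F L w (ext0 \<gamma> b) * G (ext0 \<gamma> b) \<partial>slab_measure L w \<gamma>)"
    proof (intro nn_integral_mono)
      fix b
      show "l0 * ennreal (exp (- 2 * \<tau> - 2)) * indicator (slab_box L w \<gamma> \<beta> d) b
         \<le> bnd p F L w (ext0 \<gamma> b) * G (ext0 \<gamma> b)"
      proof (cases "b \<in> slab_box L w \<gamma> \<beta> d")
        case True
        then show ?thesis using good[OF True] unfolding G_def lik_eq l0_def
          by (auto intro!: mult_left_mono ennreal_leI)
      qed simp
    qed
    finally show ?thesis .
  qed
  define T where "T = real ((L + 1) * (sn * (sn + 1)))"
  have sn1: "1 \<le> sn" using N p N2 by (metis One_nat_def Suc_leI le_trans mult_pos_pos not_numeral_le_zero zero_less_iff_neq_zero le_zero_eq not_one_le_zero)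
  have T0: "0 < T" using sn1 unfolding T_def by (simp only: of_nat_0_less_iff) simp
  have ne: "conn_sets L w s \<noteq> {}" using \<gamma> by auto
  have cT: "real (card (conn_sets L w s)) \<le> T ^ s"
  proof -
    have "card (conn_sets L w s) \<le> card (par_idx L w) ^ s" by (rule card_conn_sets_le)
    also have "\<dots> \<le> ((L + 1) * (sn * (sn + 1))) ^ s"
      unfolding w_def by (intro power_mono card_par_idx_le width_le N N2) simp
    finally show ?thesis unfolding T_def by (metis of_nat_le_iff of_nat_power)
  qed
  have c0: "0 < real (card (conn_sets L w s))" using ne finite_conn_sets by (simp add: card_gt_0_iff)
  have "ss_int L w s (\<lambda>\<beta>. bnd p F L w \<beta> * G \<beta>)
     = (\<Sum>\<gamma>\<in>conn_sets L w s. \<integral>\<^sup>+b. bnd p F L w (ext0 \<gamma> b) * G (ext0 \<gamma> b) \<partial>slab_measure L w \<gamma>)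
       / ennreal (real (card (conn_sets L w s)))"
    using ne by (simp add: ss_int_def ennreal_of_nat_eq_real_of_nat)
  also have "\<dots> \<ge> l0 * ennreal (exp (- 2 * \<tau> - 2)) * ennreal ((c * d) ^ s) / ennreal (real (card (conn_sets L w s)))"
    by (intro divide_right_mono_ennreal order_trans[OF int] member_le_sum \<gamma> finite_conn_sets) simp
  also have "l0 * ennreal (exp (- 2 * \<tau> - 2)) * ennreal ((c * d) ^ s) / ennreal (real (card (conn_sets L w s)))
      = l0 * ennreal (exp (- 2 * \<tau> - 2) * (c * d) ^ s / real (card (conn_sets L w s)))"
    using c0 std_normal_min_pos[of "K + 1"] d
    by (simp add: mult.assoc ennreal_mult'[symmetric] ennreal_times_divide[symmetric] divide_ennreal c_def)
  finally have "l0 * ennreal (exp (- 2 * \<tau> - 2) * (c * d) ^ s / real (card (conn_sets L w s)))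
     \<le> ss_int L w s (\<lambda>\<beta>. bnd p F L w \<beta> * G \<beta>)" .
  moreover have "exp (- 2 * \<tau> - 2) * (c * d) ^ s / T ^ s
      \<le> exp (- 2 * \<tau> - 2) * (c * d) ^ s / real (card (conn_sets L w s))"
    using cT c0 T0 std_normal_min_pos[of "K + 1"] d by (intro divide_left_mono mult_nonneg_nonneg) (auto simp: c_def)
  ultimately have "l0 * ennreal (exp (- 2 * \<tau> - 2) * (c * d) ^ s / T ^ s)
     \<le> ss_int L w s (\<lambda>\<beta>. bnd p F L w \<beta> * G \<beta>)"
    by (meson ennreal_leI mult_left_mono order_trans zero_le)
  also have "\<dots> \<le> cond_prior_int p L F w s G" by (rule cond_prior_int_ge)
  finally have "ennreal (pi_N lam N * exp (- lams * real s)) * (l0 * ennreal (exp (- 2 * \<tau> - 2) * (c * d) ^ s / T ^ s))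
     \<le> ennreal (pi_N lam N * exp (- lams * real s)) * cond_prior_int p L F w s G"
    by (intro mult_left_mono) auto
  also have "\<dots> \<le> prior_int p L F lam lams (\<lambda>N \<beta>. lik X n Y (relu_net L (width p L N) \<beta>))"
    unfolding prior_int_eq w_def G_def by (rule prior_int_s_ge[OF N])
  also have "ennreal (pi_N lam N * exp (- lams * real s)) * (l0 * ennreal (exp (- 2 * \<tau> - 2) * (c * d) ^ s / T ^ s))
     = l0 * ennreal (evidence N s K \<tau>)"
    using pi_N_nonneg[OF lam(1), of N]
    by (simp add: mult.left_commute[of _ l0] ennreal_mult'[symmetric] evidence_def c_def d_def T_def mult.assoc)
  finally show ?thesis by (simp add: l0_def)
qed

end

lemma prior_const_nonneg: "0 < lam \<Longrightarrow> 0 < lams \<Longrightarrow> 0 \<le> prior_const lam lams"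
  unfolding prior_const_def
  by (intro mult_nonneg_nonneg suminf_nonneg summable_pi_N pi_N_nonneg summable_exp_linear) auto

context regression
begin

section \<open>Prior mass outside the sieve\<close>

definition outside :: "nat \<Rightarrow> param \<Rightarrow> bool" where
  "outside s \<beta> \<longleftrightarrow> sn < s \<or> (\<exists>q. real n ^ 2 < \<bar>\<beta> q\<bar>)"

definition out_ind :: "nat \<Rightarrow> param \<Rightarrow> ennreal" where
  "out_ind s \<beta> = (if outside s \<beta> then 1 else 0)"

text \<open>Conditioning on the bound F can inflate probabilities by the inverse of the normalizer.
  This crude lower bound for it may be exponentially small in \<open>sn\<close>, but the Gaussian
  tail beyond n^2 is far smaller; this is why the cutoff for the top weights is as large as
  n^2.\<close>

definition norm_lb :: real where
  "norm_lb = (min (1 / 2) (std_normal_density (0 + 1)) * min 1 (F / real Lip)) ^ sn"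

definition tail_mass :: real where
  "tail_mass = exp (- (lams / 2) * real sn) + real sn * (2 * exp (1 / 2 - real n ^ 2)) / norm_lb"

lemma norm_lb_pos: "0 < norm_lb"
  unfolding norm_lb_def using std_normal_min_pos[of "0 + 1"] F Lip1 by (intro zero_less_power mult_pos_pos) auto

lemma tail_mass_nonneg: "0 \<le> tail_mass"
  unfolding tail_mass_def using norm_lb_pos by simp

text \<open>The zero network satisfies the bound, and with it every network whose parameters lie
  within F / Lip of zero.\<close>

lemma normalizer_lower_bound:
  assumes N: "1 \<le> N" and s: "s \<le> sn" and ne: "conn_sets L (width p L N) s \<noteq> {}"
  shows "ennreal norm_lb \<le> ss_int L (width p L N) s (bnd p F L (width p L N))"
proof -
  define w where "w = width p L N"
  define d where "d = min 1 (F / real Lip)"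
  define c where "c = min (1 / 2) (std_normal_density (0 + 1))"
  have d: "0 < d" "d \<le> 1" using F Lip1 by (auto simp: d_def)
  have c: "0 < c" "c \<le> 1" using std_normal_min_pos[of "0 + 1"] by (auto simp: c_def)
  have "ennreal norm_lb \<le> (\<integral>\<^sup>+b. bnd p F L w (ext0 \<gamma> b) \<partial>slab_measure L w \<gamma>)" if \<gamma>: "\<gamma> \<in> conn_sets L w s" for \<gamma>
  proof -
    have N2: "12 * p * N \<le> sn" using width_sparsity[OF \<gamma>[unfolded w_def]] s by simp
    have fin: "finite \<gamma>" "card \<gamma> = s" using conn_setsD[OF \<gamma>] by auto
    have "norm_lb \<le> (c * d) ^ s"
      unfolding norm_lb_def c_def[symmetric] d_def[symmetric] using c d s
      by (intro power_decreasing mult_le_one) auto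
    then have "ennreal norm_lb \<le> ennreal ((c * d) ^ s)" by (rule ennreal_leI)
    also have "\<dots> \<le> emeasure (slab_measure L w \<gamma>) (slab_box L w \<gamma> (\<lambda>_. 0) d)"
      using emeasure_slab_box[of \<gamma> "\<lambda>_. 0" 0 d L w] fin d by (simp add: c_def)
    also have "\<dots> = (\<integral>\<^sup>+b. indicator (slab_box L w \<gamma> (\<lambda>_. 0) d) b \<partial>slab_measure L w \<gamma>)"
      using sets_slab_box[OF fin(1)] by simp
    also have "\<dots> \<le> (\<integral>\<^sup>+b. bnd p F L w (ext0 \<gamma> b) \<partial>slab_measure L w \<gamma>)"
    proof (intro nn_integral_mono)
      fix b
      have "sup_bounded p F (relu_net L w (ext0 \<gamma> b))" if b: "b \<in> slab_box L w \<gamma> (\<lambda>_. 0) d"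
      proof -
        have near: "\<bar>ext0 \<gamma> b q - 0\<bar> \<le> d" for q
          using slab_box_ext0[OF b, of q] d by simp
        have b1: "\<bar>ext0 \<gamma> b q\<bar> \<le> 1" for q using near[of q] d by simp
        have "\<bar>relu_net L w (ext0 \<gamma> b) x - relu_net L w (\<lambda>_. 0) x\<bar> \<le> F" if x: "x \<in> cube p" for x
        proof -
          have "\<bar>relu_net L w (ext0 \<gamma> b) x - relu_net L w (\<lambda>_. 0) x\<bar>
             \<le> d * (2 * (real L + 1) * (1 * (real sn + 1)) ^ Suc L)"
            unfolding w_def
            by (rule relu_net_diff[OF _ b1 _ near width_le[OF N N2] x]) auto
          also have "\<dots> \<le> d * real Lip"
          proof (rule mult_left_mono)
            have "2 * (real L + 1) * (1 * (real sn + 1)) ^ Suc L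
               \<le> 2 * (real L + 1) * ((real n ^ 2 + 1) * (real sn + 1)) ^ Suc L"
              by (intro mult_left_mono power_mono mult_right_mono) auto
            also have "\<dots> = real Lip"
              by (simp only: Lip_def of_nat_mult of_nat_power of_nat_add of_nat_1 of_nat_numeral)
            finally show "2 * (real L + 1) * (1 * (real sn + 1)) ^ Suc L \<le> real Lip" .
          qed (use d in simp)
          also have "\<dots> \<le> F / real Lip * real Lip" by (intro mult_right_mono) (auto simp: d_def)
          also have "\<dots> = F" using Lip1 by simp
          finally show ?thesis .
        qed
        then show ?thesis by (simp add: sup_bounded_def relu_net_zero)
      qed
      then show "indicator (slab_box L w \<gamma> (\<lambda>_. 0) d) b \<le> bnd p F L w (ext0 \<gamma> b)"
        by (auto simp: indicator_def)
    qed
    finally show ?thesis .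
  qed
  then have "(\<Sum>\<gamma>\<in>conn_sets L w s. ennreal norm_lb) \<le> (\<Sum>\<gamma>\<in>conn_sets L w s. \<integral>\<^sup>+b. bnd p F L w (ext0 \<gamma> b) \<partial>slab_measure L w \<gamma>)"
    by (rule sum_mono)
  from divide_right_mono_ennreal[OF this, of "of_nat (card (conn_sets L w s))"]
  have "(\<Sum>\<gamma>\<in>conn_sets L w s. ennreal norm_lb) / of_nat (card (conn_sets L w s)) \<le> ss_int L w s (bnd p F L w)"
    using ne by (simp add: ss_int_def w_def)
  moreover have "(\<Sum>\<gamma>\<in>conn_sets L w s. ennreal norm_lb) / of_nat (card (conn_sets L w s)) = ennreal norm_lb"
    using ne finite_conn_sets[of L w s]
    by (simp add: ennreal_mult_divide_eq mult.commute[of "of_nat _"] w_def)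
  ultimately show ?thesis by (simp add: w_def)
qed

lemma cond_prior_outside:
  assumes N: "1 \<le> N"
  shows "cond_prior_int p L F (width p L N) s (out_ind s) \<le> ennreal (tail_mass * exp (lams / 2 * real s))"
proof (cases "sn < s")
  case True
  have "cond_prior_int p L F (width p L N) s (out_ind s) \<le> cond_prior_int p L F (width p L N) s (\<lambda>_. 1)"
    by (rule cond_prior_int_mono) (simp add: out_ind_def)
  also have "\<dots> \<le> ennreal 1" using cond_prior_int_const_le by simp
  also have "\<dots> \<le> ennreal (tail_mass * exp (lams / 2 * real s))"
  proof (rule ennreal_leI)
    have "lams / 2 * real sn \<le> lams / 2 * real s" using True lam by simp
    \<comment> \<open>Beyond the cutoff the trivial bound 1 is used. Since s > sn, the allowance
      exp(lams/2 s) pays for the factor exp(-lams/2 sn).\<close>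
    then have "1 \<le> exp (- (lams / 2) * real sn) * exp (lams / 2 * real s)"
      by (simp add: exp_add[symmetric])
    also have "\<dots> \<le> tail_mass * exp (lams / 2 * real s)"
      using norm_lb_pos by (intro mult_right_mono) (auto simp: tail_mass_def)
    finally show "1 \<le> tail_mass * exp (lams / 2 * real s)" .
  qed
  finally show ?thesis .
next
  case False
  define w where "w = width p L N"
  define b where "b = 2 * exp (1 / 2 - real n ^ 2)"
  show ?thesis
  proof (cases "conn_sets L w s = {}")
    case True
    then show ?thesis by (simp add: cond_prior_int_def ss_int_def w_def)
  next
    case ne: False
    have "ss_int L w s (\<lambda>\<beta>. bnd p F L w \<beta> * out_ind s \<beta>) \<le> ss_int L w s (out_ind s)"
      by (rule ss_int_mono) auto
    also have "\<dots> = (\<Sum>\<gamma>\<in>conn_sets L w s. \<integral>\<^sup>+\<beta>. out_ind s (ext0 \<gamma> \<beta>) \<partial>slab_measure L w \<gamma>) / of_nat (card (conn_sets L w s))"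
      using ne by (simp add: ss_int_def)
    also have "\<dots> \<le> (\<Sum>\<gamma>\<in>conn_sets L w s. ennreal (real sn * b)) / of_nat (card (conn_sets L w s))"
    proof (intro divide_right_mono_ennreal sum_mono)
      fix \<gamma> assume \<gamma>: "\<gamma> \<in> conn_sets L w s"
      let ?S = "slab_measure L w \<gamma>"
      let ?T = "{\<beta> \<in> space ?S. \<exists>q. real n ^ 2 < \<bar>ext0 \<gamma> \<beta> q\<bar>}"
      have T: "?T \<in> sets ?S"
      proof -
        have "?T = (\<Union>q. {\<beta> \<in> space ?S. real n ^ 2 < \<bar>ext0 \<gamma> \<beta> q\<bar>})" by auto
        moreover have "(\<lambda>\<beta>. ext0 \<gamma> \<beta> q) \<in> borel_measurable ?S" for q
          by (cases "q \<in> \<gamma>") (simp_all add: ext0_def measurable_slab_component)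
        then have "{\<beta> \<in> space ?S. real n ^ 2 < \<bar>ext0 \<gamma> \<beta> q\<bar>} \<in> sets ?S" for q by measurable
        ultimately show ?thesis by (simp add: sets.countable_UN)
      qed
      have "(\<integral>\<^sup>+\<beta>. out_ind s (ext0 \<gamma> \<beta>) \<partial>?S) = (\<integral>\<^sup>+\<beta>. indicator ?T \<beta> \<partial>?S)"
        using False by (intro nn_integral_cong) (auto simp: out_ind_def outside_def indicator_def)
      also have "\<dots> = emeasure ?S ?T" using T by simp
      also have "\<dots> \<le> ennreal (real (card \<gamma>) * (2 * exp (1 / 2 - real n ^ 2)))"
        by (rule slab_tail) (use conn_setsD(1)[OF \<gamma>] n in auto)
      also have "\<dots> \<le> ennreal (real sn * b)"
        using conn_setsD(4)[OF \<gamma>] False unfolding b_def by (intro ennreal_leI mult_right_mono) auto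
      finally show "(\<integral>\<^sup>+\<beta>. out_ind s (ext0 \<gamma> \<beta>) \<partial>?S) \<le> ennreal (real sn * b)" .
    qed
    also have "\<dots> = ennreal (real sn * b)"
      using ne finite_conn_sets[of L w s] by (simp add: ennreal_mult_divide_eq mult.commute[of "of_nat _"])
    finally have num: "ss_int L w s (\<lambda>\<beta>. bnd p F L w \<beta> * out_ind s \<beta>) \<le> ennreal (real sn * b)" .
    have Z: "ennreal norm_lb \<le> ss_int L w s (bnd p F L w)"
      unfolding w_def by (rule normalizer_lower_bound) (use N False ne in \<open>auto simp: w_def\<close>)
    have "cond_prior_int p L F w s (out_ind s) \<le> ennreal (real sn * b) / ss_int L w s (bnd p F L w)"
      unfolding cond_prior_int_def by (intro divide_right_mono_ennreal num)
    also have "\<dots> \<le> ennreal (real sn * b / norm_lb)"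
    proof (rule divide_le_posI_ennreal)
      show "0 < ss_int L w s (bnd p F L w)" using Z norm_lb_pos by (meson ennreal_less_zero_iff less_le_trans)
      have "ennreal (real sn * b) = ennreal (real sn * b / norm_lb) * ennreal norm_lb"
        using norm_lb_pos by (simp add: ennreal_mult''[symmetric] b_def)
      also have "\<dots> \<le> ennreal (real sn * b / norm_lb) * ss_int L w s (bnd p F L w)"
        using Z by (intro mult_left_mono) auto
      finally show "ennreal (real sn * b) \<le> ss_int L w s (bnd p F L w) * ennreal (real sn * b / norm_lb)"
        by (subst mult.commute)
    qed
    also have "\<dots> \<le> ennreal (tail_mass * exp (lams / 2 * real s))"
    proof (rule ennreal_leI)
      have "real sn * b / norm_lb * 1 \<le> tail_mass * exp (lams / 2 * real s)"
        using norm_lb_pos lam by (intro mult_mono) (auto simp: tail_mass_def b_def)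
      then show "real sn * b / norm_lb \<le> tail_mass * exp (lams / 2 * real s)" by simp
    qed
    finally show ?thesis by (simp add: w_def)
  qed
qed

lemma sets_outside: "{\<beta>. outside s \<beta>} \<in> sets borel"
proof -
  have "open {\<beta> :: param. real n ^ 2 < \<bar>\<beta> q\<bar>}" for q
    by (intro open_Collect_less continuous_intros continuous_on_product_coordinates)
  then have "open (\<Union>q. {\<beta> :: param. real n ^ 2 < \<bar>\<beta> q\<bar>})" by blast
  moreover have "{\<beta>. outside s \<beta>} = (if sn < s then UNIV else (\<Union>q. {\<beta>. real n ^ 2 < \<bar>\<beta> q\<bar>}))"
    by (auto simp: outside_def)
  ultimately show ?thesis by auto
qed

lemma measurable_out_ind: "out_ind s \<in> borel_measurable borel"
proof -
  have "(\<lambda>\<beta>. indicator {\<beta>. outside s \<beta>} \<beta> :: ennreal) \<in> borel_measurable borel"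
    by (rule borel_measurable_indicator[OF sets_outside])
  also have "(\<lambda>\<beta>. indicator {\<beta>. outside s \<beta>} \<beta> :: ennreal) = out_ind s"
    by (auto simp: fun_eq_iff out_ind_def)
  finally show ?thesis .
qed

abbreviation P :: "(nat \<Rightarrow> real) measure" where "P \<equiv> data_law X f0 n"

lemma prob_space_P: "prob_space P" unfolding data_law_eq by (rule prob_space_gauss)

lemma measurable_LR: "(\<lambda>(Y, \<beta>). ennreal (LR Y N \<beta>)) \<in> borel_measurable (P \<Otimes>\<^sub>M borel)"
proof -
  have 1: "(\<lambda>z. eps (fst z) i) \<in> borel_measurable (P \<Otimes>\<^sub>M (borel :: param measure))" if "i < n" for i
    unfolding eps_def data_law_eq
    by (intro borel_measurable_diff measurable_compose[OF measurable_fst measurable_gauss_component] that borel_measurable_const)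
  have 2: "(\<lambda>z. dif N (snd z) i) \<in> borel_measurable (P \<Otimes>\<^sub>M borel)" for i
    unfolding dif_def
    by (intro borel_measurable_diff measurable_compose[OF measurable_snd measurable_relu_net] borel_measurable_const)
  have "(\<lambda>z. LR (fst z) N (snd z)) \<in> borel_measurable (P \<Otimes>\<^sub>M borel)"
    unfolding LR_def
    by (intro measurable_compose[OF _ borel_measurable_exp] borel_measurable_diff borel_measurable_sum
       borel_measurable_times borel_measurable_divide borel_measurable_power borel_measurable_const 1 2) auto
  then show ?thesis by (simp add: case_prod_unfold)
qed

lemma nn_integral_LR: "(\<integral>\<^sup>+Y. ennreal (LR Y N \<beta>) \<partial>P) = 1"
proof -
  define S where "S = (\<Sum>i<n. (dif N \<beta> i)\<^sup>2) / 2"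
  have m: "(\<lambda>Y. \<Sum>i<n. dif N \<beta> i * (Y i - f0 (X n i))) \<in> borel_measurable (gauss (\<lambda>i. f0 (X n i)) n)"
    by (intro borel_measurable_sum borel_measurable_times borel_measurable_diff measurable_gauss_component borel_measurable_const) auto
  have "(\<integral>\<^sup>+Y. ennreal (LR Y N \<beta>) \<partial>P)
     = (\<integral>\<^sup>+Y. ennreal (exp (- S)) * ennreal (exp (\<Sum>i<n. dif N \<beta> i * (Y i - f0 (X n i)))) \<partial>gauss (\<lambda>i. f0 (X n i)) n)"
    unfolding data_law_eq
    by (simp add: LR_def eps_def S_def ennreal_mult'[symmetric] exp_add[symmetric])
  also have "\<dots> = ennreal (exp (- S)) * ennreal (exp ((\<Sum>i<n. (dif N \<beta> i)\<^sup>2) / 2))"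
    by (subst nn_integral_cmult) (use m in \<open>auto simp: gauss_mgf\<close>)
  also have "\<dots> = 1" by (simp add: S_def ennreal_mult'[symmetric] exp_add[symmetric])
  finally show ?thesis .
qed

definition out_evidence :: "(nat \<Rightarrow> real) \<Rightarrow> ennreal" where
  "out_evidence Y = prior_int_s p L F lam lams (\<lambda>N s \<beta>. out_ind s \<beta> * ennreal (LR Y N \<beta>))"

lemma measurable_out_LR: "(\<lambda>(Y, \<beta>). out_ind s \<beta> * ennreal (LR Y N \<beta>)) \<in> borel_measurable (P \<Otimes>\<^sub>M borel)"
proof -
  have "(\<lambda>z. out_ind s (snd z) * (\<lambda>(Y, \<beta>). ennreal (LR Y N \<beta>)) z) \<in> borel_measurable (P \<Otimes>\<^sub>M borel)"
    by (intro borel_measurable_times_ennreal measurable_LR measurable_compose[OF measurable_snd measurable_out_ind])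
  then show ?thesis by (simp add: case_prod_unfold)
qed

lemma measurable_out_evidence: "out_evidence \<in> borel_measurable P"
  unfolding out_evidence_def[abs_def] by (rule measurable_prior_int_s) (rule measurable_out_LR)

text \<open>By Tonelli the expectation moves inside the prior, where each likelihood ratio
  integrates to 1. What remains is the prior mass outside the sieve.\<close>

lemma expected_out_evidence: "(\<integral>\<^sup>+Y. out_evidence Y \<partial>P) \<le> ennreal (prior_const lam lams * tail_mass)"
proof -
  interpret prob_space P by (rule prob_space_P)
  have LRm: "(\<lambda>Y. ennreal (LR Y N \<beta>)) \<in> borel_measurable P" for N \<beta>
    using measurable_compose[OF measurable_Pair2'[of \<beta> borel P] measurable_LR[of N]] by simp
  have "(\<integral>\<^sup>+Y. out_evidence Y \<partial>P)
     = prior_int_s p L F lam lams (\<lambda>N s \<beta>. \<integral>\<^sup>+Y. out_ind s \<beta> * ennreal (LR Y N \<beta>) \<partial>P)"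
    unfolding out_evidence_def
    by (rule nn_integral_prior_int_s[OF sigma_finite_measure_axioms]) (rule measurable_out_LR)
  also have "\<dots> = prior_int_s p L F lam lams (\<lambda>N s. out_ind s)"
    by (simp add: nn_integral_cmult LRm nn_integral_LR)
  also have "\<dots> \<le> ennreal (prior_const lam lams * tail_mass)"
    by (rule prior_int_s_le[OF lam tail_mass_nonneg cond_prior_outside])
  finally show ?thesis .
qed

section \<open>The exceptional events and their probabilities\<close>

definition bad1 :: "real \<Rightarrow> (nat \<Rightarrow> real) set" where
  "bad1 En = (\<Union>N\<in>{N. 1 \<le> N \<and> 12 * p * N \<le> sn}. \<Union>\<beta>\<in>centers N.
     {Y \<in> space P. (\<Sum>i<n. (dif N \<beta> i)\<^sup>2) / 8 + En / 2 \<le> (\<Sum>i<n. dif N \<beta> i / 2 * eps Y i)})"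

text \<open>A single noise variable is written as a weighted sum, so that the bound for linear forms
  covers it.\<close>

definition bad2 :: "(nat \<Rightarrow> real) set" where
  "bad2 = (\<Union>k<n. \<Union>c\<in>{1, -1}. {Y \<in> space P. real n \<le> (\<Sum>i<n. (if i = k then c else 0) * eps Y i)})"

definition bad3 :: "nat \<Rightarrow> param \<Rightarrow> real \<Rightarrow> (nat \<Rightarrow> real) set" where
  "bad3 N \<beta> \<tau> = {Y \<in> space P. \<tau> \<le> (\<Sum>i<n. - dif N \<beta> i * eps Y i)}"

definition bad4 :: "real \<Rightarrow> (nat \<Rightarrow> real) set" where
  "bad4 thr = {Y \<in> space P. ennreal thr \<le> out_evidence Y}"

lemma chernoff_P:
  "{Y \<in> space P. b \<le> (\<Sum>i<n. g i * eps Y i)} \<in> sets P"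
  "measure P {Y \<in> space P. b \<le> (\<Sum>i<n. g i * eps Y i)} \<le> exp ((\<Sum>i<n. (g i)\<^sup>2) / 2 - b)"
  unfolding data_law_eq eps_def by (rule sets_gauss_sum, rule gauss_chernoff)

lemma measure_UN_le:
  assumes "finite I" "\<And>i. i \<in> I \<Longrightarrow> S i \<in> sets P" "\<And>i. i \<in> I \<Longrightarrow> measure P (S i) \<le> b"
  shows "(\<Union>i\<in>I. S i) \<in> sets P" "measure P (\<Union>i\<in>I. S i) \<le> real (card I) * b"
proof -
  interpret prob_space P by (rule prob_space_P)
  show "(\<Union>i\<in>I. S i) \<in> sets P" using assms by auto
  have "measure P (\<Union>i\<in>I. S i) \<le> (\<Sum>i\<in>I. measure P (S i))"
    using assms by (intro finite_measure_subadditive_finite) auto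
  also have "\<dots> \<le> real (card I) * b" using assms by (intro sum_bounded_above) auto
  finally show "measure P (\<Union>i\<in>I. S i) \<le> real (card I) * b" .
qed

text \<open>Chernoff's bound is applied to half the cross term: its variance term is one eighth of
  the sum of squares and cancels the one in the event. Each center then costs exp(-En/2), however
  far it is from f0.\<close>

lemma bad1: "bad1 En \<in> sets P" "measure P (bad1 En) \<le> real sn * (real n_centers * exp (- En / 2))"
proof -
  let ?I = "{N. 1 \<le> N \<and> 12 * p * N \<le> sn}"
  let ?E = "\<lambda>N \<beta>. {Y \<in> space P. (\<Sum>i<n. (dif N \<beta> i)\<^sup>2) / 8 + En / 2 \<le> (\<Sum>i<n. dif N \<beta> i / 2 * eps Y i)}"
  have sub: "?I \<subseteq> {1..sn}"
  proof
    fix N assume "N \<in> ?I"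
    moreover have "N \<le> 12 * p * N" using mult_le_mono1[of 1 "12 * p" N] p by simp
    ultimately show "N \<in> {1..sn}" using order_trans[of N "12 * p * N" sn] by auto
  qed
  then have fin: "finite ?I" by (rule finite_subset) simp
  have cI: "card ?I \<le> sn" using card_mono[OF _ sub] by simp
  have m: "measure P (?E N \<beta>) \<le> exp (- En / 2)" for N \<beta>
  proof -
    have "measure P (?E N \<beta>) \<le> exp ((\<Sum>i<n. (dif N \<beta> i / 2)\<^sup>2) / 2 - ((\<Sum>i<n. (dif N \<beta> i)\<^sup>2) / 8 + En / 2))"
      by (rule chernoff_P(2))
    also have "(\<Sum>i<n. (dif N \<beta> i / 2)\<^sup>2) = (\<Sum>i<n. (dif N \<beta> i)\<^sup>2) / 4"
      by (simp add: power_divide sum_divide_distrib)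
    finally show ?thesis by simp
  qed
  have c: "(\<Union>\<beta>\<in>centers N. ?E N \<beta>) \<in> sets P" "measure P (\<Union>\<beta>\<in>centers N. ?E N \<beta>) \<le> real n_centers * exp (- En / 2)"
    if "N \<in> ?I" for N
  proof -
    note u = measure_UN_le[OF centers_finite[of N] chernoff_P(1) m]
    show "(\<Union>\<beta>\<in>centers N. ?E N \<beta>) \<in> sets P" by (rule u(1))
    have "real (card (centers N)) * exp (- En / 2) \<le> real n_centers * exp (- En / 2)"
      using card_centers that by (intro mult_right_mono) auto
    then show "measure P (\<Union>\<beta>\<in>centers N. ?E N \<beta>) \<le> real n_centers * exp (- En / 2)"
      using u(2) by (rule order_trans[rotated])
  qed
  note u = measure_UN_le[OF fin c]
  show "bad1 En \<in> sets P" unfolding bad1_def by (rule u(1))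
  have "measure P (bad1 En) \<le> real (card ?I) * (real n_centers * exp (- En / 2))"
    unfolding bad1_def by (rule u(2))
  also have "\<dots> \<le> real sn * (real n_centers * exp (- En / 2))" using cI by (intro mult_right_mono) auto
  finally show "measure P (bad1 En) \<le> real sn * (real n_centers * exp (- En / 2))" .
qed

lemma bad2: "bad2 \<in> sets P" "measure P bad2 \<le> real n * (2 * exp (1 / 2 - real n))"
proof -
  let ?E = "\<lambda>k c. {Y \<in> space P. real n \<le> (\<Sum>i<n. (if i = k then c else 0) * eps Y i)}"
  have m: "measure P (?E k c) \<le> exp (1 / 2 - real n)" if "c \<in> {1, -1}" for k and c :: real
  proof -
    have "(\<Sum>i<n. (if i = k then c else 0)\<^sup>2) = (\<Sum>i<n. if i = k then c\<^sup>2 else 0)"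
      by (intro sum.cong) auto
    also have "\<dots> \<le> 1" using that by (auto simp: sum.delta)
    finally have "exp ((\<Sum>i<n. (if i = k then c else 0)\<^sup>2) / 2 - real n) \<le> exp (1 / 2 - real n)" by simp
    then show ?thesis using chernoff_P(2)[where b = "real n" and g = "\<lambda>i. if i = k then c else 0"]
      by (rule order_trans[rotated])
  qed
  have c2: "real (card {1, -1 :: real}) = 2" by simp
  have u1: "(\<Union>c\<in>{1, -1}. ?E k c) \<in> sets P" for k
    by (rule measure_UN_le(1)) (simp, rule chernoff_P(1), rule m)
  have u2: "measure P (\<Union>c\<in>{1, -1}. ?E k c) \<le> real (card {1, -1 :: real}) * exp (1 / 2 - real n)" for k
    by (rule measure_UN_le(2)) (simp, rule chernoff_P(1), rule m)
  show "bad2 \<in> sets P" unfolding bad2_def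
    by (rule measure_UN_le(1)) (simp, rule u1, rule u2)
  have "measure P bad2 \<le> real (card {..<n}) * (real (card {1, -1 :: real}) * exp (1 / 2 - real n))" unfolding bad2_def
    by (rule measure_UN_le(2)) (simp, rule u1, rule u2)
  then show "measure P bad2 \<le> real n * (2 * exp (1 / 2 - real n))" unfolding c2 by simp
qed

lemma bad3:
  assumes "(\<Sum>i<n. (dif N \<beta> i)\<^sup>2) \<le> \<tau>"
  shows "bad3 N \<beta> \<tau> \<in> sets P" "measure P (bad3 N \<beta> \<tau>) \<le> exp (- \<tau> / 2)"
proof -
  show "bad3 N \<beta> \<tau> \<in> sets P" unfolding bad3_def by (rule chernoff_P(1))
  have "measure P (bad3 N \<beta> \<tau>) \<le> exp ((\<Sum>i<n. (- dif N \<beta> i)\<^sup>2) / 2 - \<tau>)"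
    unfolding bad3_def by (rule chernoff_P(2))
  also have "\<dots> \<le> exp (- \<tau> / 2)" using assms by simp
  finally show "measure P (bad3 N \<beta> \<tau>) \<le> exp (- \<tau> / 2)" .
qed

lemma bad4:
  assumes "0 < thr"
  shows "bad4 thr \<in> sets P" "measure P (bad4 thr) \<le> prior_const lam lams * tail_mass / thr"
proof -
  interpret prob_space P by (rule prob_space_P)
  show S: "bad4 thr \<in> sets P" unfolding bad4_def using measurable_out_evidence by measurable
  have "ennreal thr * emeasure P (bad4 thr) = (\<integral>\<^sup>+Y. ennreal thr * indicator (bad4 thr) Y \<partial>P)"
    using S by (simp add: nn_integral_cmult_indicator)
  also have "\<dots> \<le> (\<integral>\<^sup>+Y. out_evidence Y \<partial>P)"
    by (intro nn_integral_mono) (auto simp: indicator_def bad4_def)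
  also have "\<dots> \<le> ennreal (prior_const lam lams * tail_mass)" by (rule expected_out_evidence)
  finally have "ennreal (thr * measure P (bad4 thr)) \<le> ennreal (prior_const lam lams * tail_mass)"
    using assms by (simp add: emeasure_eq_measure ennreal_mult')
  moreover have "0 \<le> prior_const lam lams * tail_mass"
    using tail_mass_nonneg prior_const_nonneg[OF lam] by simp
  ultimately have "thr * measure P (bad4 thr) \<le> prior_const lam lams * tail_mass"
    by (subst (asm) ennreal_le_iff) auto
  then show "measure P (bad4 thr) \<le> prior_const lam lams * tail_mass / thr"
    using assms by (simp add: pos_le_divide_eq mult.commute)
qed

lemma eps_bound:
  assumes Y: "Y \<in> space P" "Y \<notin> bad2" and k: "k < n"
  shows "\<bar>eps Y k\<bar> \<le> real n"
proof -
  have "\<not> real n \<le> (\<Sum>i<n. (if i = k then c else 0) * eps Y i)" if "c \<in> {1, -1}" for c :: real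
    using Y that k unfolding bad2_def by blast
  moreover have "(\<Sum>i<n. (if i = k then c else 0) * eps Y i) = c * eps Y k" for c :: real
    using k by (simp add: if_distrib[of "\<lambda>z. z * _"] sum.delta cong: if_cong)
  ultimately have "\<not> real n \<le> 1 * eps Y k" "\<not> real n \<le> - 1 * eps Y k" by (metis insertCI)+
  then show ?thesis by linarith
qed

text \<open>The integrand is at most a constant K plus the likelihood ratio restricted to the
  outside of the sieve. Integrating this sum treats both regions at once: K costs the total prior
  weight, and the rest is the evidence off the sieve, small outside \<open>bad4\<close>.\<close>

lemma posterior_numerator:
  assumes Y: "Y \<in> space P" "Y \<notin> bad1 En" "Y \<notin> bad2" "Y \<notin> bad4 thr"
    and E: "\<And>f. f \<in> E \<Longrightarrow> t \<le> (\<Sum>i<n. (f (X n i) - f0 (X n i))\<^sup>2)" and thr: "0 \<le> thr"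
  shows "prior_int p L F lam lams (\<lambda>N \<beta>. indicator E (relu_net L (width p L N) \<beta>) *
       lik X n Y (relu_net L (width p L N) \<beta>))
     \<le> lik X n Y f0 * ennreal (prior_const lam lams * exp (- t / 8 + En + 2) + thr)"
proof -
  define l0 where "l0 = lik X n Y f0"
  define K where "K = exp (- t / 8 + En + 2)"
  have eps: "\<bar>eps Y k\<bar> \<le> real n" if k: "k < n" for k using eps_bound Y(1,3) k by simp
  have "prior_int p L F lam lams (\<lambda>N \<beta>. indicator E (relu_net L (width p L N) \<beta>) * lik X n Y (relu_net L (width p L N) \<beta>))
     \<le> prior_int_s p L F lam lams (\<lambda>N s \<beta>. l0 * (ennreal K + out_ind s \<beta> * ennreal (LR Y N \<beta>)))"
    unfolding prior_int_eq
  proof (intro prior_int_s_mono cond_prior_int_mono)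
    fix N s \<gamma> b assume N: "1 \<le> N" and \<gamma>: "\<gamma> \<in> conn_sets L (width p L N) s"
    define \<beta> where "\<beta> = ext0 \<gamma> b"
    have "indicator E (relu_net L (width p L N) \<beta>) * ennreal (LR Y N \<beta>) \<le> ennreal K + out_ind s \<beta> * ennreal (LR Y N \<beta>)"
    proof (cases "outside s \<beta> \<or> relu_net L (width p L N) \<beta> \<notin> E")
      case True
      then show ?thesis by (auto simp: out_ind_def indicator_def intro: add_increasing)
    next
      case False
      then have s: "s \<le> sn" and \<beta>: "\<And>q. \<bar>\<beta> q\<bar> \<le> real n ^ 2" and fE: "relu_net L (width p L N) \<beta> \<in> E"
        by (auto simp: outside_def not_less)
      have N2: "12 * p * N \<le> sn" using width_sparsity[OF \<gamma>] s by simp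
      have "LR Y N \<beta> \<le> K" unfolding K_def
      proof (rule LR_sieve[OF \<gamma> s N \<beta>])
        fix \<beta>' assume "\<beta>' \<in> centers N"
        then have "\<not> (\<Sum>i<n. (dif N \<beta>' i)\<^sup>2) / 8 + En / 2 \<le> (\<Sum>i<n. dif N \<beta>' i / 2 * eps Y i)"
          using Y(1,2) N N2 unfolding bad1_def by blast
        moreover have "(\<Sum>i<n. dif N \<beta>' i / 2 * eps Y i) = (\<Sum>i<n. dif N \<beta>' i * eps Y i) / 2"
          by (simp add: sum_divide_distrib)
        ultimately show "(\<Sum>i<n. dif N \<beta>' i * eps Y i) \<le> (\<Sum>i<n. (dif N \<beta>' i)\<^sup>2) / 4 + En" by simp
      next
        show "t \<le> (\<Sum>i<n. (dif N \<beta> i)\<^sup>2)" using E[OF fE] by (simp add: dif_def)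
      qed (auto simp: eps \<beta>_def ext0_def)
      then show ?thesis using fE by (auto intro: add_increasing2 ennreal_leI)
    qed
    then have "l0 * (indicator E (relu_net L (width p L N) \<beta>) * ennreal (LR Y N \<beta>))
      \<le> l0 * (ennreal K + out_ind s \<beta> * ennreal (LR Y N \<beta>))" by (rule mult_left_mono) simp
    then show "indicator E (relu_net L (width p L N) (ext0 \<gamma> b)) * lik X n Y (relu_net L (width p L N) (ext0 \<gamma> b))
      \<le> l0 * (ennreal K + out_ind s (ext0 \<gamma> b) * ennreal (LR Y N (ext0 \<gamma> b)))"
      unfolding lik_eq l0_def \<beta>_def by (simp only: mult.left_commute)
  qed
  also have "\<dots> = l0 * (prior_int_s p L F lam lams (\<lambda>N s \<beta>. ennreal K) + out_evidence Y)"
  proof -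
    have "(\<lambda>\<beta>. ennreal (LR Y N \<beta>)) \<in> borel_measurable borel" for N
      using measurable_compose[OF measurable_Pair1'[OF Y(1), of borel] measurable_LR[of N]] by simp
    then have m: "(\<lambda>\<beta>. out_ind s \<beta> * ennreal (LR Y N \<beta>)) \<in> borel_measurable borel" for N s
      by (intro borel_measurable_times_ennreal measurable_out_ind)
    have "prior_int_s p L F lam lams (\<lambda>N s \<beta>. l0 * (ennreal K + out_ind s \<beta> * ennreal (LR Y N \<beta>)))
      = l0 * prior_int_s p L F lam lams (\<lambda>N s \<beta>. ennreal K + out_ind s \<beta> * ennreal (LR Y N \<beta>))"
      by (rule prior_int_s_cmult) (intro borel_measurable_add m borel_measurable_const)
    also have "prior_int_s p L F lam lams (\<lambda>N s \<beta>. ennreal K + out_ind s \<beta> * ennreal (LR Y N \<beta>))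
     = prior_int_s p L F lam lams (\<lambda>N s \<beta>. ennreal K) + out_evidence Y"
      unfolding out_evidence_def by (rule prior_int_s_add) (simp, rule m)
    finally show ?thesis .
  qed
  also have "\<dots> \<le> l0 * (ennreal (prior_const lam lams * K) + ennreal thr)"
  proof (intro mult_left_mono add_mono)
    show "out_evidence Y \<le> ennreal thr" using Y(1,4) by (simp add: bad4_def)
    show "prior_int_s p L F lam lams (\<lambda>N s \<beta>. ennreal K) \<le> ennreal (prior_const lam lams * K)"
    proof (rule prior_int_s_le[OF lam])
      show "0 \<le> K" by (simp add: K_def)
      fix N s
      have "K * 1 \<le> K * exp (lams / 2 * real s)" using lam by (intro mult_left_mono) (auto simp: K_def)
      then show "cond_prior_int p L F (width p L N) s (\<lambda>_. ennreal K) \<le> ennreal (K * exp (lams / 2 * real s))"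
        by (intro order_trans[OF cond_prior_int_const_le] ennreal_leI) simp
    qed
  qed simp
  also have "\<dots> = l0 * ennreal (prior_const lam lams * K + thr)"
    using thr prior_const_nonneg[OF lam] by (simp add: K_def)
  finally show ?thesis by (simp add: l0_def K_def)
qed

text \<open>Outside four events the likelihood ratio is controlled pointwise, above on the sieve and below
  near the approximating network \<beta>, so that no tests are needed.\<close>
lemma posterior_bound:
  assumes N: "1 \<le> N" and supp: "\<And>q. \<beta> q \<noteq> 0 \<Longrightarrow> q \<in> par_idx L (width p L N)"
    and \<beta>1: "\<And>l j k. l \<le> L \<Longrightarrow> \<bar>\<beta> (l, j, k)\<bar> \<le> 1" and K: "\<And>q. \<bar>\<beta> q\<bar> \<le> K" "K \<le> real n ^ 2"
    and s: "s = card ({q. \<beta> q \<noteq> 0} \<union> top_idx L (width p L N))" "s \<le> sn"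
    and sup: "\<And>x. x \<in> cube p \<Longrightarrow> \<bar>relu_net L (width p L N) \<beta> x\<bar> \<le> F - 1 / real n ^ 2"
    and \<tau>: "(\<Sum>i<n. (dif N \<beta> i)\<^sup>2) \<le> \<tau>"
    and E: "\<And>f. f \<in> E \<Longrightarrow> t \<le> (\<Sum>i<n. (f (X n i) - f0 (X n i))\<^sup>2)" and thr: "0 < thr"
    and e: "0 < e" and ratio: "prior_const lam lams * exp (- t / 8 + En + 2) + thr \<le> e * evidence N s K \<tau>"
  shows "outer_prob (data_law X f0 n) {Y. ennreal e < posterior p L F lam lams X n Y E}
     \<le> real sn * (real n_centers * exp (- En / 2)) + real n * (2 * exp (1 / 2 - real n))
       + exp (- \<tau> / 2) + prior_const lam lams * tail_mass / thr"
proof -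
  interpret prob_space P by (rule prob_space_P)
  define B where "B = bad1 En \<union> bad2 \<union> bad3 N \<beta> \<tau> \<union> bad4 thr"
  have B: "B \<in> sets P" unfolding B_def using bad1 bad2 bad3(1)[OF \<tau>] bad4(1)[OF thr] by auto
  have "measure P B \<le> measure P (bad1 En) + measure P bad2 + measure P (bad3 N \<beta> \<tau>) + measure P (bad4 thr)"
    unfolding B_def
    by (intro order_trans[OF measure_Un_le] add_mono order_refl sets.Un bad1(1) bad2(1) bad3(1)[OF \<tau>] bad4(1)[OF thr])
  also have "\<dots> \<le> real sn * (real n_centers * exp (- En / 2)) + real n * (2 * exp (1 / 2 - real n))
       + exp (- \<tau> / 2) + prior_const lam lams * tail_mass / thr"
    by (intro add_mono bad1(2) bad2(2) bad3(2)[OF \<tau>] bad4(2)[OF thr])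
  finally have mB: "measure P B \<le> real sn * (real n_centers * exp (- En / 2)) + real n * (2 * exp (1 / 2 - real n))
       + exp (- \<tau> / 2) + prior_const lam lams * tail_mass / thr" .
  have sub: "{Y. ennreal e < posterior p L F lam lams X n Y E} \<inter> space P \<subseteq> B"
  proof (rule subsetI, rule ccontr)
    fix Y assume Y: "Y \<in> {Y. ennreal e < posterior p L F lam lams X n Y E} \<inter> space P" and nB: "Y \<notin> B"
    define l0 where "l0 = lik X n Y f0"
    define num where "num = prior_int p L F lam lams (\<lambda>N \<beta>. indicator E (relu_net L (width p L N) \<beta>) *
       lik X n Y (relu_net L (width p L N) \<beta>))"
    define den where "den = prior_int p L F lam lams (\<lambda>N \<beta>. lik X n Y (relu_net L (width p L N) \<beta>))"
    have "num \<le> l0 * ennreal (prior_const lam lams * exp (- t / 8 + En + 2) + thr)"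
      unfolding num_def l0_def by (rule posterior_numerator) (use Y nB E thr in \<open>auto simp: B_def\<close>)
    also have "\<dots> \<le> l0 * ennreal (e * evidence N s K \<tau>)"
      by (intro mult_left_mono ennreal_leI ratio) simp
    also have "\<dots> = ennreal e * (l0 * ennreal (evidence N s K \<tau>))"
      using e by (simp add: ennreal_mult' mult_ac)
    also have dle: "l0 * ennreal (evidence N s K \<tau>) \<le> den"
      unfolding l0_def den_def
    proof (rule evidence_lower_bound[OF N supp \<beta>1 K s sup \<tau>])
      have "\<not> \<tau> \<le> (\<Sum>i<n. - dif N \<beta> i * eps Y i)" using Y nB by (auto simp: B_def bad3_def)
      then show "- \<tau> \<le> (\<Sum>i<n. dif N \<beta> i * eps Y i)" by (simp add: sum_negf)
    qed (use Y nB eps_bound in \<open>auto simp: B_def\<close>)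
    finally have "num \<le> ennreal e * den" by (simp add: mult_left_mono)
    \<comment> \<open>Dividing needs a positive denominator. By \<open>width_sparsity\<close> s is
      positive, so sn \<ge> 1 and the lower bound for the evidence is positive.\<close>
    moreover have "0 < den"
    proof -
      have "{q. \<beta> q \<noteq> 0} \<union> top_idx L (width p L N) \<subseteq> par_idx L (width p L N)"
        using supp top_idx_subset by blast
      then have "12 * p * N < s" using s(1)
        by (intro width_sparsity[of "{q. \<beta> q \<noteq> 0} \<union> top_idx L (width p L N)"]) (simp add: conn_sets_def)
      then have "0 < evidence N s K \<tau>" using s by (intro evidence_pos) simp
      then have "0 < l0 * ennreal (evidence N s K \<tau>)" by (simp add: l0_def lik_def ennreal_zero_less_mult_iff)
      then show ?thesis using dle by (rule less_le_trans)
    qed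
    ultimately have "num / den \<le> ennreal e" by (intro divide_le_posI_ennreal) (simp_all add: mult.commute)
    then show False using Y by (simp add: posterior_def num_def den_def not_less[symmetric])
  qed
  have "outer_prob P {Y. ennreal e < posterior p L F lam lams X n Y E} \<le> measure P B"
    unfolding outer_prob_def by (rule cInf_lower) (use B sub in \<open>auto intro!: bdd_belowI[of _ 0]\<close>)
  then show ?thesis using mB by simp
qed

end

lemma outer_prob_nonneg: "0 \<le> outer_prob M A"
proof -
  have "A \<inter> space M \<subseteq> space M" "space M \<in> sets M" by auto
  then have "{measure M B |B. B \<in> sets M \<and> A \<inter> space M \<subseteq> B} \<noteq> {}" by blast
  then show ?thesis unfolding outer_prob_def by (rule cInf_greatest) auto
qed

section \<open>Rates\<close>

text \<open>M is about n^(1/q) with q = 2 \<alpha> + p, so there are V = M^p cells, of order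
  n^(p/q). The Taylor error M^(-\<alpha>) has the order of the rate; the interpolation error 1 / V =
  O(n^(-p/q)) is within it because \<alpha> < p.\<close>

lemma approx_rate:
  fixes p :: nat and \<alpha> F :: real and L :: "nat \<Rightarrow> nat"
  assumes p: "p \<ge> 1" and \<alpha>: "0 < \<alpha>" "\<alpha> < real p" and F: "F > 0"
    and hoel: "hoelder p \<alpha> f0" and f0: "\<forall>x\<in>cube p. \<bar>f0 x\<bar> \<le> F"
    and X: "\<forall>n i. i < n \<longrightarrow> X n i \<in> cube p"
    and c: "0 < c1" "0 < c2"
    and L: "\<forall>\<^sub>F n in sequentially. c1 * ln (real n) \<le> real (L n) \<and> real (L n) \<le> c2 * ln (real n)"
  shows "\<exists>C>0. \<forall>\<^sub>F n in sequentially. \<exists>N \<beta>. 1 \<le> N \<and> real N \<le> C * real n powr (real p / (2 * \<alpha> + real p)) \<and>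
     (\<forall>q. \<beta> q \<noteq> 0 \<longrightarrow> q \<in> par_idx (L n) (width p (L n) N)) \<and> (\<forall>l j k. l \<le> L n \<longrightarrow> \<bar>\<beta> (l, j, k)\<bar> \<le> 1) \<and>
     (\<forall>q. \<bar>\<beta> q\<bar> \<le> 1 + 2 * F) \<and>
     real (card {q. \<beta> q \<noteq> 0}) \<le> C * real n powr (real p / (2 * \<alpha> + real p)) \<and>
     (\<forall>x. x \<in> cube p \<longrightarrow> \<bar>relu_net (L n) (width p (L n) N) \<beta> x\<bar> \<le> F * (1 - real n powr (- \<alpha> / (2 * \<alpha> + real p)))) \<and>
     (\<forall>k<n. \<bar>relu_net (L n) (width p (L n) N) \<beta> (X n k) - f0 (X n k)\<bar> \<le> C * real n powr (- \<alpha> / (2 * \<alpha> + real p)))"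
proof -
  define q where "q = 2 * \<alpha> + real p"
  define \<kappa> where "\<kappa> = real p / q"
  have q1: "1 \<le> q"
  proof -
    have "1 \<le> real p" using p by simp
    then show ?thesis using \<alpha> unfolding q_def by linarith
  qed
  have q0: "0 < q" using \<alpha> by (simp add: q_def)
  have \<kappa>: "1 / 3 < \<kappa>" "0 < \<kappa>" "\<kappa> < 1" using \<alpha> p by (auto simp: \<kappa>_def q_def field_simps)
  obtain J :: "(nat list \<times> nat set \<times> nat) set" and u e Ch where finJ: "finite J" and Ch: "0 \<le> Ch"
    and u: "\<forall>j\<in>J. (\<forall>i<p. 0 \<le> u j i) \<and> (\<Sum>i<p. u j i) \<le> 1"
    and expand: "\<forall>a\<in>cube p. \<exists>c. (\<forall>j\<in>J. \<bar>c j\<bar> \<le> Ch) \<and>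
        (\<forall>x\<in>cube p. \<bar>f0 x - (\<Sum>j\<in>J. c j * (\<Sum>i<p. u j i * x i) ^ e j)\<bar> \<le> Ch * dist_inf p x a powr \<alpha>)"
    using hoelder_ridge_expansion[OF _ \<alpha>(1) hoel] p by auto
  define E where "E = (\<Sum>j\<in>J. e j)"
  have eE: "e j \<le> E" if "j \<in> J" for j unfolding E_def using that finJ by (intro member_le_sum) auto
  define C' where "C' = Ch / (2 * F)"
  have C'0: "0 \<le> C'" using Ch F by (simp add: C'_def)
  define B where "B = 6 * real p + real (card J) + 1"
  define CN where "CN = B * 2 ^ p"
  define CS where "CS = ((real p + 3) * B + real (card J) + 2 * real p + 60) * 2 ^ p + 1"
  define CE where "CE = F + Ch * 2 powr \<alpha> + real (card J) * (Ch * real E)"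
  have pos: "0 < CN" "0 < CS" "0 < CE" using F Ch by (auto simp: CN_def CS_def CE_def B_def add_pos_nonneg)
  define C where "C = CN + CS + CE"
  have "\<forall>\<^sub>F n in sequentially. 16 * (1 + real (card J) * C') * real n * (real n + 1) \<le> real n ^ 4"
    by real_asymp
  moreover have "\<forall>\<^sub>F n in sequentially. C' * (2 * real E + 1) \<le> real n ^ 4" by real_asymp
  moreover have "\<forall>\<^sub>F n in sequentially. 29 \<le> c1 * ln (real n)" using c by real_asymp
  moreover have "\<forall>\<^sub>F n in sequentially. 2 * (c2 * ln (real n)) \<le> real n powr \<kappa>" using c \<kappa>(2) by real_asymp
  moreover have "\<forall>\<^sub>F n in sequentially. 1 \<le> n" by (rule eventually_ge_at_top)
  ultimately have "\<forall>\<^sub>F n in sequentially. \<exists>N \<beta>. 1 \<le> N \<and> real N \<le> C * real n powr \<kappa> \<and>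
     (\<forall>q. \<beta> q \<noteq> 0 \<longrightarrow> q \<in> par_idx (L n) (width p (L n) N)) \<and> (\<forall>l j k. l \<le> L n \<longrightarrow> \<bar>\<beta> (l, j, k)\<bar> \<le> 1) \<and>
     (\<forall>q. \<bar>\<beta> q\<bar> \<le> 1 + 2 * F) \<and>
     real (card {q. \<beta> q \<noteq> 0}) \<le> C * real n powr \<kappa> \<and>
     (\<forall>x. x \<in> cube p \<longrightarrow> \<bar>relu_net (L n) (width p (L n) N) \<beta> x\<bar> \<le> F * (1 - real n powr (- \<alpha> / q))) \<and>
     (\<forall>k<n. \<bar>relu_net (L n) (width p (L n) N) \<beta> (X n k) - f0 (X n k)\<bar> \<le> C * real n powr (- \<alpha> / q))"
    using L
  proof eventually_elim
    case (elim n)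
    define h where "h = real n powr (1 / q)"
    define M where "M = nat \<lceil>h\<rceil>"
    define \<rho> where "\<rho> = real n powr \<kappa>"
    define r where "r = real n powr (- \<alpha> / q)"
    have n1: "1 \<le> real n" using elim by simp
    have h1: "1 \<le> h" unfolding h_def using n1 q0 by (intro ge_one_powr_ge_zero) auto
    have hn: "h \<le> real n"
    proof -
      have "h \<le> real n powr 1" unfolding h_def using n1 q1 by (intro powr_mono) auto
      then show ?thesis using n1 by simp
    qed
    have hM: "h \<le> real M" "real M \<le> 2 * h" using h1 by (simp_all add: M_def) linarith
    have M1: "1 \<le> M" using hM(1) h1 by linarith
    have hp: "h ^ p = \<rho>" using n1 by (simp add: h_def \<rho>_def \<kappa>_def powr_power)
    define V where "V = M ^ p"
    have V: "\<rho> \<le> real V" "real V \<le> 2 ^ p * \<rho>"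
    proof -
      show "\<rho> \<le> real V" unfolding V_def of_nat_power hp[symmetric] using hM h1 by (intro power_mono) auto
      have "real V \<le> (2 * h) ^ p" unfolding V_def of_nat_power using hM by (intro power_mono) auto
      then show "real V \<le> 2 ^ p * \<rho>" by (simp add: power_mult_distrib hp)
    qed
    have \<rho>1: "1 \<le> \<rho>" unfolding \<rho>_def using n1 \<kappa> by (intro ge_one_powr_ge_zero) auto
    \<comment> \<open>\<alpha> < p gives \<kappa> > 1/3, so A = 12 amplification steps reach n^4.
      The factor to be restored is a constant times M (n + 1), at most of order n^2, since M \<le> 2
      n.\<close>
    have V12: "real n ^ 4 \<le> real V ^ 12"
    proof -
      have "real n ^ 4 = real n powr 4" using n1 by (simp add: powr_numeral)
      also have "\<dots> \<le> real n powr (12 * \<kappa>)" using n1 \<kappa> by (intro powr_mono) auto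
      also have "\<dots> = \<rho> ^ 12" using n1 by (simp add: \<rho>_def powr_power mult.commute)
      also have "\<dots> \<le> real V ^ 12" using V \<rho>1 by (intro power_mono) auto
      finally show ?thesis .
    qed
    have V0: "0 < real V ^ 12" using V \<rho>1 by (intro zero_less_power) linarith
    have MV: "M \<le> V" unfolding V_def using power_increasing[of 1 p M] M1 p by simp
    \<comment> \<open>The size of the first layer plus one neuron per cell; the actual width 12 p N
      is at least N, so every layer of the construction fits.\<close>
    define N where "N = 2 * p * (M + 1) + card J * V + V"
    define w where "w = width p (L n) N"
    have N1: "1 \<le> N" using MV M1 by (simp add: N_def)
    have r01: "0 \<le> r" "r \<le> 1"
      unfolding r_def using n1 \<alpha> q0 powr_mono[of "- \<alpha> / q" 0 "real n"] by auto
    have M0: "0 < real M" using M1 by simp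
    have amp1: "1 / real (M ^ p) ^ 12 * (1 + real (card J) * (Ch / (2 * F))) \<le> 1 / (8 * real M * (real n + 1))"
    proof -
      have "(1 + real (card J) * C') * (8 * real M * (real n + 1)) \<le> (1 + real (card J) * C') * (8 * (2 * real n) * (real n + 1))"
        using hM hn C'0 by (intro mult_left_mono mult_right_mono) auto
      also have "\<dots> = 16 * (1 + real (card J) * C') * real n * (real n + 1)" by (simp add: algebra_simps)
      also have "\<dots> \<le> real V ^ 12" using elim(1) V12 by linarith
      finally have "(1 + real (card J) * C') / real V ^ 12 \<le> 1 / (8 * real M * (real n + 1))"
        using V0 M0 by (simp add: divide_simps)
      then show ?thesis by (simp add: V_def C'_def)
    qed
    have amp2: "1 / real (M ^ p) ^ 12 * (Ch / (2 * F)) * (2 * real E + 1) \<le> 1"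
    proof -
      have "C' * (2 * real E + 1) / real V ^ 12 \<le> 1" using elim(2) V12 V0 by simp
      moreover have "1 / x * y * z = y * z / x" for x y z :: real by simp
      ultimately show ?thesis unfolding V_def[symmetric] C'_def[symmetric] by metis
    qed
    \<comment> \<open>The depth 2 A + 5 for A = 12; it is constant, so a logarithmic depth
      eventually exceeds it.\<close>
    have L29: "2 * 12 + 5 \<le> L n" using elim by linarith
    have Nle: "N \<le> 12 * p * N" using mult_le_mono1[of 1 "12 * p" N] p by simp
    have "\<exists>\<beta>. (\<forall>q. \<beta> q \<noteq> 0 \<longrightarrow> q \<in> par_idx (L n) w) \<and> (\<forall>l j k. l \<le> L n \<longrightarrow> \<bar>\<beta> (l, j, k)\<bar> \<le> 1) \<and>
     (\<forall>q. \<bar>\<beta> q\<bar> \<le> 1 + 2 * F) \<and>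
     card {q. \<beta> q \<noteq> 0} \<le> (p + 3) * (2 * p * (M + 1) + card J * M ^ p)
        + M ^ p * (card J + 2 * p + 2 + 4 * 12) + 5 + 2 * L n \<and>
     (\<forall>x. x \<in> cube p \<longrightarrow> \<bar>relu_net (L n) w \<beta> x\<bar> \<le> F * (1 - r)) \<and>
     (\<forall>k<n. \<bar>relu_net (L n) w \<beta> (X n k) - f0 (X n k)\<bar>
        \<le> F * r + Ch * (2 / real M) powr \<alpha> + real (card J) * (Ch * (real E / real (M ^ p))))"
    proof (rule approx_network[where Wd = "12 * p * N" and u = u and e = e])
      show "w 0 = p" "w (Suc (L n)) = 1" by (simp_all add: w_def width_def)
      show "w l = 12 * p * N" if "1 \<le> l" "l \<le> L n" for l using that by (simp add: w_def width_def)
      show "2 * p * (M + 1) + card J * M ^ p + M ^ p \<le> 12 * p * N" using Nle by (simp add: N_def V_def)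
      show "\<exists>c. (\<forall>j\<in>J. \<bar>c j\<bar> \<le> Ch) \<and>
        (\<forall>x\<in>cube p. \<bar>f0 x - (\<Sum>j\<in>J. c j * (\<Sum>i<p. u j i * x i) ^ e j)\<bar> \<le> Ch * dist_inf p x a powr \<alpha>)"
        if "a \<in> cube p" for a using expand that by blast
    qed (use p M1 finJ u eE Ch \<alpha> F r01 f0 X L29 amp1 amp2 in auto)
    then obtain \<beta> where supp: "\<forall>q. \<beta> q \<noteq> 0 \<longrightarrow> q \<in> par_idx (L n) w"
      and b1: "\<forall>l j k. l \<le> L n \<longrightarrow> \<bar>\<beta> (l, j, k)\<bar> \<le> 1" and b2: "\<forall>q. \<bar>\<beta> q\<bar> \<le> 1 + 2 * F"
      and cd: "card {q. \<beta> q \<noteq> 0} \<le> (p + 3) * (2 * p * (M + 1) + card J * M ^ p)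
        + M ^ p * (card J + 2 * p + 2 + 4 * 12) + 5 + 2 * L n"
      and sup: "\<forall>x. x \<in> cube p \<longrightarrow> \<bar>relu_net (L n) w \<beta> x\<bar> \<le> F * (1 - r)"
      and err: "\<forall>k<n. \<bar>relu_net (L n) w \<beta> (X n k) - f0 (X n k)\<bar>
        \<le> F * r + Ch * (2 / real M) powr \<alpha> + real (card J) * (Ch * (real E / real (M ^ p)))"
      by (elim exE conjE) (rule that)
    have V1: "1 \<le> V" using MV M1 by simp
    have T: "real (2 * p * (M + 1) + card J * V) \<le> (B - 1) * real V"
    proof -
      have "real M + 1 \<le> 2 * real V" using MV V1 by simp
      then have "2 * real p * (real M + 1) \<le> 2 * real p * (2 * real V)" by (intro mult_left_mono) auto
      moreover have "0 \<le> real p * real V" by simp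
      ultimately have "2 * real p * (real M + 1) \<le> 6 * real p * real V"
        by (simp only: algebra_simps)
      then show ?thesis by (simp add: B_def algebra_simps)
    qed
    have C\<rho>: "CN * \<rho> \<le> C * \<rho>" "CS * \<rho> \<le> C * \<rho>" using pos \<rho>1 by (auto simp: C_def intro!: mult_right_mono)
    have "real N \<le> B * real V" using T by (simp add: N_def algebra_simps)
    also have "\<dots> \<le> CN * \<rho>" using V by (simp add: CN_def B_def mult.assoc mult_left_mono)
    finally have Nb: "real N \<le> C * \<rho>" using C\<rho> by simp
    have "real (card {q. \<beta> q \<noteq> 0}) \<le> (real p + 3) * ((B - 1) * real V)
        + real V * (real (card J) + 2 * real p + 50) + 5 + 2 * real (L n)"
    proof -
      have "real (card {q. \<beta> q \<noteq> 0}) \<le> real ((p + 3) * (2 * p * (M + 1) + card J * V)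
        + V * (card J + 2 * p + 2 + 4 * 12) + 5 + 2 * L n)"
        using cd unfolding V_def by (rule of_nat_mono)
      also have "\<dots> = (real p + 3) * real (2 * p * (M + 1) + card J * V)
        + real V * (real (card J) + 2 * real p + 50) + 5 + 2 * real (L n)" by simp
      also have "\<dots> \<le> (real p + 3) * ((B - 1) * real V)
        + real V * (real (card J) + 2 * real p + 50) + 5 + 2 * real (L n)"
        using T by (intro add_right_mono mult_left_mono) auto
      finally show ?thesis .
    qed
    also have "\<dots> \<le> ((real p + 3) * B + real (card J) + 2 * real p + 60) * real V + \<rho>"
    proof -
      have "2 * real (L n) \<le> \<rho>" using elim by (simp add: \<rho>_def)
      moreover have "0 \<le> real p * real V" "1 \<le> real V" using V1 by auto
      ultimately show ?thesis by (simp only: algebra_simps)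
    qed
    also have "\<dots> \<le> ((real p + 3) * B + real (card J) + 2 * real p + 60) * (2 ^ p * \<rho>) + \<rho>"
      using V by (intro add_right_mono mult_left_mono) (auto simp: B_def)
    also have "\<dots> = CS * \<rho>" by (simp add: CS_def algebra_simps)
    finally have Sb: "real (card {q. \<beta> q \<noteq> 0}) \<le> C * \<rho>" using C\<rho> by simp
    have rate: "F * r + Ch * (2 / real M) powr \<alpha> + real (card J) * (Ch * (real E / real (M ^ p))) \<le> C * r"
    proof -
      have "(2 / real M) powr \<alpha> \<le> (2 / h) powr \<alpha>"
        using hM h1 \<alpha> M0 by (intro powr_mono2 divide_left_mono) auto
      also have "\<dots> = 2 powr \<alpha> * r"
      proof -
        have "h powr \<alpha> = real n powr (\<alpha> / q)" by (simp add: h_def powr_powr)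
        moreover have "r = 1 / real n powr (\<alpha> / q)" by (simp add: r_def powr_minus divide_inverse)
        ultimately show ?thesis using h1 by (simp add: powr_divide)
      qed
      finally have 1: "Ch * (2 / real M) powr \<alpha> \<le> Ch * 2 powr \<alpha> * r" using Ch by (simp add: mult.assoc mult_left_mono)
      have "1 / real V \<le> 1 / \<rho>" using V \<rho>1 by (intro divide_left_mono mult_pos_pos) auto
      also have "\<dots> = real n powr (- \<kappa>)" by (simp add: \<rho>_def powr_minus divide_inverse)
      also have "\<dots> \<le> r" unfolding r_def using n1 \<alpha> q0 by (intro powr_mono) (auto simp: \<kappa>_def divide_right_mono)
      finally have "real (card J) * Ch * real E * (1 / real V) \<le> real (card J) * Ch * real E * r"
        using Ch by (intro mult_left_mono) auto
      then have 2: "real (card J) * (Ch * (real E / real (M ^ p))) \<le> real (card J) * (Ch * real E) * r"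
        by (simp add: V_def mult.assoc)
      have "F * r + Ch * (2 / real M) powr \<alpha> + real (card J) * (Ch * (real E / real (M ^ p))) \<le> CE * r"
        using 1 2 by (simp add: CE_def algebra_simps)
      also have "\<dots> \<le> C * r" using pos r01 by (intro mult_right_mono) (auto simp: C_def)
      finally show ?thesis .
    qed
    show ?case
      by (intro exI[of _ N] exI[of _ \<beta>] conjI)
         (use N1 Nb supp b1 b2 Sb sup err rate in \<open>auto simp: \<rho>_def r_def w_def intro: order_trans\<close>)
  qed
  moreover have "0 < C" using pos by (simp add: C_def)
  ultimately show ?thesis unfolding \<kappa>_def q_def by blast
qed

section \<open>Exponential bounds per active parameter\<close>

context regression
begin

text \<open>All cardinalities, covering numbers and inverse masses that enter the bound are at most
  exp l3 per active parameter; in the limit l3 is the cube of log n.\<close>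
context
  fixes l3 :: real
  assumes size: "real n ^ 10 * real Lip \<le> exp l3" and n6: "6 \<le> n" and Ln: "L + 1 \<le> n" and snn: "sn + 1 \<le> n ^ 2"
begin

lemma pow_n_le: "k \<le> 10 \<Longrightarrow> real n ^ k \<le> exp l3" "k \<le> 10 \<Longrightarrow> real n ^ k * real Lip \<le> exp l3"
proof -
  assume k: "k \<le> 10"
  have 1: "real n ^ k \<le> real n ^ 10" using k n by (intro power_increasing) auto
  then show 2: "real n ^ k * real Lip \<le> exp l3"
    using mult_right_mono[OF 1, of "real Lip"] size by simp
  have "real n ^ k * 1 \<le> real n ^ k * real Lip" using Lip1 by (intro mult_left_mono) auto
  then show "real n ^ k \<le> exp l3" using 2 by simp
qed

lemma card_par_le: "(L + 1) * (sn * (sn + 1)) \<le> n ^ 5"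
proof -
  have "sn * (sn + 1) \<le> n ^ 2 * n ^ 2" using snn by (intro mult_le_mono) auto
  from mult_le_mono[OF Ln this] have "(L + 1) * (sn * (sn + 1)) \<le> n * (n ^ 2 * n ^ 2)" .
  then show ?thesis by (simp add: power_numeral_reduce)
qed

text \<open>At most n^5 positions times about 2 n^2 mesh grid values, where mesh = n^2 Lip, give the
  order n^9 Lip. The tenth power of n in \<open>size\<close> absorbs the numerical constant.\<close>

lemma n_centers_le: "real n_centers \<le> exp (l3 * real sn)"
proof -
  define a where "a = (L + 1) * (sn * (sn + 1)) * (2 * (n ^ 2 * mesh + 1) + 1) + 1"
  have n0: "1 \<le> real n" using n by simp
  have X1: "1 \<le> real Lip" using Lip1 by simp
  have "a \<le> n ^ 5 * (2 * (n ^ 2 * mesh + 1) + 1) + 1"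
    unfolding a_def using card_par_le by (intro add_mono mult_le_mono) auto
  then have "real a \<le> real (n ^ 5 * (2 * (n ^ 2 * mesh + 1) + 1) + 1)" by (rule of_nat_mono)
  also have "\<dots> = 2 * (real n ^ 9 * real Lip) + 3 * real n ^ 5 + 1"
    by (simp add: mesh_def algebra_simps power_add[symmetric])
  also have "\<dots> \<le> 2 * (real n ^ 9 * real Lip) + 3 * (real n ^ 9 * real Lip) + real n ^ 9 * real Lip"
  proof (intro add_mono mult_left_mono order_refl)
    have "real n ^ 5 * 1 \<le> real n ^ 9 * real Lip" using n0 X1 by (intro mult_mono power_increasing) auto
    then show "real n ^ 5 \<le> real n ^ 9 * real Lip" by simp
    have "1 * 1 \<le> real n ^ 9 * real Lip" using n0 X1 by (intro mult_mono) auto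
    then show "1 \<le> real n ^ 9 * real Lip" by simp
  qed auto
  also have "\<dots> = 6 * (real n ^ 9 * real Lip)" by simp
  also have "\<dots> \<le> real n * (real n ^ 9 * real Lip)" using n6 by (intro mult_right_mono) auto
  also have "\<dots> = real n ^ 10 * real Lip" by (simp add: power_numeral_reduce)
  also have "\<dots> \<le> exp l3" by (rule size)
  finally have "real a ^ sn \<le> exp l3 ^ sn" by (intro power_mono) auto
  then show ?thesis unfolding n_centers_def a_def[symmetric]
    by (simp add: exp_of_nat_mult[symmetric] mult.commute)
qed

lemma norm_lb_ge:
  assumes c: "1 / min (1 / 2) (std_normal_density (0 + 1)) \<le> real n" "1 / F \<le> real n"
  shows "exp (- (l3 * real sn)) \<le> norm_lb"
proof -
  define c0 where "c0 = min (1 / 2) (std_normal_density (0 + 1))"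
  have c0: "0 < c0" unfolding c0_def by (rule std_normal_min_pos)
  have n0: "1 \<le> real n" using n by simp
  have X0: "1 \<le> real Lip" using Lip1 by simp
  have "1 / real n \<le> c0" using c(1)[folded c0_def] c0 n0 by (simp add: field_simps)
  moreover have "1 / (real n * real Lip) \<le> min 1 (F / real Lip)"
  proof -
    have "1 / (real n * real Lip) \<le> 1" using mult_mono[of 1 "real n" 1 "real Lip"] n0 X0 by simp
    moreover have "1 / real n \<le> F" using c(2) F n0 by (simp add: field_simps)
    then have "1 / real n / real Lip \<le> F / real Lip" by (intro divide_right_mono) auto
    ultimately show ?thesis by simp
  qed
  ultimately have "1 / real n * (1 / (real n * real Lip)) \<le> c0 * min 1 (F / real Lip)"
    using c0 n0 X0 by (intro mult_mono) auto
  moreover have "exp (- l3) \<le> 1 / real n * (1 / (real n * real Lip))"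
  proof -
    have "1 / exp l3 \<le> 1 / (real n ^ 2 * real Lip)"
      using pow_n_le(2)[of 2] n0 X0 by (intro divide_left_mono mult_pos_pos) auto
    then show ?thesis by (simp add: exp_minus divide_inverse power2_eq_square mult_ac)
  qed
  ultimately have "exp (- l3) ^ sn \<le> norm_lb"
    unfolding norm_lb_def c0_def[symmetric] by (intro power_mono) auto
  then show ?thesis by (simp add: exp_of_nat_mult[symmetric] mult.commute)
qed

text \<open>Counting factors exp(-l3): the weight of N costs N + 1 of them, by N! \<le> N^N and the
  normalizing constant. The weight of s, the box and the number of connectivity sets cost s
  each.\<close>

lemma evidence_ge:
  assumes N: "1 \<le> N" "real N \<le> lam * real n ^ 10" "exp lam - 1 \<le> real n ^ 10" and lams: "lams \<le> l3"
    and cK: "1 / min (1 / 2) (std_normal_density (K + 1)) \<le> real n" and sn: "1 \<le> sn"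
  shows "exp (- (l3 * (real N + 1 + 3 * real s) + 2 * \<tau> + 2)) \<le> evidence N s K \<tau>"
proof -
  define c where "c = min (1 / 2) (std_normal_density (K + 1))"
  define T where "T = real ((L + 1) * (sn * (sn + 1)))"
  have c0: "0 < c" unfolding c_def by (rule std_normal_min_pos)
  have n0: "1 \<le> real n" using n by simp
  have X0: "1 \<le> real Lip" using Lip1 by simp
  have T0: "0 < T" using sn unfolding T_def by (simp only: of_nat_0_less_iff) simp
  have pi: "exp (- l3) ^ N * exp (- l3) \<le> pi_N lam N"
  proof -
    have "exp (- l3) \<le> lam / real N"
    proof -
      have "real N / lam \<le> real n ^ 10" using N(2) lam by (simp add: pos_divide_le_eq mult.commute)
      then have "real N / lam \<le> exp l3" using pow_n_le(1)[of 10] by linarith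
      moreover have "0 < real N / lam" using N lam by simp
      ultimately have "1 / exp l3 \<le> 1 / (real N / lam)" by (intro divide_left_mono mult_pos_pos) simp_all
      then show ?thesis by (simp add: exp_minus divide_inverse mult.commute)
    qed
    then have "exp (- l3) ^ N \<le> (lam / real N) ^ N" by (intro power_mono) auto
    also have "\<dots> = lam ^ N / real N ^ N" by (rule power_divide)
    also have "\<dots> \<le> lam ^ N / fact N"
    proof -
      have "(fact N :: real) \<le> real N ^ N" using fact_le_power[of N, where ?'a = real] by simp
      then show ?thesis using lam by (intro frac_le) auto
    qed
    finally have 1: "exp (- l3) ^ N \<le> lam ^ N / fact N" .
    have e1: "0 < exp lam - 1" using lam by simp
    have "1 / exp l3 \<le> 1 / (exp lam - 1)" using N(3) pow_n_le(1)[of 10] e1 by (intro divide_left_mono) auto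
    then have "exp (- l3) ^ N * exp (- l3) \<le> lam ^ N / fact N * (1 / (exp lam - 1))"
      using 1 lam by (intro mult_mono) (auto simp: exp_minus divide_inverse)
    then show ?thesis by (simp add: pi_N_def mult.commute)
  qed
  have 2: "exp (- l3) ^ s \<le> exp (- lams * real s)"
    using lams by (simp add: exp_of_nat_mult[symmetric] mult.commute mult_right_mono)
  have 3: "exp (- l3) ^ s \<le> (c / real mesh) ^ s"
  proof (rule power_mono)
    have "real mesh * (1 / c) \<le> real mesh * real n" using cK by (intro mult_left_mono) (auto simp: c_def)
    also have "\<dots> = real n ^ 3 * real Lip" by (simp add: mesh_def power_numeral_reduce)
    also have "\<dots> \<le> exp l3" by (rule pow_n_le(2)) simp
    finally have "1 / exp l3 \<le> 1 / (real mesh * (1 / c))" using c0 mesh1 by (intro divide_left_mono mult_pos_pos) auto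
    then show "exp (- l3) \<le> c / real mesh" by (simp add: exp_minus divide_inverse mult.commute)
  qed simp
  have 4: "exp (- l3) ^ s \<le> 1 / T ^ s"
  proof -
    have "T \<le> real (n ^ 5)" unfolding T_def using card_par_le by (rule of_nat_mono)
    then have "T \<le> exp l3" using pow_n_le(1)[of 5] by simp
    then have "1 / exp l3 \<le> 1 / T" using T0 by (intro divide_left_mono) auto
    then have "exp (- l3) ^ s \<le> (1 / T) ^ s" by (intro power_mono) (auto simp: exp_minus divide_inverse)
    then show ?thesis by (simp add: power_one_over)
  qed
  have "exp (- (l3 * (real N + 1 + 3 * real s) + 2 * \<tau> + 2))
    = exp (- l3) ^ N * exp (- l3) * exp (- l3) ^ s * exp (- 2 * \<tau> - 2) * exp (- l3) ^ s * exp (- l3) ^ s"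
    by (simp add: exp_of_nat_mult[symmetric] exp_add[symmetric] algebra_simps)
  also have "\<dots> \<le> pi_N lam N * exp (- lams * real s) * exp (- 2 * \<tau> - 2) * (c / real mesh) ^ s * (1 / T ^ s)"
    using pi 2 3 4 pi_N_nonneg[OF lam(1), of N] c0 T0
    by (intro mult_mono order_refl) (auto intro!: mult_nonneg_nonneg)
  also have "\<dots> = evidence N s K \<tau>" by (simp add: evidence_def c_def T_def)
  finally show ?thesis .
qed

end

end

text \<open>The base is at most n^5 and the exponent is of order log n, so the left side is
  exp(O(log^2 n)). The third power of the logarithm absorbs all constants.\<close>

lemma Lip_growth:
  fixes L sn :: "nat \<Rightarrow> nat"
  assumes \<kappa>: "0 < \<kappa>" "\<kappa> < 1" and c2: "0 < c2"
    and L: "\<forall>\<^sub>F n in sequentially. real (L n) \<le> c2 * ln (real n)"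
    and sn: "\<forall>\<^sub>F n in sequentially. real (sn n) \<le> real n powr \<kappa> * ln (real n) ^ 4 + 1"
  shows "\<forall>\<^sub>F n in sequentially. L n + 1 \<le> n \<and> sn n + 1 \<le> n ^ 2 \<and>
     real n ^ 10 * real (2 * (L n + 1) * ((n ^ 2 + 1) * (sn n + 1)) ^ Suc (L n)) \<le> exp (ln (real n) ^ 3)"
proof -
  have "\<forall>\<^sub>F n in sequentially. real n powr \<kappa> * ln (real n) ^ 4 + 2 \<le> real n ^ 2" using \<kappa> by real_asymp
  moreover have "\<forall>\<^sub>F n in sequentially. 2 * (c2 * ln (real n) + 1) \<le> real n" using c2 by real_asymp
  moreover have "\<forall>\<^sub>F n in sequentially. (5 * (c2 * ln (real n) + 1) + 11) * ln (real n) \<le> ln (real n) ^ 3"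
    using c2 by real_asymp
  moreover have "\<forall>\<^sub>F n :: nat in sequentially. 2 \<le> n" by (rule eventually_ge_at_top)
  ultimately show ?thesis using L sn
  proof eventually_elim
    case (elim n)
    define m where "m = L n + 1"
    have n1: "1 \<le> real n" using elim by simp
    have m: "2 * m \<le> n"
    proof -
      have "real (2 * m) \<le> real n" using elim by (simp add: m_def)
      then show ?thesis by (simp only: of_nat_le_iff)
    qed
    have s: "sn n + 1 \<le> n ^ 2"
    proof -
      have "real (sn n + 1) \<le> real (n ^ 2)" using elim by simp
      then show ?thesis by (simp only: of_nat_le_iff)
    qed
    have "n ^ 2 + 1 \<le> n ^ 3"
    proof -
      have "n ^ 2 + 1 \<le> 2 * n ^ 2" using elim by simp
      also have "\<dots> \<le> n * n ^ 2" using elim by (intro mult_le_mono1) simp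
      finally show ?thesis by (simp add: power_numeral_reduce)
    qed
    then have "(n ^ 2 + 1) * (sn n + 1) \<le> n ^ 3 * n ^ 2" using s by (intro mult_le_mono)
    then have "(n ^ 2 + 1) * (sn n + 1) \<le> n ^ 5" by (simp add: power_add[symmetric])
    then have "((n ^ 2 + 1) * (sn n + 1)) ^ m \<le> (n ^ 5) ^ m" by (intro power_mono) auto
    then have "2 * m * ((n ^ 2 + 1) * (sn n + 1)) ^ m \<le> n * (n ^ 5) ^ m" using m by (intro mult_le_mono)
    then have "real (2 * m * ((n ^ 2 + 1) * (sn n + 1)) ^ m) \<le> real (n * (n ^ 5) ^ m)" by (rule of_nat_mono)
    then have "real n ^ 10 * real (2 * m * ((n ^ 2 + 1) * (sn n + 1)) ^ m) \<le> real n ^ 10 * real (n * (n ^ 5) ^ m)"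
      by (intro mult_left_mono) auto
    also have "\<dots> = real n ^ (11 + 5 * m)" by (simp add: power_add power_mult power_numeral_reduce)
    also have "\<dots> = exp (real (11 + 5 * m) * ln (real n))"
      using n1 by (subst exp_of_nat_mult) simp
    also have "\<dots> \<le> exp (ln (real n) ^ 3)"
    proof -
      have "real (11 + 5 * m) \<le> 5 * (c2 * ln (real n) + 1) + 11" using elim by (simp add: m_def)
      then have "real (11 + 5 * m) * ln (real n) \<le> (5 * (c2 * ln (real n) + 1) + 11) * ln (real n)"
        using n1 by (intro mult_right_mono) auto
      then have "real (11 + 5 * m) * ln (real n) \<le> ln (real n) ^ 3" using elim(3) by (rule order_trans)
      then show ?thesis by (simp only: exp_le_cancel_iff)
    qed
    finally show ?case using m s by (simp add: m_def)
  qed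
qed

theorem mainTheorem7:
  fixes p :: nat and \<alpha> F lam lams :: real
    and X :: "nat \<Rightarrow> nat \<Rightarrow> nat \<Rightarrow> real"
    and f0 :: "(nat \<Rightarrow> real) \<Rightarrow> real"
    and L :: "nat \<Rightarrow> nat"
  assumes "p \<ge> 1" and "0 < \<alpha>" and "\<alpha> < real p"
    and "F > 0" and "lam > 0" and "lams > 0"
    and "hoelder p \<alpha> f0" and "\<forall>x\<in>cube p. \<bar>f0 x\<bar> \<le> F"
    and "\<forall>n i. i < n \<longrightarrow> X n i \<in> cube p"
    and "\<exists>c1 c2. 0 < c1 \<and> 0 < c2 \<and>
           (\<forall>\<^sub>F n in sequentially. c1 * ln (real n) \<le> real (L n) \<and> real (L n) \<le> c2 * ln (real n))"
  shows "\<exists>\<delta>>1. \<forall>M :: nat \<Rightarrow> real. filterlim M at_top sequentially \<longrightarrow>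
           (\<forall>\<epsilon>>0. (\<lambda>n. outer_prob (data_law X f0 n)
               {Y. posterior p (L n) F lam lams X n Y
                     {f \<in> relu_space p (L n) F.
                        emp_norm X n (\<lambda>x. f x - f0 x) >
                          M n * (real n powr (- \<alpha> / (2 * \<alpha> + real p)) * ln (real n) powr \<delta>)}
                   > ennreal \<epsilon>}) \<longlonglongrightarrow> 0)"
proof -
  note p = assms(1) and \<alpha> = assms(2,3) and F = assms(4) and lam = assms(5,6)
  obtain c1 c2 where c: "0 < c1" "0 < c2"
    and L: "\<forall>\<^sub>F n in sequentially. c1 * ln (real n) \<le> real (L n) \<and> real (L n) \<le> c2 * ln (real n)"
    using assms(10) by blast
  define q where "q = 2 * \<alpha> + real p"
  define \<kappa> where "\<kappa> = real p / q"
  define a where "a = \<alpha> / q"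
  have q0: "0 < q" using \<alpha> by (simp add: q_def)
  have \<kappa>: "0 < \<kappa>" "\<kappa> < 1" using \<alpha> p by (auto simp: \<kappa>_def q_def field_simps)
  have a: "0 < a" "a < 1" using \<alpha> by (auto simp: a_def q_def field_simps)
  \<comment> \<open>Multiplying the squared rate n^(-2a) by the sample size gives n^\<kappa>, the
    number of cells: bias and dimension are balanced.\<close>
  have a\<kappa>: "1 - 2 * a = \<kappa>" using q0 by (simp add: a_def \<kappa>_def q_def field_simps)
  define \<rho> where "\<rho> n = real n powr \<kappa>" for n
  obtain C where C: "0 < C" and net: "\<forall>\<^sub>F n in sequentially. \<exists>N \<beta>. 1 \<le> N \<and> real N \<le> C * \<rho> n \<and>
     (\<forall>q. \<beta> q \<noteq> 0 \<longrightarrow> q \<in> par_idx (L n) (width p (L n) N)) \<and> (\<forall>l j k. l \<le> L n \<longrightarrow> \<bar>\<beta> (l, j, k)\<bar> \<le> 1) \<and>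
     (\<forall>q. \<bar>\<beta> q\<bar> \<le> 1 + 2 * F) \<and> real (card {q. \<beta> q \<noteq> 0}) \<le> C * \<rho> n \<and>
     (\<forall>x. x \<in> cube p \<longrightarrow> \<bar>relu_net (L n) (width p (L n) N) \<beta> x\<bar> \<le> F * (1 - real n powr (- a))) \<and>
     (\<forall>k<n. \<bar>relu_net (L n) (width p (L n) N) \<beta> (X n k) - f0 (X n k)\<bar> \<le> C * real n powr (- a))"
    using approx_rate[OF p \<alpha> F assms(7,8,9) c L] unfolding \<rho>_def \<kappa>_def a_def q_def minus_divide_left by blast
  define K where "K = 1 + 2 * F"
  \<comment> \<open>\<open>Cs\<close> counts the support of the network and the 12 p N + 1 top
    parameters. \<open>D\<close> collects the evidence exponent: N + 1 + 3 s contributes C + 1 + 3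
    Cs, and 2 \<tau> + 2 fits into one further unit.\<close>
  define Cs where "Cs = C + 12 * real p * C + 1"
  define D where "D = C + 3 * Cs + 2"
  define PC where "PC = prior_const lam lams"
  have PC0: "0 \<le> PC" unfolding PC_def by (rule prior_const_nonneg[OF lam])
  have Cs0: "0 < Cs" and D0: "0 < D" using C by (auto simp: Cs_def D_def intro!: add_pos_nonneg)
  define sn where "sn n = nat \<lceil>\<rho> n * ln (real n) ^ 4\<rceil>" for n
  have L2: "\<forall>\<^sub>F n in sequentially. real (L n) \<le> c2 * ln (real n)" using L by (rule eventually_mono) simp
  have snu: "\<forall>\<^sub>F n in sequentially. real (sn n) \<le> real n powr \<kappa> * ln (real n) ^ 4 + 1"
    using eventually_ge_at_top[of 1]
  proof eventually_elim
    case (elim n)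
    have "0 \<le> real n powr \<kappa> * ln (real n) ^ 4" using elim by simp
    then show ?case unfolding sn_def \<rho>_def by linarith
  qed
  \<comment> \<open>The failure probabilities of \<open>posterior_bound\<close> in order: cross
    terms at the centers, size of the noise, cross term at the approximating network, and prior mass
    off the sieve divided by the threshold.\<close>
  define bnd_fun where "bnd_fun n = 2 * (\<rho> n * ln (real n) ^ 4) * exp (- (\<rho> n * ln (real n) ^ 7))
      + real n * (2 * exp (1 / 2 - real n)) + exp (- (\<rho> n * ln (real n)) / 2)
      + PC * (exp (- (lams / 2) * (\<rho> n * ln (real n) ^ 4) + (D + 1) * (\<rho> n * ln (real n) ^ 3))
         + 4 * (\<rho> n * ln (real n) ^ 4) * exp (1 / 2 - real n ^ 2 + 2 * (\<rho> n * ln (real n) ^ 7)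
             + (D + 1) * (\<rho> n * ln (real n) ^ 3)))" for n
  have lim0: "bnd_fun \<longlonglongrightarrow> 0"
  proof -
    have b1: "(\<lambda>n. 2 * (real n powr \<kappa> * ln (real n) ^ 4) * exp (- (real n powr \<kappa> * ln (real n) ^ 7))) \<longlonglongrightarrow> 0"
      using \<kappa> by real_asymp
    have b2: "(\<lambda>n. real n * (2 * exp (1 / 2 - real n))) \<longlonglongrightarrow> 0" by real_asymp
    have b3: "(\<lambda>n. exp (- (real n powr \<kappa> * ln (real n)) / 2)) \<longlonglongrightarrow> 0" using \<kappa> by real_asymp
    have b4: "(\<lambda>n. exp (- (lams / 2) * (real n powr \<kappa> * ln (real n) ^ 4) + (D + 1) * (real n powr \<kappa> * ln (real n) ^ 3))) \<longlonglongrightarrow> 0"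
      using \<kappa> lam D0 by real_asymp
    have b5: "(\<lambda>n. 4 * (real n powr \<kappa> * ln (real n) ^ 4) * exp (1 / 2 - real n ^ 2 + 2 * (real n powr \<kappa> * ln (real n) ^ 7)
             + (D + 1) * (real n powr \<kappa> * ln (real n) ^ 3))) \<longlonglongrightarrow> 0"
      using \<kappa> D0 by real_asymp
    have "(\<lambda>n. bnd_fun n) \<longlonglongrightarrow> 0 + 0 + 0 + PC * (0 + 0)"
      unfolding bnd_fun_def \<rho>_def by (intro tendsto_add tendsto_mult tendsto_const b1 b2 b3 b4 b5)
    then show ?thesis by simp
  qed
  have main: "(\<lambda>n. outer_prob (data_law X f0 n) {Y. posterior p (L n) F lam lams X n Y
        {f \<in> relu_space p (L n) F. emp_norm X n (\<lambda>x. f x - f0 x) >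
             M n * (real n powr (- \<alpha> / (2 * \<alpha> + real p)) * ln (real n) powr 4)} > ennreal e}) \<longlonglongrightarrow> 0"
    if M: "filterlim M at_top sequentially" and e: "0 < e" for M e
  proof (rule tendsto_sandwich[OF _ _ tendsto_const lim0])
    show "\<forall>\<^sub>F n in sequentially. 0 \<le> outer_prob (data_law X f0 n) {Y. posterior p (L n) F lam lams X n Y
        {f \<in> relu_space p (L n) F. emp_norm X n (\<lambda>x. f x - f0 x) >
             M n * (real n powr (- \<alpha> / (2 * \<alpha> + real p)) * ln (real n) powr 4)} > ennreal e}"
      by (simp add: outer_prob_nonneg)
    \<comment> \<open>The ratio condition of \<open>posterior_bound\<close> after dividing by the
      lower bound exp(-D R l^3) of the evidence, where R = n^\<kappa> and l = log n. It holds
      eventually because R l^8 dominates R l^7.\<close>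
    have ev1: "\<forall>\<^sub>F n in sequentially. PC * exp (2 + 8 * (\<rho> n * ln (real n) ^ 7) - (\<rho> n * ln (real n) ^ 8) / 8
          + D * (\<rho> n * ln (real n) ^ 3)) + exp (- (\<rho> n * ln (real n) ^ 3)) < e"
    proof -
      have r1: "(\<lambda>n. exp (2 + 8 * (real n powr \<kappa> * ln (real n) ^ 7) - (real n powr \<kappa> * ln (real n) ^ 8) / 8
          + D * (real n powr \<kappa> * ln (real n) ^ 3))) \<longlonglongrightarrow> 0"
        using \<kappa> D0 by real_asymp
      have r2: "(\<lambda>n. exp (- (real n powr \<kappa> * ln (real n) ^ 3))) \<longlonglongrightarrow> 0" using \<kappa> by real_asymp
      have "(\<lambda>n. PC * exp (2 + 8 * (\<rho> n * ln (real n) ^ 7) - (\<rho> n * ln (real n) ^ 8) / 8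
          + D * (\<rho> n * ln (real n) ^ 3)) + exp (- (\<rho> n * ln (real n) ^ 3))) \<longlonglongrightarrow> PC * 0 + 0"
        unfolding \<rho>_def by (intro tendsto_add tendsto_mult tendsto_const r1 r2)
      then show ?thesis using e by (intro order_tendstoD(2)) auto
    qed
    define c0 where "c0 = 1 / min (1 / 2) (std_normal_density (0 + 1))"
    define cK where "cK = 1 / min (1 / 2) (std_normal_density (K + 1))"
    have ev2: "\<forall>\<^sub>F n in sequentially. c0 \<le> real n \<and> cK \<le> real n \<and> 1 / F \<le> real n \<and> exp lam - 1 \<le> real n ^ 10
        \<and> lams \<le> ln (real n) ^ 3 \<and> K \<le> real n ^ 2 \<and> C ^ 2 \<le> ln (real n) \<and> Cs \<le> ln (real n) ^ 4"
    proof -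
      have "\<forall>\<^sub>F n in sequentially. c0 \<le> real n" "\<forall>\<^sub>F n in sequentially. cK \<le> real n"
        "\<forall>\<^sub>F n in sequentially. 1 / F \<le> real n" "\<forall>\<^sub>F n in sequentially. exp lam - 1 \<le> real n ^ 10"
        "\<forall>\<^sub>F n in sequentially. lams \<le> ln (real n) ^ 3" "\<forall>\<^sub>F n in sequentially. K \<le> real n ^ 2"
        "\<forall>\<^sub>F n in sequentially. C ^ 2 \<le> ln (real n)" "\<forall>\<^sub>F n in sequentially. Cs \<le> ln (real n) ^ 4"
        by real_asymp+
      then show ?thesis by eventually_elim simp
    qed
    have ev3: "\<forall>\<^sub>F n in sequentially. 1 / real n ^ 2 \<le> F * real n powr (- a)" using a F by real_asymp
    have ev4: "\<forall>\<^sub>F n in sequentially. 2 * (real n powr \<kappa> * ln (real n)) + 2 \<le> real n powr \<kappa> * ln (real n) ^ 3"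
      using \<kappa> by real_asymp
    have ev5: "\<forall>\<^sub>F n in sequentially. C * real n powr \<kappa> \<le> lam * real n ^ 10" using \<kappa> lam C by real_asymp
    have ev6: "\<forall>\<^sub>F n in sequentially. 1 \<le> real n powr \<kappa> * ln (real n) ^ 4" using \<kappa> by real_asymp
    have ev7: "\<forall>\<^sub>F n in sequentially. 1 \<le> M n" using M by (simp add: filterlim_at_top)
    have ev8: "\<forall>\<^sub>F n in sequentially. 1 \<le> L n"
    proof -
      have "\<forall>\<^sub>F n in sequentially. 1 \<le> c1 * ln (real n)" using c by real_asymp
      with L show ?thesis by eventually_elim linarith
    qed
    have ev9: "\<forall>\<^sub>F n :: nat in sequentially. 6 \<le> n" by (rule eventually_ge_at_top)
    show "\<forall>\<^sub>F n in sequentially. outer_prob (data_law X f0 n) {Y. posterior p (L n) F lam lams X n Y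
        {f \<in> relu_space p (L n) F. emp_norm X n (\<lambda>x. f x - f0 x) >
             M n * (real n powr (- \<alpha> / (2 * \<alpha> + real p)) * ln (real n) powr 4)} > ennreal e} \<le> bnd_fun n"
      using net Lip_growth[OF \<kappa> c(2) L2 snu] snu ev1 ev2 ev3 ev4 ev5 ev6 ev7 ev8 ev9
    proof eventually_elim
      case (elim n)
      define l where "l = ln (real n)"
      define S where "S = sn n"
      define R where "R = \<rho> n"
      have n6: "6 \<le> n" by (rule elim)
      have n1: "1 \<le> real n" using n6 by simp
      have l0: "0 \<le> l" using n1 by (simp add: l_def)
      have R1: "1 \<le> R" unfolding R_def \<rho>_def using n1 \<kappa> by (intro ge_one_powr_ge_zero) auto
      have Rl4: "1 \<le> R * l ^ 4" using elim by (simp add: R_def \<rho>_def l_def)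
      have S: "R * l ^ 4 \<le> real S" "real S \<le> 2 * (R * l ^ 4)" "1 \<le> S"
      proof -
        show "R * l ^ 4 \<le> real S" unfolding S_def sn_def R_def l_def by linarith
        then show "1 \<le> S" using Rl4 by linarith
        have "real S \<le> R * l ^ 4 + 1" using elim(3) by (simp add: S_def R_def l_def \<rho>_def)
        then show "real S \<le> 2 * (R * l ^ 4)" using Rl4 by simp
      qed
      obtain N \<beta> where N: "1 \<le> N" "real N \<le> C * R"
        and supp: "\<forall>q. \<beta> q \<noteq> 0 \<longrightarrow> q \<in> par_idx (L n) (width p (L n) N)"
        and b1: "\<forall>l j k. l \<le> L n \<longrightarrow> \<bar>\<beta> (l, j, k)\<bar> \<le> 1" and bK: "\<forall>q. \<bar>\<beta> q\<bar> \<le> 1 + 2 * F"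
        and cd: "real (card {q. \<beta> q \<noteq> 0}) \<le> C * R"
        and sup: "\<forall>x. x \<in> cube p \<longrightarrow> \<bar>relu_net (L n) (width p (L n) N) \<beta> x\<bar> \<le> F * (1 - real n powr (- a))"
        and err: "\<forall>k<n. \<bar>relu_net (L n) (width p (L n) N) \<beta> (X n k) - f0 (X n k)\<bar> \<le> C * real n powr (- a)"
        using elim(1)[folded R_def] by (elim exE conjE) (rule that)
      interpret regression p n "L n" S F lam lams X f0
        by unfold_locales (use p n6 elim F lam assms(9) in auto)
      have "L n + 1 \<le> n \<and> S + 1 \<le> n ^ 2 \<and>
          real n ^ 10 * real (2 * (L n + 1) * ((n ^ 2 + 1) * (S + 1)) ^ Suc (L n)) \<le> exp (l ^ 3)"
        using elim(2) unfolding S_def l_def .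
      then have size: "real n ^ 10 * real Lip \<le> exp (l ^ 3)" "L n + 1 \<le> n" "S + 1 \<le> n ^ 2"
        unfolding Lip_def by blast+
      note szf = size(1) n6 size(2) size(3)
      define s where "s = card ({q. \<beta> q \<noteq> 0} \<union> top_idx (L n) (width p (L n) N))"
      have sR: "real s \<le> Cs * R"
      proof -
        have "s \<le> card {q. \<beta> q \<noteq> 0} + card (top_idx (L n) (width p (L n) N))"
          unfolding s_def by (rule card_Un_le)
        also have "card (top_idx (L n) (width p (L n) N)) = 12 * p * N + 1"
          using elim by (simp add: card_top_idx width_def)
        finally have "real s \<le> real (card {q. \<beta> q \<noteq> 0} + (12 * p * N + 1))" by (rule of_nat_mono)
        also have "\<dots> = real (card {q. \<beta> q \<noteq> 0}) + 12 * real p * real N + 1" by simp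
        also have "\<dots> \<le> C * R + 12 * real p * (C * R) + 1 * R"
          using cd N(2) R1 by (intro add_mono mult_left_mono) auto
        finally show ?thesis by (simp add: Cs_def algebra_simps)
      qed
      have sS: "s \<le> S"
      proof -
        have "Cs * R \<le> l ^ 4 * R" using elim R1 by (intro mult_right_mono) (auto simp: l_def)
        then have "real s \<le> real S" using sR S(1) by (simp add: mult.commute)
        then show ?thesis by simp
      qed
      \<comment> \<open>\<tau> exceeds the squared bias, of order R, by a factor log n, so that
        exp(-\<tau>/2) tends to 0. En is chosen so that exp(-En/2) beats the number of centers with
        exp(-l^3 S) to spare. The threshold is below the evidence bound by exp(-R l^3), yet far
        above the prior mass off the sieve, which decays like exp(-lams/2 R l^4).\<close>
      define \<tau> where "\<tau> = R * l"
      define t where "t = R * l ^ 8"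
      define thr where "thr = exp (- ((D + 1) * (R * l ^ 3)))"
      define En where "En = 4 * (l ^ 3 * real S)"
      have nr: "real n * (real n powr (- a))\<^sup>2 = R"
      proof -
        have "real n * (real n powr (- a))\<^sup>2 = real n powr 1 * real n powr (- (2 * a))"
          using n1 by (simp add: powr_power mult.commute)
        also have "\<dots> = real n powr (1 + - (2 * a))" by (rule powr_add[symmetric])
        also have "\<dots> = R" unfolding R_def \<rho>_def a\<kappa>[symmetric] by simp
        finally show ?thesis .
      qed
      have dif: "(\<Sum>i<n. (dif N \<beta> i)\<^sup>2) \<le> \<tau>"
      proof -
        have "(\<Sum>i<n. (dif N \<beta> i)\<^sup>2) \<le> (\<Sum>i<n. (C * real n powr (- a))\<^sup>2)"
          unfolding dif_def using err by (intro sum_mono) (simp add: abs_le_square_iff[symmetric] C less_imp_le)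
        also have "\<dots> = C\<^sup>2 * R" using nr by (simp add: power_mult_distrib)
        also have "\<dots> \<le> l * R" using elim R1 by (intro mult_right_mono) (auto simp: l_def)
        finally show ?thesis by (simp add: \<tau>_def mult.commute)
      qed
      have l3S: "l ^ 3 * real S \<le> 2 * (R * l ^ 7)" "R * l ^ 7 \<le> l ^ 3 * real S"
        using mult_left_mono[OF S(2), of "l ^ 3"] mult_left_mono[OF S(1), of "l ^ 3"] l0
        by (simp_all add: power_add[symmetric] mult.left_commute[of "l ^ 3"])
      have evid: "exp (- (D * (R * l ^ 3))) \<le> evidence N s K \<tau>"
      proof -
        have "exp (- (l ^ 3 * (real N + 1 + 3 * real s) + 2 * \<tau> + 2)) \<le> evidence N s K \<tau>"
          by (rule evidence_ge[OF szf N(1)])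
             (use elim N S(3) order_trans[OF N(2)] in \<open>auto simp: l_def cK_def R_def \<rho>_def\<close>)
        moreover have "l ^ 3 * (real N + 1 + 3 * real s) + 2 * \<tau> + 2 \<le> D * (R * l ^ 3)"
        proof -
          have "l ^ 3 * (real N + 1 + 3 * real s) \<le> l ^ 3 * (C * R + 1 * R + 3 * (Cs * R))"
            using N(2) R1 sR l0 by (intro mult_left_mono add_mono) auto
          moreover have "2 * \<tau> + 2 \<le> R * l ^ 3" using elim by (simp add: \<tau>_def R_def \<rho>_def l_def)
          ultimately show ?thesis by (simp add: D_def algebra_simps)
        qed
        ultimately show ?thesis by (meson exp_le_cancel_iff neg_le_iff_le order_trans)
      qed
      have post: "outer_prob (data_law X f0 n) {Y. ennreal e < posterior p (L n) F lam lams X n Y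
        {f \<in> relu_space p (L n) F. emp_norm X n (\<lambda>x. f x - f0 x) >
             M n * (real n powr (- \<alpha> / (2 * \<alpha> + real p)) * ln (real n) powr 4)}}
         \<le> real S * (real n_centers * exp (- En / 2)) + real n * (2 * exp (1 / 2 - real n))
       + exp (- \<tau> / 2) + prior_const lam lams * tail_mass / thr"
      proof (rule posterior_bound[where N = N and \<beta> = \<beta> and K = K and s = s and t = t])
        show "1 \<le> N" by fact
        show "s = card ({q. \<beta> q \<noteq> 0} \<union> top_idx (L n) (width p (L n) N))" by (rule s_def)
        show "s \<le> S" by fact
        show "q \<in> par_idx (L n) (width p (L n) N)" if "\<beta> q \<noteq> 0" for q using supp that by blast
        show "\<bar>\<beta> (l, j, k)\<bar> \<le> 1" if "l \<le> L n" for l j k using b1 that by blast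
        show "\<bar>\<beta> q\<bar> \<le> K" for q using bK[rule_format, of q] by (simp add: K_def)
        show "K \<le> real n ^ 2" using elim by simp
        show "\<bar>relu_net (L n) (width p (L n) N) \<beta> x\<bar> \<le> F - 1 / real n ^ 2" if "x \<in> cube p" for x
        proof -
          have "\<bar>relu_net (L n) (width p (L n) N) \<beta> x\<bar> \<le> F - F * real n powr (- a)"
            using sup that by (simp add: right_diff_distrib)
          then show ?thesis using elim(6) by linarith
        qed
        show "(\<Sum>i<n. (dif N \<beta> i)\<^sup>2) \<le> \<tau>" by (rule dif)
        show "0 < thr" by (simp add: thr_def)
        show "0 < e" by (rule e)
        show "t \<le> (\<Sum>i<n. (f (X n i) - f0 (X n i))\<^sup>2)"
          if f: "f \<in> {f \<in> relu_space p (L n) F. emp_norm X n (\<lambda>x. f x - f0 x) >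
             M n * (real n powr (- \<alpha> / (2 * \<alpha> + real p)) * ln (real n) powr 4)}" for f
        proof -
          define g where "g = (\<Sum>i<n. (f (X n i) - f0 (X n i))\<^sup>2)"
          have ex: "- \<alpha> / (2 * \<alpha> + real p) = - a" by (simp add: a_def q_def)
          have lp: "ln (real n) powr 4 = l ^ 4"
            using n6 by (simp add: l_def powr_numeral)
          have x0: "0 \<le> real n powr (- a) * l ^ 4" by simp
          have "1 * (real n powr (- a) * l ^ 4) \<le> M n * (real n powr (- a) * l ^ 4)"
            using elim x0 by (intro mult_right_mono) auto
          also have "\<dots> < sqrt (g / real n)"
          proof -
            have "M n * (real n powr (- \<alpha> / (2 * \<alpha> + real p)) * ln (real n) powr 4) < emp_norm X n (\<lambda>x. f x - f0 x)"
              using f by blast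
            then show ?thesis unfolding ex lp emp_norm_def g_def .
          qed
          finally have "(real n powr (- a) * l ^ 4)\<^sup>2 < (sqrt (g / real n))\<^sup>2"
            using x0 by (intro power_strict_mono) auto
          also have "\<dots> = g / real n" by (simp add: g_def sum_nonneg)
          finally have "real n * (real n powr (- a) * l ^ 4)\<^sup>2 < g" using n1 by (simp add: pos_less_divide_eq mult.commute)
          moreover have "real n * (real n powr (- a) * l ^ 4)\<^sup>2 = R * l ^ 8"
            unfolding nr[symmetric] by (simp add: power_mult_distrib power_mult[symmetric])
          ultimately show ?thesis by (simp add: t_def g_def)
        qed
        show "prior_const lam lams * exp (- t / 8 + En + 2) + thr \<le> e * evidence N s K \<tau>"
        proof -
          have "prior_const lam lams * exp (- t / 8 + En + 2) + thr
             \<le> PC * exp (2 + 8 * (R * l ^ 7) - R * l ^ 8 / 8) + thr"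
          proof -
            have "- t / 8 + En + 2 \<le> 2 + 8 * (R * l ^ 7) - R * l ^ 8 / 8"
              unfolding t_def En_def using l3S by linarith
            then show ?thesis
              using PC0 unfolding PC_def[symmetric] by (intro add_right_mono mult_left_mono) auto
          qed
          also have "\<dots> = (PC * exp (2 + 8 * (R * l ^ 7) - R * l ^ 8 / 8 + D * (R * l ^ 3)) + exp (- (R * l ^ 3)))
              * exp (- (D * (R * l ^ 3)))"
            by (simp add: thr_def distrib_right mult.assoc exp_add[symmetric] algebra_simps)
          also have "\<dots> \<le> e * exp (- (D * (R * l ^ 3)))"
            using elim(4) by (intro mult_right_mono) (auto simp: R_def l_def)
          also have "\<dots> \<le> e * evidence N s K \<tau>" using evid e by (intro mult_left_mono) auto
          finally show ?thesis .
        qed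
      qed
      also have "\<dots> \<le> bnd_fun n"
      proof -
        have t1: "real S * (real n_centers * exp (- En / 2)) \<le> 2 * (R * l ^ 4) * exp (- (R * l ^ 7))"
        proof -
          have "real n_centers * exp (- En / 2) \<le> exp (l ^ 3 * real S) * exp (- En / 2)"
            using n_centers_le[OF szf] by (intro mult_right_mono) auto
          also have "\<dots> = exp (- (l ^ 3 * real S))" by (simp add: En_def exp_add[symmetric])
          also have "\<dots> \<le> exp (- (R * l ^ 7))" using l3S by simp
          finally show ?thesis using S by (intro mult_mono) auto
        qed
        have "tail_mass \<le> exp (- (lams / 2) * (R * l ^ 4)) + 2 * (R * l ^ 4) * (2 * exp (1 / 2 - real n ^ 2)) * exp (2 * (R * l ^ 7))"
        proof -
          have "exp (- (2 * (R * l ^ 7))) \<le> norm_lb"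
            using norm_lb_ge[OF szf] elim l3S unfolding c0_def
            by (meson exp_le_cancel_iff neg_le_iff_le order_trans)
          then have "1 / norm_lb \<le> 1 / exp (- (2 * (R * l ^ 7)))"
            using norm_lb_pos by (intro divide_left_mono mult_pos_pos) auto
          then have "1 / norm_lb \<le> exp (2 * (R * l ^ 7))" by (simp add: exp_minus divide_inverse)
          then have h1: "real S * (2 * exp (1 / 2 - real n ^ 2)) * (1 / norm_lb)
            \<le> 2 * (R * l ^ 4) * (2 * exp (1 / 2 - real n ^ 2)) * exp (2 * (R * l ^ 7))"
            using S R1 l0 norm_lb_pos by (intro mult_mono mult_nonneg_nonneg) auto
          have h2: "exp (- (lams / 2) * real S) \<le> exp (- (lams / 2) * (R * l ^ 4))"
            using S lam by simp
          from add_mono[OF h2 h1] show ?thesis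
            by (simp only: tail_mass_def times_divide_eq_right mult_1_right)
        qed
        then have "tail_mass / thr \<le> (exp (- (lams / 2) * (R * l ^ 4)) + 2 * (R * l ^ 4) * (2 * exp (1 / 2 - real n ^ 2)) * exp (2 * (R * l ^ 7))) / thr"
          by (intro divide_right_mono) (auto simp: thr_def)
        also have "\<dots> = exp (- (lams / 2) * (R * l ^ 4) + (D + 1) * (R * l ^ 3))
         + 4 * (R * l ^ 4) * exp (1 / 2 - real n ^ 2 + 2 * (R * l ^ 7) + (D + 1) * (R * l ^ 3))"
        proof -
          define y where "y = (D + 1) * (R * l ^ 3)"
          have thr_y: "x / thr = x * exp y" for x by (simp add: thr_def y_def exp_minus divide_inverse)
          have "(x + 2 * b * (2 * e1) * e2) * ey = x * ey + 4 * b * (e1 * e2 * ey)" for x b e1 e2 ey :: real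
            by (simp add: algebra_simps)
          then show ?thesis unfolding y_def[symmetric] thr_y exp_add .
        qed
        finally have t4: "PC * (tail_mass / thr) \<le> PC * (exp (- (lams / 2) * (R * l ^ 4) + (D + 1) * (R * l ^ 3))
         + 4 * (R * l ^ 4) * exp (1 / 2 - real n ^ 2 + 2 * (R * l ^ 7) + (D + 1) * (R * l ^ 3)))"
          using PC0 by (rule mult_left_mono)
        show ?thesis
          using t1 t4 unfolding bnd_fun_def \<tau>_def PC_def[symmetric] R_def[symmetric] l_def[symmetric] times_divide_eq_right[symmetric]
          by (intro add_mono order_refl) auto
      qed
      finally show ?case .
    qed
  qed
  show ?thesis by (intro exI[of _ "4::real"] conjI allI impI) (use main in auto)
qed

end
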